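(* Let $k\geq 2$. Let $N$ be a sufficiently large prime, $G=\mathbb{Z}/N\mathbb{Z}$, and let $f,\nu:G\to\mathbb{R}$ satisfy $0\leq f\leq\nu$. Let $D,S\geq 2$ be integers with $S=o(D)$, and suppose that $\nu$ satisfies the $k$-linear forms conditions with width $S$. Then there is a function $\widetilde f:G\to[0,1]$ with $\mathbb{E}f=\mathbb{E}\widetilde f+o(1)$ such that $|\Lambda_D(f,\dots,f)-\Lambda_D(\widetilde f,\dots,\widetilde f)|=o(1)$.
   Context: Asymptotic convention: $N$ runs through primes tending to infinity; $f,\nu,D,S$ may depend on $N$; $o(1)$ denotes a quantity tending to $0$ as $N\to\infty$ ($k$ fixed), and $S=o(D)$ means $S/D\to 0$. $\mathbb{E}f=\mathbb{E}_{n\in G}f(n)$. Integers are viewed as elements of $G$. $\Lambda_D(f_1,\dots,f_k)=\mathbb{E}_{n\in G}\mathbb{E}_{d\in[D]}f_1(n)f_2(n+d)\cdots f_k(n+(k-1)d)$ with $[D]=\{1,\dots,D\}$. For $\omega=(\omega_i)$ indexed by a subset of $[k]$, $\mathbf{s}^{(\omega)}$ has coordinates $s_i^{(\omega_i)}$. Let $\psi_j(s_1,\dots,s_k)=\sum_{i=1}^k(j-i)s_i$ (independent of $s_j$) and $\psi(s_1,\dots,s_k)=k!\sum_i s_i$; $r(\Omega)$ is the inradius of a convex body $\Omega$. $\nu$ satisfies the $k$-linear forms conditions with width $S$ if, for every fixed $C>0$, uniformly over the indicated convex bodies: (1) for every convex body $\Omega\subset\mathbb{R}^{2k}$ with $r(\Omega)\geq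 S$ and $\Omega\subset[-r(\Omega)^C,r(\Omega)^C]^{2k}$ and all $e(j,\omega)\in\{0,1\}$: $\mathbb{E}_{n\in G}\mathbb{E}_{(\mathbf{s}^{(0)},\mathbf{s}^{(1)})\in\Omega\cap\mathbb{Z}^{2k}}\prod_{j=1}^k\prod_{\omega\in\{0,1\}^{[k]\setminus\{j\}}}\nu(n+\psi_j(\mathbf{s}^{(\omega)}))^{e(j,\omega)}=1+o(1)$; (2) for every such $\Omega\subset\mathbb{R}^{2k}$ and all $e(\omega)\in\{0,1\}$: $\mathbb{E}_{n\in G}\mathbb{E}_{(\mathbf{s}^{(0)},\mathbf{s}^{(1)})\in\Omega\cap\mathbb{Z}^{2k}}\prod_{\omega\in\{0,1\}^k}\nu(n+\psi(\mathbf{s}^{(\omega)}))^{e(\omega)}=1+o(1)$; (3) for every convex body $\Omega\subset\mathbb{R}^2$ with $r(\Omega)\geq S$, $\Omega\subset[-r(\Omega)^C,r(\Omega)^C]^2$, every $1\leq j\leq k$ and all $e,e(i,\tau)\in\{0,1\}$: $\mathbb{E}_{n\in G}\nu(n)^e\,\mathbb{E}_{(d^{(0)},d^{(1)})\in\Omega\cap\mathbb{Z}^2}\prod_{i\neq j}\prod_{\tau\in\{0,1\}}\nu(n+(i-j)d^{(\tau)})^{e(i,\tau)}=1+o(1)$. *)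

theory Defs
  imports "HOL-Analysis.Analysis" "HOL-Number_Theory.Number_Theory"
begin

definition primes_at_top :: "nat filter" where
  "primes_at_top = inf at_top (principal {N. prime N})"

text \<open>
  A function on \<open>\<int>/N\<int>\<close> is represented by a function on \<^typ>\<open>int\<close>, of which only the values on the
  representatives \<open>0, \<dots>, N - 1\<close> matter; \<open>at_residue N h x\<close> is its value at the class of
  the integer \<open>x\<close>.
\<close>

abbreviation ZMod :: "nat \<Rightarrow> int set" where
  "ZMod N \<equiv> carrier (residue_ring (int N))"

definition at_residue :: "nat \<Rightarrow> (int \<Rightarrow> real) \<Rightarrow> int \<Rightarrow> real" where
  "at_residue N h x = h (x mod int N)"

text \<open>Meaningful for finite nonempty \<open>A\<close> only; \<open>avg {} g = 0\<close> is a junk value.\<close>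

definition avg :: "'a set \<Rightarrow> ('a \<Rightarrow> real) \<Rightarrow> real" where
  "avg A g = (\<Sum>x\<in>A. g x) / real (card A)"

definition Lambda :: "nat \<Rightarrow> nat \<Rightarrow> nat \<Rightarrow> (nat \<Rightarrow> int \<Rightarrow> real) \<Rightarrow> real" where
  "Lambda N k D F =
     avg (ZMod N) (\<lambda>n. avg {1..int D} (\<lambda>d.
       \<Prod>j = 1..k. at_residue N (F j) (n + (int j - 1) * d)))"

definition convex_body :: "'a::euclidean_space set \<Rightarrow> bool" where
  "convex_body \<Omega> \<longleftrightarrow> convex \<Omega> \<and> compact \<Omega> \<and> interior \<Omega> \<noteq> {}"

definition inradius :: "'a::euclidean_space set \<Rightarrow> real" where
  "inradius \<Omega> = Sup {r. 0 \<le> r \<and> (\<exists>x. cball x r \<subseteq> \<Omega>)}"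

definition admissible_body :: "real \<Rightarrow> real \<Rightarrow> 'a::euclidean_space set \<Rightarrow> bool" where
  "admissible_body S C \<Omega> \<longleftrightarrow> convex_body \<Omega> \<and> inradius \<Omega> \<ge> S \<and>
     \<Omega> \<subseteq> cbox (- (inradius \<Omega> powr C) *\<^sub>R One) ((inradius \<Omega> powr C) *\<^sub>R One)"

text \<open>
  For a type \<open>'k\<close> with \<open>k\<close> elements, \<open>\<real>\<^sup>2\<^sup>k\<close> is rendered as \<^typ>\<open>(real ^ 'k) \<times> (real ^ 'k)\<close>, the two
  components being \<open>s\<^sup>0\<close> and \<open>s\<^sup>1\<close>.  A bijection \<open>lab\<close> from \<open>'k\<close> to \<open>{1..k}\<close> numbers the
  coordinates.
\<close>

definition int_points_pair :: "((real ^ 'k) \<times> (real ^ 'k)) set \<Rightarrow> ((int ^ 'k) \<times> (int ^ 'k)) set" where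
  "int_points_pair \<Omega> = {(s0, s1). ((\<chi> i. real_of_int (s0 $ i)), (\<chi> i. real_of_int (s1 $ i))) \<in> \<Omega>}"

definition int_points_plane :: "(real \<times> real) set \<Rightarrow> (int \<times> int) set" where
  "int_points_plane \<Omega> = {(d0, d1). (real_of_int d0, real_of_int d1) \<in> \<Omega>}"

definition pick :: "'a \<times> 'a \<Rightarrow> nat \<Rightarrow> 'a" where
  "pick p t = (if t = 0 then fst p else snd p)"

definition select :: "(int ^ 'k) \<times> (int ^ 'k) \<Rightarrow> ('k \<Rightarrow> nat) \<Rightarrow> int ^ 'k" where
  "select p \<omega> = (\<chi> i. pick p (\<omega> i) $ i)"

text \<open>
  The coefficient of \<open>s $ j\<close> in \<open>psi_at lab j s\<close> is zero, so \<open>psi_at lab j (select p \<omega>)\<close> does not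
  depend on the (arbitrary) value at \<open>j\<close> of an \<open>\<omega>\<close> which is indexed by \<open>UNIV - {j}\<close>.
\<close>

definition psi_at :: "('k::finite \<Rightarrow> nat) \<Rightarrow> 'k \<Rightarrow> int ^ 'k \<Rightarrow> int" where
  "psi_at lab j s = (\<Sum>i\<in>UNIV. (int (lab j) - int (lab i)) * s $ i)"

definition psi :: "nat \<Rightarrow> int ^ ('k::finite) \<Rightarrow> int" where
  "psi k s = fact k * (\<Sum>i\<in>UNIV. s $ i)"

text \<open>
  In the three conditions the width \<open>S\<close> and the weight \<open>\<nu>\<close> depend on \<open>N\<close>, and
  \<open>1 + o(1)\<close> is uniform in the body \<open>\<Omega>\<close>, which is quantified after \<open>N\<close>.  Bodies without integer
  points, over which there is nothing to average, are excluded; they exist only when the inradius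
  is smaller than a constant depending on the dimension.
\<close>

definition linear_forms_1 ::
    "('k::finite \<Rightarrow> nat) \<Rightarrow> (nat \<Rightarrow> nat) \<Rightarrow> (nat \<Rightarrow> int \<Rightarrow> real) \<Rightarrow> bool" where
  "linear_forms_1 lab S \<nu> \<longleftrightarrow>
     (\<forall>C>0. \<forall>\<epsilon>>0. \<forall>\<^sub>F N in primes_at_top.
       \<forall>(\<Omega> :: ((real ^ 'k) \<times> (real ^ 'k)) set) (e :: 'k \<Rightarrow> ('k \<Rightarrow> nat) \<Rightarrow> nat).
         admissible_body (real (S N)) C \<Omega> \<longrightarrow> int_points_pair \<Omega> \<noteq> {} \<longrightarrow>
         (\<forall>j. \<forall>\<omega> \<in> (UNIV - {j}) \<rightarrow>\<^sub>E {0, 1}. e j \<omega> \<in> {0, 1}) \<longrightarrow>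
         \<bar>avg (ZMod N) (\<lambda>n. avg (int_points_pair \<Omega>) (\<lambda>p.
            \<Prod>j\<in>UNIV. \<Prod>\<omega> \<in> (UNIV - {j}) \<rightarrow>\<^sub>E {0, 1}.
              at_residue N (\<nu> N) (n + psi_at lab j (select p \<omega>)) ^ e j \<omega>)) - 1\<bar> < \<epsilon>)"

definition linear_forms_2 ::
    "('k::finite \<Rightarrow> nat) \<Rightarrow> nat \<Rightarrow> (nat \<Rightarrow> nat) \<Rightarrow> (nat \<Rightarrow> int \<Rightarrow> real) \<Rightarrow> bool" where
  "linear_forms_2 lab k S \<nu> \<longleftrightarrow>
     (\<forall>C>0. \<forall>\<epsilon>>0. \<forall>\<^sub>F N in primes_at_top.
       \<forall>(\<Omega> :: ((real ^ 'k) \<times> (real ^ 'k)) set) (e :: ('k \<Rightarrow> nat) \<Rightarrow> nat).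
         admissible_body (real (S N)) C \<Omega> \<longrightarrow> int_points_pair \<Omega> \<noteq> {} \<longrightarrow>
         (\<forall>\<omega> \<in> UNIV \<rightarrow>\<^sub>E {0, 1}. e \<omega> \<in> {0, 1}) \<longrightarrow>
         \<bar>avg (ZMod N) (\<lambda>n. avg (int_points_pair \<Omega>) (\<lambda>p.
            \<Prod>\<omega> \<in> UNIV \<rightarrow>\<^sub>E {0, 1}.
              at_residue N (\<nu> N) (n + psi k (select p \<omega>)) ^ e \<omega>)) - 1\<bar> < \<epsilon>)"

definition linear_forms_3 :: "nat \<Rightarrow> (nat \<Rightarrow> nat) \<Rightarrow> (nat \<Rightarrow> int \<Rightarrow> real) \<Rightarrow> bool" where
  "linear_forms_3 k S \<nu> \<longleftrightarrow>
     (\<forall>C>0. \<forall>\<epsilon>>0. \<forall>\<^sub>F N in primes_at_top.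
       \<forall>(\<Omega> :: (real \<times> real) set) (e :: nat) (e' :: nat \<Rightarrow> nat \<Rightarrow> nat). \<forall>j\<in>{1..k}.
         admissible_body (real (S N)) C \<Omega> \<longrightarrow> int_points_plane \<Omega> \<noteq> {} \<longrightarrow>
         e \<in> {0, 1} \<longrightarrow> (\<forall>i\<in>{1..k} - {j}. \<forall>t\<in>{0, 1}. e' i t \<in> {0, 1}) \<longrightarrow>
         \<bar>avg (ZMod N) (\<lambda>n. at_residue N (\<nu> N) n ^ e * avg (int_points_plane \<Omega>) (\<lambda>p.
            \<Prod>i\<in>{1..k} - {j}. \<Prod>t\<in>{0, 1}.
              at_residue N (\<nu> N) (n + (int i - int j) * pick p t) ^ e' i t)) - 1\<bar> < \<epsilon>)"

definition linear_forms_conditions ::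
    "('k::finite \<Rightarrow> nat) \<Rightarrow> nat \<Rightarrow> (nat \<Rightarrow> nat) \<Rightarrow> (nat \<Rightarrow> int \<Rightarrow> real) \<Rightarrow> bool" where
  "linear_forms_conditions lab k S \<nu> \<longleftrightarrow>
     linear_forms_1 lab S \<nu> \<and> linear_forms_2 lab k S \<nu> \<and> linear_forms_3 k S \<nu>"

end

theory Submission
  imports Defs
begin

text \<open>
  The proof combines a dense model theorem with densification.  Dual functions are averages over
  a cube of side \<open>M\<close>, a small multiple of \<open>D\<close>, of products of bounded functions each of which is invariant
  in one direction.  They are closed under products up to a constant, and a weighted
  Gowers--Cauchy--Schwarz inequality makes them orthogonal to \<open>\<nu> - 1\<close> by the second linear forms
  condition.  A boosting argument therefore gives a function with values in \<open>[0,1]\<close> that \<open>f\<close>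
  cannot be distinguished from by dual functions.

  To compare the two counts of progressions, the factors bounded by \<open>\<nu>\<close> are replaced by bounded
  ones, one position \<open>j\<close> at a time.  The average over the other positions is a function
  \<open>F\<^sub>j'\<close>, which by the third condition is bounded by 1 up to an error that is small in mean square, and by
  the first condition \<open>\<nu> - 1\<close> is orthogonal to products of two such functions.  So Cauchy--Schwarz
  removes the factor at \<open>j\<close>, and truncating \<open>F\<^sub>j'\<close> at 1 supplies a bounded factor in its place.
  When all factors are bounded, the count is controlled by dual functions.
\<close>

subsection \<open>Averages\<close>

text \<open>Three scales are at work, \<open>S\<close> below \<open>M\<close> below
  \<open>D\<close>. Shifting \<open>d\<close> by combinations of variables of size \<open>M\<close>
  changes an average over \<open>{1..D}\<close> by \<open>O(M / D)\<close> only, and these variables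
  are the ones that Cauchy--Schwarz doubles; but boxes of side \<open>M\<close> are admissible only
  if \<open>M > 2 * S\<close>. As \<open>S = o(D)\<close>, the ratio \<open>M / D\<close> can be a
  small constant that depends on the accuracy alone.

  The factor \<open>k!\<close> in \<open>psi\<close> makes the shifts integral: when position
  \<open>j\<close> moves by \<open>\<kappa>\<close> times a variable, \<open>d\<close> has to change
  by \<open>\<kappa> / (c j - c l)\<close> times it to hold position \<open>l\<close> fixed.

  The obstacle is that dual functions have bounded factors whereas \<open>f\<close> is bounded only
  by \<open>\<nu>\<close>. Every replacement of a position by a bounded one costs a square root,
  which is harmless because \<open>k\<close> is fixed: first the accuracy \<open>\<tau>\<close> of a
  step is chosen, then \<open>\<eta>\<close> and \<open>M / D\<close>. Models obtained in this way
  depend on the accuracy, so a single sequence is selected at the end.\<close>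

lemma avg_cong: "(\<And>x. x \<in> A \<Longrightarrow> g x = h x) \<Longrightarrow> avg A g = avg A h"
  unfolding avg_def by (metis sum.cong)

lemma avg_add: "avg A (\<lambda>x. g x + h x) = avg A g + avg A h"
  by (simp add: avg_def sum.distrib add_divide_distrib)

lemma avg_diff: "avg A (\<lambda>x. g x - h x) = avg A g - avg A h"
  by (simp add: avg_def sum_subtractf diff_divide_distrib)

lemma avg_minus: "avg A (\<lambda>x. - g x) = - avg A g"
  by (simp add: avg_def sum_negf)

lemma avg_cmult: "avg A (\<lambda>x. c * g x) = c * avg A g"
  by (simp add: avg_def sum_distrib_left)

lemma avg_multc: "avg A (\<lambda>x. g x * c) = avg A g * c"
  by (simp add: avg_def sum_distrib_right)

lemma avg_const: "finite A \<Longrightarrow> A \<noteq> {} \<Longrightarrow> avg A (\<lambda>_. c) = c"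
  by (simp add: avg_def)

lemma avg_sum: "avg A (\<lambda>x. \<Sum>i\<in>I. g i x) = (\<Sum>i\<in>I. avg A (g i))"
  unfolding avg_def by (subst sum.swap) (simp add: sum_divide_distrib)

lemma avg_mono: "(\<And>x. x \<in> A \<Longrightarrow> g x \<le> h x) \<Longrightarrow> avg A g \<le> avg A h"
  unfolding avg_def by (intro divide_right_mono sum_mono) auto

lemma avg_nonneg: "(\<And>x. x \<in> A \<Longrightarrow> 0 \<le> g x) \<Longrightarrow> 0 \<le> avg A g"
  unfolding avg_def by (intro divide_nonneg_nonneg sum_nonneg) auto

lemma avg_le: "finite A \<Longrightarrow> A \<noteq> {} \<Longrightarrow> (\<And>x. x \<in> A \<Longrightarrow> g x \<le> c) \<Longrightarrow> avg A g \<le> c"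
  using avg_mono[of A g "\<lambda>_. c"] by (simp add: avg_const)

lemma abs_avg_le: "\<bar>avg A g\<bar> \<le> avg A (\<lambda>x. \<bar>g x\<bar>)"
  unfolding avg_def by (simp add: divide_right_mono sum_abs)

lemma avg_abs_le: "finite A \<Longrightarrow> A \<noteq> {} \<Longrightarrow> (\<And>x. x \<in> A \<Longrightarrow> \<bar>g x\<bar> \<le> c) \<Longrightarrow> \<bar>avg A g\<bar> \<le> c"
  by (rule order_trans[OF abs_avg_le avg_le])

lemma avg_abs_mono: "(\<And>x. x \<in> A \<Longrightarrow> \<bar>g x\<bar> \<le> h x) \<Longrightarrow> \<bar>avg A g\<bar> \<le> avg A h"
  by (rule order_trans[OF abs_avg_le avg_mono])

lemma avg_swap: "avg A (\<lambda>x. avg B (\<lambda>y. g x y)) = avg B (\<lambda>y. avg A (\<lambda>x. g x y))"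
  unfolding avg_def
  by (simp add: sum_divide_distrib[symmetric] mult.commute) (subst sum.swap, simp)

lemma avg_Times: "avg (A \<times> B) g = avg A (\<lambda>x. avg B (\<lambda>y. g (x, y)))"
  unfolding avg_def
  by (simp add: sum.cartesian_product sum_divide_distrib[symmetric] card_cartesian_product mult.commute)

lemma avg_mult_avg: "avg A g * avg B h = avg A (\<lambda>x. avg B (\<lambda>y. g x * h y))"
  by (simp add: avg_cmult avg_multc)

lemma avg_reindex_bij:
  assumes "bij_betw \<phi> A B"
  shows "avg B g = avg A (\<lambda>x. g (\<phi> x))"
  using assms by (simp add: avg_def bij_betw_same_card sum.reindex_bij_betw)

text \<open>Each \<open>w x\<close> is split as \<open>sqrt (w x) * sqrt (w x)\<close>. Keeping the
  weight to the first power on both sides matters because the weights are products of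
  \<open>\<nu>\<close>, whose squares the linear forms conditions do not control.\<close>

lemma weighted_Cauchy_Schwarz:
  assumes "\<And>x. x \<in> A \<Longrightarrow> \<bar>a x\<bar> \<le> w x"
  shows "(avg A (\<lambda>x. a x * b x))\<^sup>2 \<le> avg A w * avg A (\<lambda>x. w x * (b x)\<^sup>2)"
proof -
  have w: "0 \<le> w x" if "x \<in> A" for x using assms[OF that] by linarith
  have "\<bar>\<Sum>x\<in>A. a x * b x\<bar> \<le> (\<Sum>x\<in>A. w x * \<bar>b x\<bar>)"
    by (rule order_trans[OF sum_abs]) (auto intro!: sum_mono simp: abs_mult mult_right_mono assms)
  also have "\<dots> = (\<Sum>x\<in>A. sqrt (w x) * (sqrt (w x) * \<bar>b x\<bar>))"
    using w by (intro sum.cong) (auto simp: mult.assoc[symmetric])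
  finally have "(\<Sum>x\<in>A. a x * b x)\<^sup>2 \<le> (\<Sum>x\<in>A. sqrt (w x) * (sqrt (w x) * \<bar>b x\<bar>))\<^sup>2"
    by (metis abs_ge_zero power2_abs power_mono)
  also have "\<dots> \<le> (\<Sum>x\<in>A. (sqrt (w x))\<^sup>2) * (\<Sum>x\<in>A. (sqrt (w x) * \<bar>b x\<bar>)\<^sup>2)"
    by (rule Cauchy_Schwarz_ineq_sum)
  also have "\<dots> = (\<Sum>x\<in>A. w x) * (\<Sum>x\<in>A. w x * (b x)\<^sup>2)"
    using w by (simp add: power_mult_distrib)
  finally show ?thesis
    unfolding avg_def by (simp add: power2_eq_square divide_right_mono)
qed

lemma finite_box: "(\<And>i. finite (B i)) \<Longrightarrow> finite (PiE UNIV B)" for B :: "'i::finite \<Rightarrow> 'b set"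
  by (intro finite_PiE) auto

text \<open>Exchanging \<open>s i\<close> with the extra variable is an involution of
  \<open>PiE UNIV B \<times> B i\<close>, so a fresh value can be carried along as a dummy and then
  swapped in.\<close>

lemma box_resample:
  fixes B :: "'i::finite \<Rightarrow> 'b set"
  assumes "\<And>i. finite (B i)" "\<And>i. B i \<noteq> {}"
  shows "avg (PiE UNIV B) h = avg (PiE UNIV B) (\<lambda>s. avg (B i) (\<lambda>x. h (s(i := x))))"
proof -
  let ?X = "PiE UNIV B"
  have "avg ?X h = avg (?X \<times> B i) (\<lambda>(s, x). h s)"
    using assms by (simp add: avg_Times avg_const)
  also have "\<dots> = avg (?X \<times> B i) (\<lambda>p. (\<lambda>(s, x). h s) ((\<lambda>(s, x). (s(i := x), s i)) p))"
  proof (rule avg_reindex_bij)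
    show "bij_betw (\<lambda>(s, x). (s(i := x), s i)) (?X \<times> B i) (?X \<times> B i)"
      by (rule bij_betw_byWitness[where f' = "\<lambda>(s, x). (s(i := x), s i)"])
         (auto simp: PiE_iff)
  qed
  also have "\<dots> = avg ?X (\<lambda>s. avg (B i) (\<lambda>x. h (s(i := x))))"
    by (simp add: avg_Times)
  finally show ?thesis .
qed

subsection \<open>A weighted Gowers--Cauchy--Schwarz inequality\<close>

text \<open>The vertex of the doubled cube whose index \<open>\<omega>\<close> is the indicator
  function of \<open>A\<close>. With sets as indices, doubling one more variable amounts to
  \<open>prod_Pow_insert\<close>.\<close>

definition mix :: "'i set \<Rightarrow> ('i \<Rightarrow> 'b) \<Rightarrow> ('i \<Rightarrow> 'b) \<Rightarrow> 'i \<Rightarrow> 'b" where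
  "mix A s t = (\<lambda>i. if i \<in> A then t i else s i)"

lemma mix_empty: "mix {} s t = s"
  by (simp add: mix_def)

lemma mix_upd_left: "i \<in> A \<Longrightarrow> mix A (s(i := x)) t = mix A s t"
  "i \<notin> A \<Longrightarrow> mix A (s(i := x)) t = (mix A s t)(i := x)"
  by (auto simp: mix_def fun_eq_iff)

lemma mix_upd_right: "i \<notin> A \<Longrightarrow> mix A s (t(i := x)) = mix A s t"
  "i \<in> A \<Longrightarrow> mix A s (t(i := x)) = (mix A s t)(i := x)"
  by (auto simp: mix_def fun_eq_iff)

lemma mix_insert: "i \<notin> A \<Longrightarrow> mix A (s(i := t i)) t = mix (insert i A) s t"
  by (auto simp: mix_def fun_eq_iff)

lemma prod_Pow_insert:
  fixes g :: "'a set \<Rightarrow> 'b::comm_monoid_mult"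
  assumes "finite J" "i \<notin> J"
  shows "(\<Prod>A\<in>Pow (insert i J). g A) = (\<Prod>A\<in>Pow J. g A * g (insert i A))"
proof -
  have inj: "inj_on (insert i) (Pow J)"
    by (rule inj_on_inverseI[where g = "\<lambda>A. A - {i}"]) (use assms in auto)
  have "(\<Prod>A\<in>Pow (insert i J). g A) = (\<Prod>A\<in>Pow J. g A) * (\<Prod>A\<in>insert i ` Pow J. g A)"
    unfolding Pow_insert using assms by (intro prod.union_disjoint) auto
  also have "(\<Prod>A\<in>insert i ` Pow J. g A) = (\<Prod>A\<in>Pow J. g (insert i A))"
    by (simp add: prod.reindex[OF inj])
  finally show ?thesis by (simp add: prod.distrib)
qed

text \<open>\<open>\<alpha>\<close> and \<open>\<omega>\<close> ignore coordinate \<open>i\<close>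
  of \<open>s\<close>, so the average over it can be moved onto \<open>\<beta>\<close>. Squaring
  gives two independent copies of that coordinate; \<open>t i\<close>, on which neither
  \<open>\<omega>\<close> nor \<open>\<beta>\<close> depends, serves as the second one.\<close>

lemma Cauchy_Schwarz_resample:
  fixes B :: "'i::finite \<Rightarrow> 'b set" and \<alpha> \<beta> \<omega> :: "'p \<Rightarrow> ('i \<Rightarrow> 'b) \<Rightarrow> ('i \<Rightarrow> 'b) \<Rightarrow> real"
  defines "X \<equiv> PiE UNIV B"
  assumes B: "\<And>i. finite (B i)" "\<And>i. B i \<noteq> {}"
    and \<alpha>: "\<And>p s t x. \<alpha> p (s(i := x)) t = \<alpha> p s t"
    and \<omega>: "\<And>p s t x. \<omega> p (s(i := x)) t = \<omega> p s t" "\<And>p s t x. \<omega> p s (t(i := x)) = \<omega> p s t"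
    and \<beta>: "\<And>p s t x. \<beta> p s (t(i := x)) = \<beta> p s t"
    and le: "\<And>p s t. p \<in> P \<Longrightarrow> \<bar>\<alpha> p s t\<bar> \<le> \<omega> p s t"
  shows "(avg P (\<lambda>p. avg X (\<lambda>s. avg X (\<lambda>t. \<alpha> p s t * \<beta> p s t))))\<^sup>2 \<le>
    avg P (\<lambda>p. avg X (\<lambda>s. avg X (\<lambda>t. \<omega> p s t))) *
    avg P (\<lambda>p. avg X (\<lambda>s. avg X (\<lambda>t. \<omega> p s t * (\<beta> p s t * \<beta> p (s(i := t i)) t))))"
proof -
  let ?T = "P \<times> X \<times> X"
  let ?b = "\<lambda>(p, s, t). avg (B i) (\<lambda>x. \<beta> p (s(i := x)) t)"
  let ?a = "\<lambda>(p, s, t). \<alpha> p s t"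
  let ?w = "\<lambda>(p, s, t). \<omega> p s t"
  have res: "avg X h = avg X (\<lambda>s. avg (B i) (\<lambda>x. h (s(i := x))))" for h :: "('i \<Rightarrow> 'b) \<Rightarrow> real"
    unfolding X_def by (rule box_resample[OF B])
  have 1: "avg P (\<lambda>p. avg X (\<lambda>s. avg X (\<lambda>t. \<alpha> p s t * \<beta> p s t))) = avg ?T (\<lambda>q. ?a q * ?b q)"
  proof -
    have "avg X (\<lambda>s. avg X (\<lambda>t. \<alpha> p s t * \<beta> p s t)) =
      avg X (\<lambda>s. avg X (\<lambda>t. \<alpha> p s t * avg (B i) (\<lambda>x. \<beta> p (s(i := x)) t)))" for p
      by (subst res, subst avg_swap[of "B i"]) (simp add: \<alpha> avg_cmult)
    then show ?thesis by (simp add: avg_Times)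
  qed
  have 2: "avg ?T (\<lambda>q. ?w q * (?b q)\<^sup>2) =
    avg P (\<lambda>p. avg X (\<lambda>s. avg X (\<lambda>t. \<omega> p s t * (\<beta> p s t * \<beta> p (s(i := t i)) t))))"
  proof -
    have "avg X (\<lambda>s. avg X (\<lambda>t. \<omega> p s t * (\<beta> p s t * \<beta> p (s(i := t i)) t))) =
      avg X (\<lambda>s. avg X (\<lambda>t. \<omega> p s t * (avg (B i) (\<lambda>x. \<beta> p (s(i := x)) t))\<^sup>2))" for p
    proof -
      have "avg X (\<lambda>s. avg X (\<lambda>t. \<omega> p s t * (\<beta> p s t * \<beta> p (s(i := t i)) t))) =
        avg X (\<lambda>s. avg (B i) (\<lambda>x. avg X (\<lambda>t. \<omega> p s t * (\<beta> p (s(i := x)) t * \<beta> p (s(i := t i)) t))))"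
        by (subst res) (simp add: \<omega>)
      also have "\<dots> = avg X (\<lambda>s. avg X (\<lambda>t. avg (B i) (\<lambda>x. \<omega> p s t * (\<beta> p (s(i := x)) t * \<beta> p (s(i := t i)) t))))"
        by (subst avg_swap[of "B i"]) simp
      also have "\<dots> = avg X (\<lambda>s. avg X (\<lambda>t. avg (B i) (\<lambda>y.
          avg (B i) (\<lambda>x. \<omega> p s t * (\<beta> p (s(i := x)) t * \<beta> p (s(i := y)) t)))))"
        by (subst (2) res) (simp add: \<omega> \<beta>)
      finally show ?thesis
        by (simp add: avg_cmult avg_multc power2_eq_square)
    qed
    then show ?thesis by (simp add: avg_Times)
  qed
  have "(avg ?T (\<lambda>q. ?a q * ?b q))\<^sup>2 \<le> avg ?T ?w * avg ?T (\<lambda>q. ?w q * (?b q)\<^sup>2)"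
    by (rule weighted_Cauchy_Schwarz) (auto simp: le)
  then show ?thesis unfolding 1 2 by (simp add: avg_Times)
qed

text \<open>
  The stage of the iteration at which exactly the variables in \<open>J\<close> have been doubled: the factors
  \<open>a l\<close> with \<open>l \<in> J\<close> have been replaced by their majorants \<open>w l\<close>.
\<close>

definition gcs_form ::
    "'p set \<Rightarrow> ('i \<Rightarrow> 'b) set \<Rightarrow> ('p \<Rightarrow> ('i \<Rightarrow> 'b) \<Rightarrow> real) \<Rightarrow> ('i \<Rightarrow> 'p \<Rightarrow> ('i \<Rightarrow> 'b) \<Rightarrow> real) \<Rightarrow>
     ('i \<Rightarrow> 'p \<Rightarrow> ('i \<Rightarrow> 'b) \<Rightarrow> real) \<Rightarrow> 'i set \<Rightarrow> 'i set \<Rightarrow> real" where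
  "gcs_form P X g w a I J = avg P (\<lambda>p. avg X (\<lambda>s. avg X (\<lambda>t.
     (\<Prod>A\<in>Pow J. g p (mix A s t)) *
     (\<Prod>l\<in>J. \<Prod>A\<in>Pow (J - {l}). w l p (mix A s t)) *
     (\<Prod>l\<in>I - J. \<Prod>A\<in>Pow J. a l p (mix A s t)))))"

text \<open>Cauchy--Schwarz in coordinate \<open>i\<close>, with the factors \<open>a i\<close> as
  \<open>\<alpha>\<close> and all others as \<open>\<beta>\<close>. Doubling adds the vertices
  containing \<open>i\<close> to the factors in \<open>\<beta>\<close>; the majorants
  \<open>w i\<close> do not depend on this coordinate and stay on \<open>Pow J\<close>, which is
  \<open>Pow (insert i J - {i})\<close>.\<close>

lemma gcs_step:
  fixes B :: "'i::finite \<Rightarrow> 'b set"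
  defines "X \<equiv> PiE UNIV B"
  assumes B: "\<And>i. finite (B i)" "\<And>i. B i \<noteq> {}"
    and a: "\<And>l p s x. l \<in> I \<Longrightarrow> a l p (s(l := x)) = a l p s"
    and w: "\<And>l p s x. l \<in> I \<Longrightarrow> w l p (s(l := x)) = w l p s"
    and aw: "\<And>l p s. l \<in> I \<Longrightarrow> p \<in> P \<Longrightarrow> \<bar>a l p s\<bar> \<le> w l p s"
    and iJ: "J \<subseteq> I" "i \<in> I" "i \<notin> J"
  shows "(gcs_form P X g w a I J)\<^sup>2 \<le>
    avg P (\<lambda>p. avg X (\<lambda>s. avg X (\<lambda>t. \<Prod>A\<in>Pow J. w i p (mix A s t)))) *
    gcs_form P X g w a I (insert i J)"
proof -
  define \<alpha> where "\<alpha> = (\<lambda>p s t. \<Prod>A\<in>Pow J. a i p (mix A s t))"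
  define \<omega> where "\<omega> = (\<lambda>p s t. \<Prod>A\<in>Pow J. w i p (mix A s t))"
  define \<beta> where "\<beta> = (\<lambda>p s t. (\<Prod>A\<in>Pow J. g p (mix A s t)) *
     (\<Prod>l\<in>J. \<Prod>A\<in>Pow (J - {l}). w l p (mix A s t)) *
     (\<Prod>l\<in>I - insert i J. \<Prod>A\<in>Pow J. a l p (mix A s t)))"
  have fin: "finite J" by simp
  have notin: "i \<notin> A" if "A \<in> Pow J \<or> A \<in> Pow (J - {l})" for A l using iJ that by auto
  have 1: "gcs_form P X g w a I J = avg P (\<lambda>p. avg X (\<lambda>s. avg X (\<lambda>t. \<alpha> p s t * \<beta> p s t)))"
  proof -
    have "I - J = insert i (I - insert i J)" using iJ by auto
    then have "(\<Prod>l\<in>I - J. \<Prod>A\<in>Pow J. a l p (mix A s t)) =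
      \<alpha> p s t * (\<Prod>l\<in>I - insert i J. \<Prod>A\<in>Pow J. a l p (mix A s t))" for p s t
      by (simp add: \<alpha>_def)
    then show ?thesis unfolding gcs_form_def \<beta>_def by (simp add: algebra_simps)
  qed
  have 2: "gcs_form P X g w a I (insert i J) =
    avg P (\<lambda>p. avg X (\<lambda>s. avg X (\<lambda>t. \<omega> p s t * (\<beta> p s t * \<beta> p (s(i := t i)) t))))"
  proof -
    have "(\<Prod>A\<in>Pow (insert i J). g p (mix A s t)) =
       (\<Prod>A\<in>Pow J. g p (mix A s t)) * (\<Prod>A\<in>Pow J. g p (mix A (s(i := t i)) t))" for p s t
      unfolding prod_Pow_insert[OF fin iJ(3)] prod.distrib[symmetric]
      by (intro prod.cong refl arg_cong2[where f = "(*)"]) (auto simp: mix_insert notin)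
    moreover have "(\<Prod>l\<in>I - insert i J. \<Prod>A\<in>Pow (insert i J). a l p (mix A s t)) =
       (\<Prod>l\<in>I - insert i J. \<Prod>A\<in>Pow J. a l p (mix A s t)) *
       (\<Prod>l\<in>I - insert i J. \<Prod>A\<in>Pow J. a l p (mix A (s(i := t i)) t))" for p s t
      unfolding prod_Pow_insert[OF fin iJ(3)] prod.distrib[symmetric]
      by (intro prod.cong refl arg_cong2[where f = "(*)"]) (auto simp: mix_insert notin)
    moreover have "(\<Prod>l\<in>insert i J. \<Prod>A\<in>Pow (insert i J - {l}). w l p (mix A s t)) =
       \<omega> p s t * (\<Prod>l\<in>J. \<Prod>A\<in>Pow (J - {l}). w l p (mix A s t)) *
       (\<Prod>l\<in>J. \<Prod>A\<in>Pow (J - {l}). w l p (mix A (s(i := t i)) t))" for p s t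
    proof -
      have "(\<Prod>l\<in>insert i J. \<Prod>A\<in>Pow (insert i J - {l}). w l p (mix A s t)) =
        \<omega> p s t * (\<Prod>l\<in>J. \<Prod>A\<in>Pow (insert i J - {l}). w l p (mix A s t))"
        using iJ by (simp add: \<omega>_def)
      also have "(\<Prod>l\<in>J. \<Prod>A\<in>Pow (insert i J - {l}). w l p (mix A s t)) =
        (\<Prod>l\<in>J. \<Prod>A\<in>Pow (J - {l}). w l p (mix A s t) * w l p (mix A (s(i := t i)) t))"
      proof (rule prod.cong[OF refl])
        fix l assume "l \<in> J"
        then have eq: "insert i J - {l} = insert i (J - {l})" using iJ by auto
        show "(\<Prod>A\<in>Pow (insert i J - {l}). w l p (mix A s t)) =
          (\<Prod>A\<in>Pow (J - {l}). w l p (mix A s t) * w l p (mix A (s(i := t i)) t))"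
          unfolding eq by (subst prod_Pow_insert)
            (use iJ in \<open>auto intro!: prod.cong arg_cong2[where f = "(*)"] simp: mix_insert notin subset_iff\<close>)
      qed
      finally show ?thesis by (simp add: prod.distrib)
    qed
    ultimately show ?thesis unfolding gcs_form_def \<beta>_def by (simp add: algebra_simps)
  qed
  have inv: "h p (mix A (s(i := x)) t) = h p (mix A s t)"
    if "A \<in> Pow J" "\<And>p s x. h p (s(i := x)) = h p s" for h :: "'p \<Rightarrow> ('i \<Rightarrow> 'b) \<Rightarrow> real" and p A s t x
    using notin that by (simp add: mix_upd_left)
  have 3: "avg P (\<lambda>p. avg X (\<lambda>s. avg X (\<lambda>t. \<Prod>A\<in>Pow J. w i p (mix A s t)))) =
    avg P (\<lambda>p. avg X (\<lambda>s. avg X (\<lambda>t. \<omega> p s t)))"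
    by (simp add: \<omega>_def)
  show ?thesis unfolding 1 2 3 unfolding X_def
  proof (rule Cauchy_Schwarz_resample[OF B])
    show "\<alpha> p (s(i := x)) t = \<alpha> p s t" for p s t x
      unfolding \<alpha>_def by (intro prod.cong refl inv a iJ)
    show "\<omega> p (s(i := x)) t = \<omega> p s t" for p s t x
      unfolding \<omega>_def by (intro prod.cong refl inv w iJ)
    show "\<omega> p s (t(i := x)) = \<omega> p s t" for p s t x
      unfolding \<omega>_def by (intro prod.cong refl) (simp add: mix_upd_right notin)
    show "\<beta> p s (t(i := x)) = \<beta> p s t" for p s t x
      unfolding \<beta>_def
      by (intro arg_cong2[where f = "(*)"] prod.cong refl; subst mix_upd_right(1); use notin in blast)
    show "\<bar>\<alpha> p s t\<bar> \<le> \<omega> p s t" if "p \<in> P" for p s t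
      unfolding \<alpha>_def \<omega>_def abs_prod by (intro prod_mono) (auto simp: aw iJ that)
  qed
qed

text \<open>The variables in \<open>I\<close> are doubled one after another by
  \<open>gcs_step\<close>; each time the previous bound is squared and a mean of majorants, at most
  2 by \<open>W\<close>, is lost. The parameters \<open>p\<close> are never doubled.\<close>

lemma gowers_Cauchy_Schwarz:
  fixes B :: "'i::finite \<Rightarrow> 'b set"
  defines "X \<equiv> PiE UNIV B"
  assumes B: "\<And>i. finite (B i)" "\<And>i. B i \<noteq> {}"
    and a: "\<And>l p s x. l \<in> I \<Longrightarrow> a l p (s(l := x)) = a l p s"
    and w: "\<And>l p s x. l \<in> I \<Longrightarrow> w l p (s(l := x)) = w l p s"
    and aw: "\<And>l p s. l \<in> I \<Longrightarrow> p \<in> P \<Longrightarrow> \<bar>a l p s\<bar> \<le> w l p s"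
    and W: "\<And>i J. i \<in> I \<Longrightarrow> J \<subseteq> I - {i} \<Longrightarrow>
      avg P (\<lambda>p. avg X (\<lambda>s. avg X (\<lambda>t. \<Prod>A\<in>Pow J. w i p (mix A s t)))) \<le> 2"
  shows "\<bar>avg P (\<lambda>p. avg X (\<lambda>s. g p s * (\<Prod>l\<in>I. a l p s)))\<bar> ^ (2 ^ card I) \<le>
    2 ^ (2 ^ card I) * \<bar>avg P (\<lambda>p. avg X (\<lambda>s. avg X (\<lambda>t.
      (\<Prod>A\<in>Pow I. g p (mix A s t)) * (\<Prod>l\<in>I. \<Prod>A\<in>Pow (I - {l}). w l p (mix A s t)))))\<bar>"
proof -
  let ?Q = "gcs_form P X g w a I"
  have fX: "finite X" "X \<noteq> {}" unfolding X_def using B by (auto intro: finite_box simp: PiE_eq_empty_iff)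
  have main: "J \<subseteq> I \<Longrightarrow> \<bar>?Q {}\<bar> ^ (2 ^ card J) \<le> 2 ^ (2 ^ card J - 1) * \<bar>?Q J\<bar>" for J
  proof (induction J rule: finite_induct[OF finite])
    case 1 then show ?case by simp
  next
    case (2 i J)
    have st: "(?Q J)\<^sup>2 \<le> 2 * \<bar>?Q (insert i J)\<bar>"
    proof -
      let ?W = "avg P (\<lambda>p. avg X (\<lambda>s. avg X (\<lambda>t. \<Prod>A\<in>Pow J. w i p (mix A s t))))"
      have "(?Q J)\<^sup>2 \<le> ?W * ?Q (insert i J)"
        unfolding X_def by (rule gcs_step[OF B a w aw]) (use 2 in auto)
      also have "\<dots> \<le> ?W * \<bar>?Q (insert i J)\<bar>"
      proof (rule mult_left_mono)
        show "0 \<le> ?W" 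
        proof (intro avg_nonneg prod_nonneg)
          fix p s t A assume p: "p \<in> P"
          have "i \<in> I" using 2 by auto
          from aw[OF this p, of "mix A s t"] show "0 \<le> w i p (mix A s t)" by linarith
        qed
      qed simp
      also have "\<dots> \<le> 2 * \<bar>?Q (insert i J)\<bar>"
        by (intro mult_right_mono W) (use 2 in auto)
      finally show ?thesis .
    qed
    have card: "(2::nat) ^ card (insert i J) = 2 * 2 ^ card J" using 2 by simp
    \<comment> \<open>Squaring doubles the exponent of 2 and the new mean of majorants adds 1;
      starting from 0 this gives \<open>2 ^ card J - 1\<close>.\<close>
    have e: "2 * (2 ^ card J - 1) + 1 = 2 * 2 ^ card J - (1::nat)"
      using one_le_power[of "2::nat" "card J"] by linarith
    have "\<bar>?Q {}\<bar> ^ (2 ^ card (insert i J)) = (\<bar>?Q {}\<bar> ^ (2 ^ card J))\<^sup>2"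
      unfolding card by (simp add: power_mult[symmetric] mult.commute)
    also have "\<dots> \<le> (2 ^ (2 ^ card J - 1) * \<bar>?Q J\<bar>)\<^sup>2"
      by (intro power_mono) (use 2 in auto)
    also have "\<dots> = 2 ^ (2 * (2 ^ card J - 1)) * (?Q J)\<^sup>2"
      by (simp add: power_mult_distrib power_mult[symmetric] mult.commute)
    also have "\<dots> \<le> 2 ^ (2 * (2 ^ card J - 1)) * (2 * \<bar>?Q (insert i J)\<bar>)"
      by (intro mult_left_mono st) auto
    also have "\<dots> = 2 ^ (2 * (2 ^ card J - 1) + 1) * \<bar>?Q (insert i J)\<bar>"
      by simp
    also have "\<dots> = 2 ^ (2 ^ card (insert i J) - 1) * \<bar>?Q (insert i J)\<bar>"
      unfolding e card ..
    finally show ?case .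
  qed
  have "\<bar>?Q {}\<bar> ^ (2 ^ card I) \<le> 2 ^ (2 ^ card I - 1) * \<bar>?Q I\<bar>" by (rule main) simp
  also have "\<dots> \<le> 2 ^ (2 ^ card I) * \<bar>?Q I\<bar>"
    by (intro mult_right_mono power_increasing) auto
  finally show ?thesis
    unfolding gcs_form_def by (simp add: mix_empty avg_const[OF fX])
qed

subsection \<open>The dense model theorem\<close>

definition clip :: "real \<Rightarrow> real" where
  "clip z = max 0 (min 1 z)"

text \<open>The antiderivative of \<open>clip\<close>, which serves as the potential of the boosting argument.\<close>

definition clip_potential :: "real \<Rightarrow> real" where
  "clip_potential z = clip z * z - (clip z)\<^sup>2 / 2"

lemma clip_bounds: "0 \<le> clip z" "clip z \<le> 1"
  by (auto simp: clip_def)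

text \<open>\<open>clip\<close> is the projection onto the unit interval and 1-Lipschitz, so its
  antiderivative has a quadratic upper bound with constant 1. The proof completes a square and uses
  that \<open>z - clip z\<close> points out of the interval.\<close>

lemma clip_potential_step: "clip_potential (z + \<delta>) \<le> clip_potential z + clip z * \<delta> + \<delta>\<^sup>2 / 2"
proof -
  have *: "(clip z - clip (z + \<delta>)) * (z - clip z) \<ge> 0"
  proof (cases "z \<le> 0 \<or> z \<ge> 1")
    case True then show ?thesis
      by (auto simp: clip_def zero_le_mult_iff)
  next
    case False then show ?thesis by (simp add: clip_def)
  qed
  have "clip_potential z + clip z * \<delta> + \<delta>\<^sup>2 / 2 - clip_potential (z + \<delta>) =
    (clip z - clip (z + \<delta>)) * (z - clip z) + (clip z - clip (z + \<delta>) + \<delta>)\<^sup>2 / 2"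
    unfolding clip_potential_def by (simp add: power2_eq_square field_simps)
  moreover have "(clip z - clip (z + \<delta>) + \<delta>)\<^sup>2 / 2 \<ge> 0" by simp
  ultimately show ?thesis using * by linarith
qed

text \<open>\<open>clip_potential z\<close> is the maximum of \<open>a * z - a\<^sup>2 / 2\<close>
  over \<open>a\<close> in the unit interval, so for \<open>a \<le> 1\<close> the left side is at
  most 1/2. Larger values of \<open>a\<close> are charged to \<open>(b - 1) * max z 0\<close>, which
  becomes a correlation with \<open>\<nu> - 1\<close>.\<close>

lemma clip_potential_lower:
  assumes "0 \<le> a" "a \<le> b"
  shows "a * z - clip_potential z \<le> 1 / 2 + (b - 1) * max z 0"
proof (cases "z \<le> 0")
  case True
  then have "a * z \<le> 0" using assms by (simp add: mult_nonneg_nonpos)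
  then show ?thesis using True by (simp add: clip_potential_def clip_def)
next
  case False
  have "a * z \<le> b * z" using assms False by (intro mult_right_mono) auto
  moreover have "z - clip_potential z \<le> 1 / 2"
  proof (cases "z \<le> 1")
    case True
    have "0 \<le> (z - 1)\<^sup>2" by simp
    then show ?thesis using True False
      by (simp add: clip_potential_def clip_def power2_eq_square algebra_simps)
  qed (simp add: clip_potential_def clip_def)
  moreover have "(b - 1) * max z 0 = b * z - z" using False by (simp add: algebra_simps)
  ultimately show ?thesis by linarith
qed

text \<open>The correlations of \<open>\<nu> - 1\<close> are controlled only for polynomials in the
  test functions, so the positive part in \<open>clip_potential_lower\<close> has to be replaced by
  a polynomial.\<close>

lemma pos_part_polynomial_approx:
  assumes "0 < e"
  obtains a :: "nat \<Rightarrow> real" and n where "\<And>z. \<bar>z\<bar> \<le> L \<Longrightarrow> \<bar>max z 0 - (\<Sum>i\<le>n. a i * z ^ i)\<bar> \<le> e"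
proof -
  obtain g where g: "real_polynomial_function g" "\<And>x. x \<in> {-L..L} \<Longrightarrow> \<bar>max x 0 - g x\<bar> < e"
    by (rule Stone_Weierstrass_real_polynomial_function[of "{-L..L}" "\<lambda>x::real. max x 0" e])
       (use assms in \<open>auto intro!: continuous_intros\<close>)
  then obtain a n where "g = (\<lambda>x. \<Sum>i\<le>n. a i * x ^ i)"
    using real_polynomial_function_iff_sum by metis
  with g(2) that show thesis by (metis abs_le_iff atLeastAtMost_iff less_eq_real_def minus_le_iff)
qed

text \<open>One factor of the power at a time is expanded and moved into \<open>L\<close>; the list
  is there to make the induction on \<open>r\<close> work.\<close>

lemma avg_power_sum_bound:
  fixes \<phi> :: "nat \<Rightarrow> 'a \<Rightarrow> real"
  assumes \<phi>: "\<And>i. i < T \<Longrightarrow> \<phi> i \<in> \<Phi>" and K: "0 \<le> K"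
    and orth: "\<And>L. set L \<subseteq> \<Phi> \<Longrightarrow> \<bar>avg G (\<lambda>x. w x * prod_list (map (\<lambda>\<phi>. \<phi> x) L))\<bar> \<le> K ^ length L * \<eta>"
  shows "set L \<subseteq> \<Phi> \<Longrightarrow>
    \<bar>avg G (\<lambda>x. w x * ((\<Sum>i<T. \<phi> i x) ^ r * prod_list (map (\<lambda>\<phi>. \<phi> x) L)))\<bar> \<le> real T ^ r * K ^ (r + length L) * \<eta>"
proof (induction r arbitrary: L)
  case 0
  then show ?case using orth by simp
next
  case (Suc r)
  have "avg G (\<lambda>x. w x * ((\<Sum>i<T. \<phi> i x) ^ Suc r * prod_list (map (\<lambda>\<phi>. \<phi> x) L))) =
    (\<Sum>j<T. avg G (\<lambda>x. w x * ((\<Sum>i<T. \<phi> i x) ^ r * prod_list (map (\<lambda>\<phi>. \<phi> x) (\<phi> j # L)))))"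
    unfolding avg_sum[symmetric]
    by (intro avg_cong) (simp add: sum_distrib_left sum_distrib_right mult_ac)
  also have "\<bar>\<dots>\<bar> \<le> (\<Sum>j<T. real T ^ r * K ^ (r + length (\<phi> 0 # L)) * \<eta>)"
    by (rule order_trans[OF sum_abs], rule sum_mono)
       (use Suc.IH[of "\<phi> _ # L"] Suc.prems \<phi> in auto)
  also have "\<dots> = real T ^ Suc r * K ^ (Suc r + length L) * \<eta>"
    by simp
  finally show ?case .
qed

text \<open>If every candidate \<open>clip (F t)\<close> fails, each failure supplies a test
  function. Adding \<open>\<epsilon>\<close> times it to the score \<open>F\<close> for
  \<open>T\<close> rounds accumulates more correlation than the potential permits. The polynomial
  depends on \<open>\<epsilon>\<close> only, so \<open>\<eta>\<close> can be fixed before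
  \<open>G\<close>, \<open>\<Phi>\<close> and the functions.\<close>

theorem dense_model:
  fixes \<epsilon> K :: real
  assumes \<epsilon>: "0 < \<epsilon>" and K: "1 \<le> K"
  obtains \<eta> where "0 < \<eta>"
    "\<And>(G :: 'a set) \<Phi> f \<nu>.
      \<lbrakk>finite G; G \<noteq> {}; \<And>\<phi> x. \<phi> \<in> \<Phi> \<Longrightarrow> \<bar>\<phi> x\<bar> \<le> 1; \<And>\<phi>. \<phi> \<in> \<Phi> \<Longrightarrow> (\<lambda>x. - \<phi> x) \<in> \<Phi>;
       \<And>x. x \<in> G \<Longrightarrow> 0 \<le> f x; \<And>x. x \<in> G \<Longrightarrow> f x \<le> \<nu> x; avg G \<nu> \<le> 2;
       \<And>L. set L \<subseteq> \<Phi> \<Longrightarrow> \<bar>avg G (\<lambda>x. (\<nu> x - 1) * prod_list (map (\<lambda>\<phi>. \<phi> x) L))\<bar> \<le> K ^ length L * \<eta>\<rbrakk>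
      \<Longrightarrow> \<exists>h. (\<forall>x. 0 \<le> h x \<and> h x \<le> 1) \<and> (\<forall>\<phi>\<in>\<Phi>. \<bar>avg G (\<lambda>x. (f x - h x) * \<phi> x)\<bar> \<le> \<epsilon>)"
proof -
  \<comment> \<open>The rounds gain at least \<open>T * \<epsilon>\<^sup>2\<close>, while the
    potential allows at most \<open>1 + T * \<epsilon>\<^sup>2 / 2\<close>; these conflict once
    \<open>T * \<epsilon>\<^sup>2 > 2\<close>.\<close>
  define T where "T = nat \<lceil>2 / \<epsilon>\<^sup>2\<rceil> + 1"
  have T: "2 / \<epsilon>\<^sup>2 < real T" unfolding T_def by linarith
  define L0 where "L0 = \<epsilon> * real T"
  \<comment> \<open>\<open>L0\<close> bounds the final score. The mean of \<open>\<nu> + 1\<close>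
    is at most 3, so accuracy 1/12 costs 1/4; the choice of \<open>\<eta>\<close> below costs the
    other 1/4.\<close>
  obtain a n where a: "\<And>z. \<bar>z\<bar> \<le> L0 \<Longrightarrow> \<bar>max z 0 - (\<Sum>i\<le>n. a i * z ^ i)\<bar> \<le> 1/12"
    by (rule pos_part_polynomial_approx[of "1/12" L0]) auto
  define A where "A = (\<Sum>r\<le>n. \<bar>a r\<bar> * (L0 * K) ^ r)"
  have A: "A \<ge> 0" unfolding A_def L0_def using \<epsilon> K by (intro sum_nonneg) auto
  define \<eta> where "\<eta> = 1 / (4 * (A + 1))"
  have \<eta>: "0 < \<eta>" "A * \<eta> \<le> 1/4" unfolding \<eta>_def using A by (auto simp: field_simps)
  show thesis
  proof (rule that[OF \<eta>(1)])
    fix G :: "'a set" and \<Phi> and f \<nu> :: "'a \<Rightarrow> real"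
    assume G: "finite G" "G \<noteq> {}"
      and bd: "\<And>\<phi> x. \<phi> \<in> \<Phi> \<Longrightarrow> \<bar>\<phi> x\<bar> \<le> 1"
      and neg: "\<And>\<phi>. \<phi> \<in> \<Phi> \<Longrightarrow> (\<lambda>x. - \<phi> x) \<in> \<Phi>"
      and f: "\<And>x. x \<in> G \<Longrightarrow> 0 \<le> f x" "\<And>x. x \<in> G \<Longrightarrow> f x \<le> \<nu> x"
      and \<nu>: "avg G \<nu> \<le> 2"
      and orth: "\<And>L. set L \<subseteq> \<Phi> \<Longrightarrow> \<bar>avg G (\<lambda>x. (\<nu> x - 1) * prod_list (map (\<lambda>\<phi>. \<phi> x) L))\<bar> \<le> K ^ length L * \<eta>"
    show "\<exists>h. (\<forall>x. 0 \<le> h x \<and> h x \<le> 1) \<and> (\<forall>\<phi>\<in>\<Phi>. \<bar>avg G (\<lambda>x. (f x - h x) * \<phi> x)\<bar> \<le> \<epsilon>)"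
    proof (rule ccontr)
      assume con: "\<not> ?thesis"
      have "\<exists>\<phi>\<in>\<Phi>. avg G (\<lambda>x. (f x - clip (F x)) * \<phi> x) > \<epsilon>" for F
      proof -
        obtain \<phi> where \<phi>: "\<phi> \<in> \<Phi>" "\<bar>avg G (\<lambda>x. (f x - clip (F x)) * \<phi> x)\<bar> > \<epsilon>"
          using con clip_bounds by (metis not_le)
        show ?thesis
        proof (cases "avg G (\<lambda>x. (f x - clip (F x)) * \<phi> x) > \<epsilon>")
          case False
          then have "avg G (\<lambda>x. (f x - clip (F x)) * - \<phi> x) > \<epsilon>"
            using \<phi>(2) by (simp add: avg_minus)
          then show ?thesis by (rule bexI[where x = "\<lambda>x. - \<phi> x"]) (rule neg[OF \<phi>(1)])
        qed (use \<phi> in blast)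
      qed
      then obtain pk where pk: "\<And>F. pk F \<in> \<Phi>" "\<And>F. avg G (\<lambda>x. (f x - clip (F x)) * pk F x) > \<epsilon>"
        by metis
      define F where "F = rec_nat (\<lambda>_. 0) (\<lambda>_ Ft x. Ft x + \<epsilon> * pk Ft x)"
      have F0: "F 0 = (\<lambda>_. 0)" and FS: "\<And>t. F (Suc t) = (\<lambda>x. F t x + \<epsilon> * pk (F t) x)"
        by (simp_all add: F_def)
      define \<phi> where "\<phi> t = pk (F t)" for t
      have Fsum: "F t x = \<epsilon> * (\<Sum>i<t. \<phi> i x)" for t x
        by (induction t) (auto simp: F0 FS \<phi>_def algebra_simps)
      have pot: "clip_potential (F t x) \<le> (\<Sum>i<t. clip (F i x) * (\<epsilon> * \<phi> i x)) + real t * (\<epsilon>\<^sup>2 / 2)" for t x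
      proof (induction t)
        case 0 then show ?case by (simp add: F0 clip_potential_def clip_def)
      next
        case (Suc t)
        have "clip_potential (F (Suc t) x) \<le>
          clip_potential (F t x) + clip (F t x) * (\<epsilon> * \<phi> t x) + (\<epsilon> * \<phi> t x)\<^sup>2 / 2"
          unfolding FS \<phi>_def[symmetric] by (rule clip_potential_step)
        moreover have "(\<epsilon> * \<phi> t x)\<^sup>2 \<le> \<epsilon>\<^sup>2"
          using bd[OF pk(1), of "F t" x] \<epsilon> unfolding \<phi>_def
          by (simp add: power_mult_distrib mult_left_le abs_square_le_1)
        ultimately show ?case using Suc.IH by (simp add: algebra_simps add_divide_distrib)
      qed
      \<comment> \<open>Subtracting the telescoped potential leaves
        \<open>f x * z - clip_potential z\<close> at the final score \<open>z\<close>, to which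
        \<open>clip_potential_lower\<close> applies.\<close>
      have ptw: "\<epsilon> * (\<Sum>i<T. (f x - clip (F i x)) * \<phi> i x) \<le>
          1/2 + (\<nu> x - 1) * max (F T x) 0 + real T * (\<epsilon>\<^sup>2 / 2)" if "x \<in> G" for x
      proof -
        have "\<epsilon> * (\<Sum>i<T. (f x - clip (F i x)) * \<phi> i x) =
          f x * F T x - (\<Sum>i<T. clip (F i x) * (\<epsilon> * \<phi> i x))"
          by (simp add: Fsum algebra_simps sum_subtractf sum_distrib_left)
        then show ?thesis
          using pot[where t = T and x = x] clip_potential_lower[OF f[OF that], of "F T x"] by linarith
      qed
      have "\<epsilon> * (real T * \<epsilon>) \<le> \<epsilon> * (\<Sum>i<T. avg G (\<lambda>x. (f x - clip (F i x)) * \<phi> i x))"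
      proof (rule mult_left_mono)
        have "(\<Sum>i<T. \<epsilon>) \<le> (\<Sum>i<T. avg G (\<lambda>x. (f x - clip (F i x)) * \<phi> i x))"
          unfolding \<phi>_def by (intro sum_mono less_imp_le pk(2))
        then show "real T * \<epsilon> \<le> (\<Sum>i<T. avg G (\<lambda>x. (f x - clip (F i x)) * \<phi> i x))" by simp
      qed (use \<epsilon> in simp)
      also have "\<dots> = avg G (\<lambda>x. \<epsilon> * (\<Sum>i<T. (f x - clip (F i x)) * \<phi> i x))"
        by (simp add: avg_sum avg_cmult)
      also have "\<dots> \<le> avg G (\<lambda>x. 1/2 + (\<nu> x - 1) * max (F T x) 0 + real T * (\<epsilon>\<^sup>2 / 2))"
        by (rule avg_mono) (rule ptw)
      also have "\<dots> = 1/2 + avg G (\<lambda>x. (\<nu> x - 1) * max (F T x) 0) + real T * (\<epsilon>\<^sup>2 / 2)"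
        by (simp add: avg_add avg_const[OF G])
      also have "avg G (\<lambda>x. (\<nu> x - 1) * max (F T x) 0) \<le> 1/2"
      proof -
        let ?P = "\<lambda>z. \<Sum>i\<le>n. a i * z ^ i"
        have FT: "\<bar>F T x\<bar> \<le> L0" for x
        proof -
          have "\<bar>\<Sum>i<T. \<phi> i x\<bar> \<le> (\<Sum>i<T. 1)"
            by (rule order_trans[OF sum_abs], rule sum_mono) (simp add: \<phi>_def bd pk)
          then show ?thesis unfolding Fsum L0_def abs_mult using \<epsilon> by (simp add: mult_left_mono)
        qed
        have "avg G (\<lambda>x. (\<nu> x - 1) * max (F T x) 0) \<le>
          avg G (\<lambda>x. (\<nu> x - 1) * ?P (F T x) + (\<nu> x + 1) * (1/12))"
        proof (rule avg_mono)
          fix x assume x: "x \<in> G"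
          have "(\<nu> x - 1) * (max (F T x) 0 - ?P (F T x)) \<le> \<bar>\<nu> x - 1\<bar> * \<bar>max (F T x) 0 - ?P (F T x)\<bar>"
            by (metis abs_ge_self abs_mult)
          also have "\<dots> \<le> (\<nu> x + 1) * (1/12)"
            using f[OF x] a[OF FT] by (intro mult_mono) auto
          finally show "(\<nu> x - 1) * max (F T x) 0 \<le> (\<nu> x - 1) * ?P (F T x) + (\<nu> x + 1) * (1/12)"
            unfolding right_diff_distrib by linarith
        qed
        also have "\<dots> = avg G (\<lambda>x. (\<nu> x - 1) * ?P (F T x)) + (avg G \<nu> + 1) * (1/12)"
          by (simp add: avg_add avg_const[OF G] avg_multc add_divide_distrib[symmetric] del: times_divide_eq_right times_divide_eq_left)
        also have "\<dots> \<le> avg G (\<lambda>x. (\<nu> x - 1) * ?P (F T x)) + 1/4" using \<nu> by simp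
        also have "avg G (\<lambda>x. (\<nu> x - 1) * ?P (F T x)) =
          (\<Sum>r\<le>n. a r * \<epsilon> ^ r * avg G (\<lambda>x. (\<nu> x - 1) * ((\<Sum>i<T. \<phi> i x) ^ r * prod_list (map (\<lambda>\<phi>. \<phi> x) []))))"
          unfolding avg_cmult[symmetric] avg_sum[symmetric]
          by (intro avg_cong) (simp add: Fsum power_mult_distrib sum_distrib_left[of "\<nu> _ - 1"] mult_ac)
        also have "\<dots> \<le> (\<Sum>r\<le>n. \<bar>a r\<bar> * (L0 * K) ^ r * \<eta>)"
        proof (rule sum_mono)
          fix r
          have "\<bar>avg G (\<lambda>x. (\<nu> x - 1) * ((\<Sum>i<T. \<phi> i x) ^ r * prod_list (map (\<lambda>\<phi>. \<phi> x) [])))\<bar>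
            \<le> real T ^ r * K ^ (r + length ([] :: ('a \<Rightarrow> real) list)) * \<eta>"
            by (rule avg_power_sum_bound[OF _ _ orth]) (use pk K in \<open>auto simp: \<phi>_def\<close>)
          then have "\<bar>a r * \<epsilon> ^ r * avg G (\<lambda>x. (\<nu> x - 1) * ((\<Sum>i<T. \<phi> i x) ^ r * prod_list (map (\<lambda>\<phi>. \<phi> x) [])))\<bar>
            \<le> \<bar>a r\<bar> * \<epsilon> ^ r * (real T ^ r * K ^ r * \<eta>)"
            unfolding abs_mult using \<epsilon> by (intro mult_mono) auto
          then show "a r * \<epsilon> ^ r * avg G (\<lambda>x. (\<nu> x - 1) * ((\<Sum>i<T. \<phi> i x) ^ r * prod_list (map (\<lambda>\<phi>. \<phi> x) [])))
            \<le> \<bar>a r\<bar> * (L0 * K) ^ r * \<eta>"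
            unfolding L0_def power_mult_distrib by (simp add: mult_ac)
        qed
        also have "\<dots> = A * \<eta>" unfolding A_def by (simp add: sum_distrib_right)
        finally show ?thesis using \<eta>(2) by linarith
      qed
      finally have "real T * \<epsilon>\<^sup>2 \<le> 1 + real T * \<epsilon>\<^sup>2 / 2 " by (simp add: power2_eq_square mult_ac)
      moreover have "2 < real T * \<epsilon>\<^sup>2" using T \<epsilon> by (simp add: divide_less_eq)
      ultimately show False by simp
    qed
  qed
qed

subsection \<open>Periodic functions and shifts\<close>

definition periodic :: "nat \<Rightarrow> (int \<Rightarrow> 'a) \<Rightarrow> bool" where
  "periodic N h \<longleftrightarrow> (\<forall>x. h (x + int N) = h x)"

lemma periodic_mult:
  assumes "periodic N h"
  shows "h (x + m * int N) = h x"
proof (induction m rule: int_induct[where k = 0])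
  case base
  show ?case by simp
next
  case (step1 i)
  have "h (x + (i + 1) * int N) = h (x + i * int N + int N)" by (simp add: algebra_simps)
  with step1 assms show ?case by (simp add: periodic_def)
next
  case (step2 i)
  have "h (x + i * int N) = h (x + (i - 1) * int N + int N)" by (simp add: algebra_simps)
  with step2 assms show ?case by (simp add: periodic_def)
qed

lemma periodic_mod: "periodic N h \<Longrightarrow> h (x mod int N) = h x"
  using periodic_mult[of N h "x mod int N" "x div int N"] by simp

lemma periodicI: "(\<And>x. h (x + int N) = h x) \<Longrightarrow> periodic N h"
  by (simp add: periodic_def)

lemma periodicD: "periodic N h \<Longrightarrow> h (x + int N) = h x"
  by (simp add: periodic_def)

lemma periodic_shift:
  assumes "periodic N h"
  shows "periodic N (\<lambda>x. h (x + a))"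
proof (rule periodicI)
  fix x
  have "h (x + int N + a) = h (x + a + int N)" by (simp add: algebra_simps)
  then show "h (x + int N + a) = h (x + a)" using assms by (simp add: periodic_def)
qed

lemma avg_period_shift:
  assumes "0 < N" "periodic N h"
  shows "avg {0..<int N} (\<lambda>n. h (n + a)) = avg {0..<int N} h"
proof -
  have "bij_betw (\<lambda>n. (n + a) mod int N) {0..<int N} {0..<int N}"
    by (rule bij_betw_byWitness[where f' = "\<lambda>n. (n - a) mod int N"])
       (use assms in \<open>auto simp: mod_add_left_eq mod_diff_left_eq\<close>)
  from avg_reindex_bij[OF this, of h] show ?thesis
    using periodic_mod[OF assms(2)] by simp
qed

lemma sum_shift_interval:
  fixes g :: "int \<Rightarrow> real"
  assumes "0 \<le> h" "0 \<le> D"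
  shows "(\<Sum>d\<in>{1..D}. g d) - (\<Sum>d\<in>{1..D}. g (d + h)) = (\<Sum>d\<in>{1..h}. g d) - (\<Sum>d\<in>{D+1..D+h}. g d)"
proof -
  have "(\<Sum>d\<in>{1..D}. g (d + h)) = (\<Sum>d\<in>{1+h..D+h}. g d)"
    by (rule sum.reindex_bij_witness[of _ "\<lambda>d. d - h" "\<lambda>d. d + h"]) auto
  moreover have "(\<Sum>d\<in>{1..D}. g d) + (\<Sum>d\<in>{D+1..D+h}. g d) = (\<Sum>d\<in>{1..D+h}. g d)"
    by (subst sum.union_disjoint[symmetric]) (use assms in \<open>auto intro!: sum.cong\<close>)
  moreover have "(\<Sum>d\<in>{1..h}. g d) + (\<Sum>d\<in>{1+h..D+h}. g d) = (\<Sum>d\<in>{1..D+h}. g d)"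
    by (subst sum.union_disjoint[symmetric]) (use assms in \<open>auto intro!: sum.cong\<close>)
  ultimately show ?thesis by linarith
qed

text \<open>The two sums differ only on end intervals of length \<open>h\<close>. Enlarging these to
  length \<open>H\<close> makes the bound uniform in \<open>h\<close>, and writing them as averages
  brings it into the form covered by the third condition.\<close>

lemma avg_shift_dominated:
  fixes g :: "int \<Rightarrow> real"
  assumes h: "0 \<le> h" "h \<le> H" and D: "0 < D" and g: "\<And>d. \<bar>g d\<bar> \<le> w d"
  shows "\<bar>avg {1..D} g - avg {1..D} (\<lambda>d. g (d + h))\<bar> \<le>
    real_of_int H / real_of_int D * (avg {1..H} w + avg {D+1..D+H} w)"
proof -
  have w: "0 \<le> w d" for d using g[of d] by linarith
  have "\<bar>(\<Sum>d\<in>{1..h}. g d) - (\<Sum>d\<in>{D+1..D+h}. g d)\<bar> \<le> (\<Sum>d\<in>{1..h}. w d) + (\<Sum>d\<in>{D+1..D+h}. w d)"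
    by (intro order_trans[OF abs_triangle_ineq4] add_mono order_trans[OF sum_abs] sum_mono g)
  also have "\<dots> \<le> (\<Sum>d\<in>{1..H}. w d) + (\<Sum>d\<in>{D+1..D+H}. w d)"
    by (intro add_mono sum_mono2) (use h w in auto)
  also have "\<dots> = real_of_int H * (avg {1..H} w + avg {D+1..D+H} w)"
    using h by (cases "H = 0") (auto simp: avg_def field_simps)
  finally show ?thesis
    unfolding sum_shift_interval[OF h(1) less_imp_le[OF D], symmetric]
    using D by (simp add: avg_def diff_divide_distrib[symmetric] divide_right_mono)
qed

lemma avg_shift_bounded:
  fixes g :: "int \<Rightarrow> real"
  assumes D: "0 < D" and g: "\<And>d. \<bar>g d\<bar> \<le> B" and h: "\<bar>h\<bar> \<le> H"
  shows "\<bar>avg {1..D} g - avg {1..D} (\<lambda>d. g (d + h))\<bar> \<le> real_of_int H / real_of_int D * (2 * B)"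
proof -
  have B: "0 \<le> B" using g[of 0] by linarith
  have H: "0 \<le> H" using h by linarith
  have main: "\<bar>avg {1..D} g - avg {1..D} (\<lambda>d. g (d + h))\<bar> \<le> real_of_int H / real_of_int D * (2 * B)"
    if h: "0 \<le> h" "h \<le> H" and g: "\<And>d. \<bar>g d\<bar> \<le> B" for h and g :: "int \<Rightarrow> real"
  proof -
    have "avg {1..H} (\<lambda>_. B) \<le> B" "avg {D+1..D+H} (\<lambda>_. B) \<le> B"
      using B H by (cases "H = 0"; simp add: avg_def)+
    then have "avg {1..H} (\<lambda>_. B) + avg {D+1..D+H} (\<lambda>_. B) \<le> 2 * B" by linarith
    then show ?thesis
      by (intro order_trans[OF avg_shift_dominated[OF h D g]] mult_left_mono) (use D H in auto)
  qed
  show ?thesis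
  proof (cases "0 \<le> h")
    case True then show ?thesis using main[of h g] h g by auto
  next
    case False
    then show ?thesis using main[of "-h" "\<lambda>d. g (d + h)"] h g by (simp add: abs_minus_commute)
  qed
qed

text \<open>Expanding the product gives signed averages over the subsets of \<open>Y\<close>. The
  signs sum to \<open>(1 - 1) ^ card Y = 0\<close> because \<open>Y\<close> is nonempty, so 1 can be
  subtracted from every average.\<close>

lemma avg_prod_minus_one:
  fixes g :: "'q \<Rightarrow> 'y \<Rightarrow> real"
  assumes Y: "finite Y" "Y \<noteq> {}"
    and le: "\<And>B. B \<subseteq> Y \<Longrightarrow> \<bar>avg Q (\<lambda>q. (\<Prod>A\<in>B. g q A) * r q) - 1\<bar> \<le> \<eta>"
  shows "\<bar>avg Q (\<lambda>q. (\<Prod>A\<in>Y. g q A - 1) * r q)\<bar> \<le> 2 ^ card Y * \<eta>"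
proof -
  let ?s = "\<lambda>B. (-1::real) ^ (card Y - card B)"
  let ?a = "\<lambda>B. avg Q (\<lambda>q. (\<Prod>A\<in>B. g q A) * r q)"
  have s0: "(\<Sum>B\<in>Pow Y. ?s B) = 0"
    using prod_diff_conv_sum'[OF Y(1), of "\<lambda>_. 1::real" "\<lambda>_. 1"] Y by (simp add: power_0_left)
  have "avg Q (\<lambda>q. (\<Prod>A\<in>Y. g q A - 1) * r q) = (\<Sum>B\<in>Pow Y. ?s B * ?a B)"
    unfolding prod_diff_conv_sum'[OF Y(1)] avg_cmult[symmetric] avg_sum[symmetric]
    by (intro avg_cong) (simp add: sum_distrib_left sum_distrib_right mult_ac)
  also have "\<dots> = (\<Sum>B\<in>Pow Y. ?s B * (?a B - 1))"
    using s0 by (simp add: algebra_simps sum_subtractf)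
  also have "\<bar>\<dots>\<bar> \<le> (\<Sum>B\<in>Pow Y. \<eta>)"
    by (rule order_trans[OF sum_abs], rule sum_mono) (auto simp: abs_mult power_abs le)
  finally show ?thesis using Y by (simp add: card_Pow)
qed

text \<open>With \<open>n = 2 ^ card I\<close>, one factor \<open>2 ^ n\<close> comes from
  \<open>gowers_Cauchy_Schwarz\<close>, the other from the \<open>2 ^ n\<close> terms in
  \<open>avg_prod_minus_one\<close>.\<close>

lemma root_bound:
  fixes x \<eta> :: real
  assumes "\<bar>x\<bar> ^ n \<le> 2 ^ n * (2 ^ n * \<eta>)" "0 < n"
  shows "\<bar>x\<bar> \<le> 4 * root n \<eta>"
proof -
  have "\<bar>x\<bar> = root n (\<bar>x\<bar> ^ n)" using assms by (simp add: real_root_power_cancel)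
  also have "\<dots> \<le> root n (4 ^ n * \<eta>)"
    using assms by (simp add: mult.assoc[symmetric] power_mult_distrib[symmetric])
  also have "\<dots> = 4 * root n \<eta>" using assms by (simp add: real_root_mult real_root_power_cancel)
  finally show ?thesis .
qed

subsection \<open>Dual functions\<close>

text \<open>The progressions are \<open>n + c i * d\<close>. In the application \<open>c\<close> is
  \<open>lab\<close> and \<open>\<kappa>\<close> is \<open>k!\<close>; the divisibility makes the
  shifts of \<open>d\<close> in \<open>count_small_bounded\<close> integral. \<open>M\<close> is the
  side of the auxiliary cube.\<close>

locale ap_system =
  fixes c :: "'k::finite \<Rightarrow> int" and \<kappa> :: int and N :: nat and M D :: int and \<nu> :: "int \<Rightarrow> real"
  assumes N: "0 < N" and M: "0 < M" and D: "0 < D"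
    and inj_c: "inj c" and dvd: "i \<noteq> j \<Longrightarrow> c j - c i dvd \<kappa>"
    and card_k: "2 \<le> CARD('k)"
    and \<nu>_periodic: "periodic N \<nu>" and \<nu>_nonneg: "0 \<le> \<nu> x"
begin

abbreviation E :: "(int \<Rightarrow> real) \<Rightarrow> real" where
  "E h \<equiv> avg {0..<int N} h"

definition cube :: "('k \<Rightarrow> int) set" where
  "cube = PiE UNIV (\<lambda>_. {1..M})"

definition tot :: "('k \<Rightarrow> int) \<Rightarrow> int" where
  "tot s = (\<Sum>i\<in>UNIV. s i)"

text \<open>The last clause says that \<open>v i x s\<close> depends on \<open>x\<close> and
  \<open>s i\<close> only through \<open>x - \<kappa> * s i\<close>. After the substitution
  \<open>x = n + \<kappa> * tot s\<close> the factor \<open>v i\<close> no longer involves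
  \<open>s i\<close>, as Gowers--Cauchy--Schwarz requires.\<close>

definition dual_factors :: "('k \<Rightarrow> int \<Rightarrow> ('k \<Rightarrow> int) \<Rightarrow> real) \<Rightarrow> bool" where
  "dual_factors v \<longleftrightarrow> (\<forall>i x s. \<bar>v i x s\<bar> \<le> 1) \<and> (\<forall>i x s. v i (x + int N) s = v i x s) \<and>
     (\<forall>i x s \<tau>. v i (x + \<kappa> * \<tau>) (s(i := s i + \<tau>)) = v i x s)"

text \<open>The factors are arbitrary rather than built from \<open>f\<close>; this freedom lets the
  product of two dual functions be absorbed into new factors.\<close>

definition dual_functions :: "(int \<Rightarrow> real) set" where
  "dual_functions = {(\<lambda>x. avg cube (\<lambda>s. \<Prod>i\<in>UNIV. v i x s)) | v. dual_factors v}"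

lemma cube_ne: "finite cube" "cube \<noteq> {}"
  using M by (auto simp: cube_def PiE_eq_empty_iff intro: finite_box)

lemma G_ne: "finite {0..<int N}" "{0..<int N} \<noteq> {}"
  using N by auto

lemma E_shift: "periodic N h \<Longrightarrow> E (\<lambda>n. h (n + a)) = E h"
  by (rule avg_period_shift[OF N])

lemma tot_upd: "tot (s(i := x)) = tot s + x - s i"
proof -
  have "tot (s(i := x)) = x + (\<Sum>l\<in>UNIV - {i}. s l)" "tot s = s i + (\<Sum>l\<in>UNIV - {i}. s l)"
    unfolding tot_def by (subst sum.remove[of UNIV i]; auto)+
  then show ?thesis by linarith
qed

lemma dual_functions_bounded: "\<phi> \<in> dual_functions \<Longrightarrow> \<bar>\<phi> x\<bar> \<le> 1"
  unfolding dual_functions_def dual_factors_def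
  by (auto intro!: avg_abs_le cube_ne prod_le_1 simp: abs_prod)

lemma dual_functions_minus: "\<phi> \<in> dual_functions \<Longrightarrow> (\<lambda>x. - \<phi> x) \<in> dual_functions"
proof -
  assume "\<phi> \<in> dual_functions"
  then obtain v where v: "dual_factors v" "\<phi> = (\<lambda>x. avg cube (\<lambda>s. \<Prod>i\<in>UNIV. v i x s))"
    by (auto simp: dual_functions_def)
  obtain a :: 'k where True by simp
  define v' where "v' = (\<lambda>i x s. (if i = a then -1 else 1) * v i x s)"
  have "dual_factors v'" using v(1) by (auto simp: dual_factors_def v'_def abs_mult)
  moreover have "(\<Prod>i\<in>UNIV. v' i x s) = - (\<Prod>i\<in>UNIV. v i x s)" for x s
    unfolding v'_def prod.distrib by simp
  ultimately show ?thesis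
    unfolding dual_functions_def v(2) by (auto simp: avg_minus intro!: exI[of _ v'])
qed

lemma dual_functions_one: "(\<lambda>_. 1) \<in> dual_functions"
  unfolding dual_functions_def
  by (auto intro!: exI[of _ "\<lambda>_ _ _. 1"] simp: dual_factors_def avg_const[OF cube_ne])

text \<open>
  Writing \<open>s + h\<close> for the second variable turns a product of two averages over the cube into a sum
  over \<open>h\<close> of averages over those \<open>s\<close> for which \<open>s + h\<close> lies in the cube as well.  As there are at
  least two coordinates, the indicator function of that condition can be distributed among the
  factors without destroying their invariance.
\<close>

lemma dual_functions_mult:
  assumes "\<phi> \<in> dual_functions" "\<phi>' \<in> dual_functions"
  obtains \<rho> :: "('k \<Rightarrow> int) \<Rightarrow> int \<Rightarrow> real" where "\<And>h. \<rho> h \<in> dual_functions"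
    "\<And>x. \<phi> x * \<phi>' x = (\<Sum>h\<in>PiE UNIV (\<lambda>_. {-M..M}). \<rho> h x) / real (card cube)"
proof -
  obtain v where v: "dual_factors v" "\<phi> = (\<lambda>x. avg cube (\<lambda>s. \<Prod>i\<in>UNIV. v i x s))"
    using assms(1) by (auto simp: dual_functions_def)
  obtain v' where v': "dual_factors v'" "\<phi>' = (\<lambda>x. avg cube (\<lambda>s. \<Prod>i\<in>UNIV. v' i x s))"
    using assms(2) by (auto simp: dual_functions_def)
  obtain a b :: 'k where ab: "a \<noteq> b"
    using card_k card_le_Suc0_iff_eq[of "UNIV :: 'k set"] by auto
  define sh where "sh s h = (\<lambda>i. s i + h i)" for s h :: "'k \<Rightarrow> int"
  define H :: "('k \<Rightarrow> int) set" where "H = PiE UNIV (\<lambda>_. {-M..M})"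
  \<comment> \<open>Factor \<open>a\<close> must be invariant when \<open>s a\<close> moves, so it
    carries the condition on all other coordinates; the condition on \<open>s a\<close> goes to
    factor \<open>b\<close>.\<close>
  define u where "u h i x s = (v i x s * v' i x (sh s h)) *
     ((if i = a then of_bool (\<forall>l. l \<noteq> a \<longrightarrow> s l + h l \<in> {1..M}) else 1) *
      (if i = b then of_bool (s a + h a \<in> {1..M}) else 1))" for h i x s
  define \<rho> where "\<rho> h x = avg cube (\<lambda>s. \<Prod>i\<in>UNIV. u h i x s)" for h x
  have u: "dual_factors (u h)" for h
  proof -
    have "v' i (x + \<kappa> * \<tau>) (sh (s(i := s i + \<tau>)) h) = v' i x (sh s h)" for i x \<tau> s
    proof -
      have "sh (s(i := s i + \<tau>)) h = (sh s h)(i := sh s h i + \<tau>)" by (auto simp: sh_def)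
      then show ?thesis using v'(1) by (simp add: dual_factors_def)
    qed
    then show ?thesis
      using v(1) v'(1) ab unfolding dual_factors_def u_def
      by (auto simp: abs_mult mult_le_one)
  qed
  have prod_u: "(\<Prod>i\<in>UNIV. u h i x s) =
      (\<Prod>i\<in>UNIV. v i x s) * (of_bool (sh s h \<in> cube) * (\<Prod>i\<in>UNIV. v' i x (sh s h)))" for h x s
  proof -
    have "of_bool (\<forall>l. l \<noteq> a \<longrightarrow> s l + h l \<in> {1..M}) * of_bool (s a + h a \<in> {1..M}) =
      (of_bool (sh s h \<in> cube) :: real)"
      by (auto simp: cube_def sh_def PiE_iff)
    then show ?thesis unfolding u_def prod.distrib by (simp add: prod.delta)
  qed
  have sum_cube: "(\<Sum>t\<in>cube. g t) = (\<Sum>h\<in>H. of_bool (sh s h \<in> cube) * g (sh s h))"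
    if s: "s \<in> cube" for s and g :: "('k \<Rightarrow> int) \<Rightarrow> real"
  proof -
    have fH: "finite H" unfolding H_def by (intro finite_box) auto
    have "(\<Sum>h\<in>H. of_bool (sh s h \<in> cube) * g (sh s h)) = (\<Sum>h\<in>{h \<in> H. sh s h \<in> cube}. g (sh s h))"
      by (subst sum.inter_filter[OF fH]) (auto intro!: sum.cong)
    also have "\<dots> = (\<Sum>t\<in>cube. g t)"
    proof (rule sum.reindex_bij_witness[of _ "\<lambda>t i. t i - s i" "sh s"])
      fix t assume t: "t \<in> cube"
      have "- M \<le> t i - s i \<and> t i - s i \<le> M" for i
        using PiE_mem[OF s[unfolded cube_def], of i] PiE_mem[OF t[unfolded cube_def], of i] by auto
      then show "(\<lambda>i. t i - s i) \<in> {h \<in> H. sh s h \<in> cube}"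
        using t by (auto simp: H_def PiE_iff sh_def)
    qed (auto simp: sh_def)
    finally show ?thesis ..
  qed
  show thesis
  proof (rule that[of \<rho>])
    show "\<rho> h \<in> dual_functions" for h
      unfolding dual_functions_def \<rho>_def using u by auto
    show "\<phi> x * \<phi>' x = (\<Sum>h\<in>PiE UNIV (\<lambda>_. {-M..M}). \<rho> h x) / real (card cube)" for x
    proof -
      have "\<phi> x * \<phi>' x =
        (\<Sum>s\<in>cube. (\<Prod>i\<in>UNIV. v i x s) * (\<Sum>t\<in>cube. \<Prod>i\<in>UNIV. v' i x t)) / real (card cube) / real (card cube)"
        unfolding v(2) v'(2) avg_def by (simp add: sum_distrib_right)
      also have "(\<Sum>s\<in>cube. (\<Prod>i\<in>UNIV. v i x s) * (\<Sum>t\<in>cube. \<Prod>i\<in>UNIV. v' i x t)) =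
        (\<Sum>s\<in>cube. \<Sum>h\<in>H. \<Prod>i\<in>UNIV. u h i x s)"
        by (rule sum.cong[OF refl], subst sum_cube) (auto simp: prod_u sum_distrib_left)
      also have "\<dots> = (\<Sum>h\<in>H. \<Sum>s\<in>cube. \<Prod>i\<in>UNIV. u h i x s)" by (rule sum.swap)
      finally show ?thesis
        unfolding \<rho>_def avg_def H_def by (simp add: sum_divide_distrib)
    qed
  qed
qed

text \<open>The first two entries of the list are replaced by a sum of single dual functions, which
  shortens the list by one. This costs the number of shifts \<open>h\<close> divided by the size of
  the cube, that is \<open>((2 * M + 1) / M) ^ CARD('k)\<close>, whence the 3. The empty list is the
  constant dual function 1.\<close>

lemma dual_functions_products_orth:
  assumes "\<And>\<phi>. \<phi> \<in> dual_functions \<Longrightarrow> \<bar>E (\<lambda>x. w x * \<phi> x)\<bar> \<le> \<theta>" and "set L \<subseteq> dual_functions"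
  shows "\<bar>E (\<lambda>x. w x * prod_list (map (\<lambda>\<phi>. \<phi> x) L))\<bar> \<le> (3 ^ CARD('k)) ^ length L * \<theta>"
  using assms(2)
proof (induction "length L" arbitrary: L rule: less_induct)
  case less
  let ?K = "(3::real) ^ CARD('k)"
  have \<theta>: "0 \<le> \<theta>" using assms(1)[OF dual_functions_one] by linarith
  have K: "1 \<le> ?K" by simp
  show ?case
  proof (cases L)
    case Nil
    then show ?thesis using assms(1)[OF dual_functions_one] by simp
  next
    case (Cons \<phi> L')
    show ?thesis
    proof (cases L')
      case Nil
      have "\<bar>E (\<lambda>x. w x * \<phi> x)\<bar> \<le> \<theta>" using assms(1) less Cons by auto
      also have "\<dots> \<le> ?K * \<theta>" using mult_right_mono[OF K \<theta>] by simp
      finally show ?thesis using Cons Nil by simp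
    next
      case c2: (Cons \<phi>' L'')
      let ?H = "PiE UNIV (\<lambda>_. {-M..M}) :: ('k \<Rightarrow> int) set"
      obtain \<rho> where \<rho>: "\<And>h. \<rho> h \<in> dual_functions"
        "\<And>x. \<phi> x * \<phi>' x = (\<Sum>h\<in>?H. \<rho> h x) / real (card cube)"
        by (rule dual_functions_mult[of \<phi> \<phi>']) (use less.prems Cons c2 in auto)
      have "E (\<lambda>x. w x * prod_list (map (\<lambda>\<phi>. \<phi> x) L)) =
         E (\<lambda>x. \<Sum>h\<in>?H. w x * prod_list (map (\<lambda>\<phi>. \<phi> x) (\<rho> h # L'')) / real (card cube))"
      proof (rule avg_cong)
        fix x
        have "w x * prod_list (map (\<lambda>\<phi>. \<phi> x) L) = w x * (\<phi> x * \<phi>' x) * prod_list (map (\<lambda>\<phi>. \<phi> x) L'')"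
          by (simp add: Cons c2)
        then show "w x * prod_list (map (\<lambda>\<phi>. \<phi> x) L) =
          (\<Sum>h\<in>?H. w x * prod_list (map (\<lambda>\<phi>. \<phi> x) (\<rho> h # L'')) / real (card cube))"
          unfolding \<rho>(2) by (simp add: sum_distrib_left sum_distrib_right sum_divide_distrib mult.assoc)
      qed
      also have "\<dots> = (\<Sum>h\<in>?H. E (\<lambda>x. w x * prod_list (map (\<lambda>\<phi>. \<phi> x) (\<rho> h # L'')))) / real (card cube)"
        unfolding avg_sum[symmetric] sum_divide_distrib[symmetric] by (simp add: avg_def sum_divide_distrib mult_ac)
      also have "\<bar>\<dots>\<bar> \<le> (\<Sum>h\<in>?H. ?K ^ length (\<phi>' # L'') * \<theta>) / real (card cube)"
        unfolding abs_divide abs_of_nat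
        by (intro divide_right_mono order_trans[OF sum_abs] sum_mono order_trans[OF less.hyps])
           (use less.prems Cons c2 \<rho> in auto)
      also have "\<dots> = real (card ?H) / real (card cube) * (?K ^ length L' * \<theta>)"
        using c2 by simp
      also have "\<dots> \<le> ?K * (?K ^ length L' * \<theta>)"
      proof (rule mult_right_mono)
        have "real (card ?H) = (2 * real_of_int M + 1) ^ CARD('k)" "real (card cube) = real_of_int M ^ CARD('k)"
          using M by (auto simp: cube_def card_PiE)
        moreover have "(2 * real_of_int M + 1) ^ CARD('k) \<le> (3 * real_of_int M) ^ CARD('k)"
          using M by (intro power_mono) auto
        ultimately show "real (card ?H) / real (card cube) \<le> ?K"
          using M by (simp add: divide_le_eq power_mult_distrib)
      qed (use \<theta> K in auto)
      finally show ?thesis by (simp add: Cons)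
    qed
  qed
qed

end

subsection \<open>Counting progressions\<close>

text \<open>Two copies \<open>x\<close> and \<open>y\<close> of the common difference are treated as
  the two values of coordinate \<open>j\<close> in a doubled cube: vertices without \<open>j\<close>
  see \<open>x\<close>, those with \<open>j\<close> see \<open>y\<close>.\<close>

lemma mix_prod_Pow_insert:
  fixes g :: "'i::finite set \<Rightarrow> ('i \<Rightarrow> 'b) \<Rightarrow> 'c::comm_monoid_mult"
  assumes "j \<notin> Y"
  shows "(\<Prod>A\<in>Pow (insert j Y). g A (mix A (s(j := x)) (t(j := y)))) =
    (\<Prod>A\<in>Pow Y. g A ((mix A s t)(j := x)) * g (insert j A) ((mix A s t)(j := y)))"
proof (subst prod_Pow_insert[OF _ assms], simp, rule prod.cong[OF refl])
  fix A assume "A \<in> Pow Y"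
  then have "j \<notin> A" using assms by auto
  then have "mix A (s(j := x)) (t(j := y)) = (mix A s t)(j := x)"
    "mix (insert j A) (s(j := x)) (t(j := y)) = (mix A s t)(j := y)"
    by (auto simp: mix_def fun_eq_iff)
  then show "g A (mix A (s(j := x)) (t(j := y))) * g (insert j A) (mix (insert j A) (s(j := x)) (t(j := y))) =
    g A ((mix A s t)(j := x)) * g (insert j A) ((mix A s t)(j := y))" by simp
qed

lemma sum_mult_fun_upd:
  fixes g s :: "'i \<Rightarrow> int"
  assumes "finite A"
  shows "(\<Sum>l\<in>A. g l * (s(i := y)) l) = (\<Sum>l\<in>A. g l * s l) + (if i \<in> A then g i * (y - s i) else 0)"
proof -
  have "(\<Sum>l\<in>A. g l * (s(i := y)) l - g l * s l) = (\<Sum>l\<in>A. if l = i then g i * (y - s i) else 0)"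
    by (rule sum.cong) (auto simp: algebra_simps)
  then show ?thesis using assms by (simp add: sum_subtractf sum.delta)
qed

context ap_system
begin

text \<open>For \<open>c = lab\<close> this is \<open>psi_at\<close>, the linear form of the first
  condition.\<close>

definition form :: "'k \<Rightarrow> ('k \<Rightarrow> int) \<Rightarrow> int" where
  "form j s = (\<Sum>i\<in>UNIV. (c j - c i) * s i)"

definition count :: "('k \<Rightarrow> int \<Rightarrow> real) \<Rightarrow> real" where
  "count F = E (\<lambda>n. avg {1..D} (\<lambda>d. \<Prod>i\<in>UNIV. F i (n + c i * d)))"

text \<open>The coefficient of \<open>F j\<close> in the multilinear form \<open>count\<close>, by
  \<open>count_eq_dual\<close>.\<close>

definition dual :: "('k \<Rightarrow> int \<Rightarrow> real) \<Rightarrow> 'k \<Rightarrow> int \<Rightarrow> real" where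
  "dual F j n = avg {1..D} (\<lambda>d. \<Prod>i\<in>UNIV - {j}. F i (n + (c i - c j) * d))"

lemma form_split: "form i s = (c i - c j) * s j + (\<Sum>l\<in>UNIV - {j}. (c i - c l) * s l)"
  unfolding form_def by (subst sum.remove[of UNIV j]) auto

lemma form_upd_self: "form j (s(j := x)) = form j s"
  unfolding form_def sum_mult_fun_upd[OF finite] by simp

text \<open>This is where the forms of the first condition originate: with \<open>n\<close> moved by
  \<open>form j s\<close> and \<open>d\<close> by the sum of the other variables, position
  \<open>i\<close> sees \<open>form i\<close>, which does not involve \<open>s i\<close>.\<close>

lemma form_shift:
  "form j s + (c i - c j) * (d + (\<Sum>l\<in>UNIV - {j}. s l)) = form i (s(j := d))"
  unfolding form_split[of _ _ j] sum_mult_fun_upd[OF finite_Diff[OF finite]]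
  by (simp add: distrib_left sum_distrib_left sum.distrib[symmetric] left_diff_distrib)

lemma E_prod_shift:
  assumes "\<And>i. periodic N (F i)"
  shows "E (\<lambda>n. \<Prod>i\<in>UNIV. F i (n + c i * d)) = E (\<lambda>n. F j n * (\<Prod>i\<in>UNIV - {j}. F i (n + (c i - c j) * d)))"
proof -
  let ?h = "\<lambda>n. F j n * (\<Prod>i\<in>UNIV - {j}. F i (n + (c i - c j) * d))"
  have "periodic N ?h"
    using assms by (intro periodicI) (simp add: periodicD periodic_shift[THEN periodicD])
  then have "E ?h = E (\<lambda>n. ?h (n + c j * d))" by (rule E_shift[symmetric])
  also have "\<dots> = E (\<lambda>n. \<Prod>i\<in>UNIV. F i (n + c i * d))"
  proof (rule avg_cong)
    fix n
    have "(\<Prod>i\<in>UNIV. F i (n + c i * d)) = F j (n + c j * d) * (\<Prod>i\<in>UNIV - {j}. F i (n + c i * d))"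
      by (rule prod.remove) auto
    then show "?h (n + c j * d) = (\<Prod>i\<in>UNIV. F i (n + c i * d))"
      by (simp add: left_diff_distrib)
  qed
  finally show ?thesis ..
qed

lemma count_eq_dual:
  assumes "\<And>i. periodic N (F i)"
  shows "count F = E (\<lambda>n. F j n * dual F j n)"
proof -
  have "count F = avg {1..D} (\<lambda>d. E (\<lambda>n. \<Prod>i\<in>UNIV. F i (n + c i * d)))"
    unfolding count_def by (rule avg_swap)
  also have "\<dots> = E (\<lambda>n. avg {1..D} (\<lambda>d. F j n * (\<Prod>i\<in>UNIV - {j}. F i (n + (c i - c j) * d))))"
    unfolding E_prod_shift[OF assms, where j = j] by (rule avg_swap)
  finally show ?thesis by (simp add: dual_def avg_cmult)
qed

lemma dual_upd_self: "dual (F(j := g)) j = dual F j"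
  unfolding dual_def by (intro ext avg_cong prod.cong) auto

lemma periodic_dual:
  assumes "\<And>i. periodic N (F i)"
  shows "periodic N (dual F j)"
  unfolding dual_def using assms
  by (intro periodicI) (simp add: periodicD periodic_shift[THEN periodicD])

lemma D_ne: "finite {1..D}" "{1..D} \<noteq> {}"
  using D by auto

lemma dual_nonneg: "(\<And>i x. 0 \<le> F i x) \<Longrightarrow> 0 \<le> dual F j n"
  unfolding dual_def by (intro avg_nonneg prod_nonneg) auto

lemma dual_mono: "(\<And>i x. 0 \<le> F i x) \<Longrightarrow> (\<And>i x. F i x \<le> F' i x) \<Longrightarrow> dual F j n \<le> dual F' j n"
  unfolding dual_def by (intro avg_mono prod_mono) auto

lemma dual_le_1: "(\<And>i x. 0 \<le> F i x) \<Longrightarrow> (\<And>i x. F i x \<le> 1) \<Longrightarrow> dual F j n \<le> 1"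
  unfolding dual_def by (intro avg_le D_ne prod_le_1) auto

text \<open>Replacing \<open>d\<close> by \<open>d + t s\<close> changes the average by
  \<open>O(M / D)\<close>. The coefficients \<open>q l = \<kappa> / (c j - c l)\<close> of
  \<open>t\<close> are chosen so that moving \<open>s i\<close> by \<open>\<tau>\<close> and
  \<open>x\<close> by \<open>\<kappa> * \<tau>\<close> fixes the argument at position
  \<open>i\<close>; seen from position \<open>j\<close>, the bounded factors then form a dual
  function.\<close>

lemma count_small_bounded:
  assumes per: "\<And>i. periodic N (F i)"
    and b: "\<And>i x. i \<noteq> j \<Longrightarrow> \<bar>F i x\<bar> \<le> 1" and bj: "\<And>x. \<bar>F j x\<bar> \<le> \<nu> x + 1"
    and orth: "\<And>\<phi>. \<phi> \<in> dual_functions \<Longrightarrow> \<bar>E (\<lambda>x. F j x * \<phi> x)\<bar> \<le> \<delta>"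
  shows "\<bar>count F\<bar> \<le> \<delta> + real_of_int (int CARD('k) * \<bar>\<kappa>\<bar> * M) / real_of_int D * (2 * (E \<nu> + 1))"
proof -
  define q where "q l = \<kappa> div (c j - c l)" for l
  have q: "(c j - c l) * q l = \<kappa>" if "l \<noteq> j" for l
    using dvd[OF that] by (simp add: q_def)
  define t where "t s = (\<Sum>l\<in>UNIV - {j}. q l * s l)" for s :: "'k \<Rightarrow> int"
  \<comment> \<open>The average over \<open>n\<close> is taken first: \<open>G\<close> is bounded
    although \<open>F j\<close> is not, so \<open>avg_shift_bounded\<close> applies.\<close>
  define G where "G d = E (\<lambda>n. \<Prod>i\<in>UNIV. F i (n + c i * d))" for d
  define \<epsilon> where "\<epsilon> = real_of_int (int CARD('k) * \<bar>\<kappa>\<bar> * M) / real_of_int D * (2 * (E \<nu> + 1))"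
  have G: "\<bar>G d\<bar> \<le> E \<nu> + 1" for d
  proof -
    have "\<bar>G d\<bar> \<le> E (\<lambda>n. \<nu> (n + c j * d) + 1)"
      unfolding G_def
    proof (rule avg_abs_mono)
      fix n
      have "\<bar>\<Prod>i\<in>UNIV. F i (n + c i * d)\<bar> = \<bar>F j (n + c j * d)\<bar> * (\<Prod>i\<in>UNIV - {j}. \<bar>F i (n + c i * d)\<bar>)"
        unfolding abs_prod by (subst prod.remove[of UNIV j]) auto
      also have "\<dots> \<le> \<bar>F j (n + c j * d)\<bar> * 1"
        by (intro mult_left_mono prod_le_1) (auto simp: b)
      finally show "\<bar>\<Prod>i\<in>UNIV. F i (n + c i * d)\<bar> \<le> \<nu> (n + c j * d) + 1"
        using bj[of "n + c j * d"] by linarith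
    qed
    then show ?thesis using E_shift[OF \<nu>_periodic] by (simp add: avg_add avg_const[OF G_ne])
  qed
  have t: "\<bar>t s\<bar> \<le> int CARD('k) * \<bar>\<kappa>\<bar> * M" if s: "s \<in> cube" for s
  proof -
    have "\<bar>t s\<bar> \<le> (\<Sum>l\<in>UNIV - {j}. \<bar>\<kappa>\<bar> * M)"
      unfolding t_def
    proof (rule order_trans[OF sum_abs], rule sum_mono)
      fix l assume l: "l \<in> UNIV - {j}"
      have "c j - c l \<noteq> 0" using l inj_c by (auto dest: injD)
      then have "\<bar>q l\<bar> * 1 \<le> \<bar>q l\<bar> * \<bar>c j - c l\<bar>" by (intro mult_left_mono) auto
      also have "\<dots> = \<bar>\<kappa>\<bar>" using q[of l] l by (simp add: abs_mult[symmetric] mult.commute)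
      finally have "\<bar>q l\<bar> \<le> \<bar>\<kappa>\<bar>" by simp
      moreover have "\<bar>s l\<bar> \<le> M" using PiE_mem[OF s[unfolded cube_def], of l] by auto
      ultimately show "\<bar>q l * s l\<bar> \<le> \<bar>\<kappa>\<bar> * M" unfolding abs_mult by (intro mult_mono) auto
    qed
    also have "\<dots> \<le> (\<Sum>l\<in>(UNIV :: 'k set). \<bar>\<kappa>\<bar> * M)"
      using M by (intro sum_mono2) auto
    finally show ?thesis by simp
  qed
  have "\<bar>avg cube (\<lambda>s. avg {1..D} G - avg {1..D} (\<lambda>d. G (d + t s)))\<bar> \<le> \<epsilon>"
    unfolding \<epsilon>_def by (intro avg_abs_le cube_ne avg_shift_bounded D G t)
  moreover have "\<bar>avg cube (\<lambda>s. avg {1..D} (\<lambda>d. G (d + t s)))\<bar> \<le> \<delta>"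
  proof -
    define v where "v d = (\<lambda>i x s. if i = j then 1 else F i (x + (c i - c j) * (d + t s)))" for d
    have v: "dual_factors (v d)" for d
    proof -
      have "v d i (x + \<kappa> * \<tau>) (s(i := s i + \<tau>)) = v d i x s" if ij: "i \<noteq> j" for i x \<tau> s
      proof -
        have "t (s(i := s i + \<tau>)) = t s + q i * \<tau>"
          unfolding t_def sum_mult_fun_upd[OF finite_Diff[OF finite]] using ij by simp
        moreover have "(c i - c j) * (q i * \<tau>) = - (\<kappa> * \<tau>)"
          using q[OF ij] by (simp add: algebra_simps) 
        ultimately have shift: "x + \<kappa> * \<tau> + (c i - c j) * (d + t (s(i := s i + \<tau>))) = x + (c i - c j) * (d + t s)"
          by (simp add: distrib_left)
        show ?thesis unfolding v_def shift ..
      qed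
      moreover have "v d i (x + int N) s = v d i x s" for i x s
        using per periodicD[OF per, of i "x + (c i - c j) * (d + t s)"] by (simp add: v_def algebra_simps)
      ultimately show ?thesis using b unfolding dual_factors_def by (auto simp: v_def)
    qed
    have "avg cube (\<lambda>s. avg {1..D} (\<lambda>d. G (d + t s))) =
      avg {1..D} (\<lambda>d. avg cube (\<lambda>s. E (\<lambda>x. F j x * (\<Prod>i\<in>UNIV. v d i x s))))"
    proof -
      have "(\<Prod>i\<in>UNIV. v d i x s) = (\<Prod>i\<in>UNIV - {j}. F i (x + (c i - c j) * (d + t s)))" for d x s
        by (subst prod.remove[of UNIV j]) (auto simp: v_def intro!: prod.cong)
      then show ?thesis
        unfolding G_def E_prod_shift[OF per, where j = j] by (subst avg_swap) simp
    qed
    also have "\<dots> = avg {1..D} (\<lambda>d. E (\<lambda>x. F j x * avg cube (\<lambda>s. \<Prod>i\<in>UNIV. v d i x s)))"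
      by (subst avg_swap[of cube]) (simp add: avg_cmult)
    also have "\<bar>\<dots>\<bar> \<le> \<delta>"
      by (intro avg_abs_le D_ne orth) (use v in \<open>auto simp: dual_functions_def\<close>)
    finally show ?thesis .
  qed
  moreover have "count F = avg {1..D} G"
    unfolding count_def G_def by (rule avg_swap)
  moreover have "avg cube (\<lambda>s. avg {1..D} G - avg {1..D} (\<lambda>d. G (d + t s))) =
    avg {1..D} G - avg cube (\<lambda>s. avg {1..D} (\<lambda>d. G (d + t s)))"
    by (simp add: avg_diff avg_const[OF cube_ne])
  ultimately show ?thesis unfolding \<epsilon>_def by linarith
qed

text \<open>Bounds the sum of fewer than \<open>k\<close> variables from \<open>{1..M}\<close> by
  which \<open>d\<close> is shifted in \<open>\<nu>_dual_dual\<close>; the end intervals caused by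
  the shift have this length.\<close>

definition width :: int where
  "width = int CARD('k) * M"

text \<open>Coordinate \<open>j\<close>, which \<open>form j\<close> ignores, stands for the common
  difference and therefore has the long range.\<close>

definition body :: "'k \<Rightarrow> ('k \<Rightarrow> int) set" where
  "body j = PiE UNIV (\<lambda>i. if i = j then {1..D} else {1..M})"

end

text \<open>
  The instances of the three linear forms conditions that are needed, with \<open>\<eta>\<close> in place of
  \<open>o(1)\<close>.  The set \<open>A\<close> plays the role of the index \<open>\<omega>\<close> (it is where \<open>\<omega>\<close> equals 1), and the sets
  \<open>Y\<close> select the factors with exponent 1.
\<close>

locale ap_pseudorandom = ap_system c \<kappa> N M D \<nu>
  for c :: "'k::finite \<Rightarrow> int" and \<kappa> :: int and N :: nat and M D :: int and \<nu> :: "int \<Rightarrow> real" +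
  fixes \<eta> :: real
  assumes \<eta>: "0 \<le> \<eta>" "\<eta> \<le> 1"
    and linear_forms_AP: "(\<And>l. Y l \<subseteq> Pow (UNIV - {l})) \<Longrightarrow>
      \<bar>E (\<lambda>n. avg (body j) (\<lambda>s. avg (body j) (\<lambda>t.
         \<Prod>l\<in>UNIV. \<Prod>A\<in>Y l. \<nu> (n + form l (mix A s t))))) - 1\<bar> \<le> \<eta>"
    and linear_forms_cube:
      "\<bar>E (\<lambda>n. avg cube (\<lambda>s. avg cube (\<lambda>t. \<Prod>A\<in>(Y' :: 'k set set). \<nu> (n + \<kappa> * tot (mix A s t))))) - 1\<bar> \<le> \<eta>"
    and linear_forms_plane: "I \<in> {{1..D}, {1..width}, {D+1..D+width}} \<Longrightarrow>
      I' \<in> {{1..D}, {1..width}, {D+1..D+width}} \<Longrightarrow> Z \<subseteq> UNIV - {j} \<Longrightarrow> Z' \<subseteq> UNIV - {j} \<Longrightarrow>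
      \<bar>E (\<lambda>n. (if b then \<nu> n else 1) * avg I (\<lambda>d. avg I' (\<lambda>d'.
        (\<Prod>i\<in>Z. \<nu> (n + (c i - c j) * d)) * (\<Prod>i\<in>Z'. \<nu> (n + (c i - c j) * d'))))) - 1\<bar> \<le> \<eta>"
begin

section \<open>Orthogonality of \<open>\<nu> - 1\<close> to dual functions\<close>

lemma \<nu>_mean: "\<bar>E \<nu> - 1\<bar> \<le> \<eta>" "E \<nu> \<le> 2"
proof -
  show *: "\<bar>E \<nu> - 1\<bar> \<le> \<eta>"
    using linear_forms_plane[of "{1..D}" "{1..D}" "{}" undefined "{}" True]
    by (simp add: avg_const[OF D_ne])
  show "E \<nu> \<le> 2" using * \<eta> by linarith
qed

text \<open>After \<open>x = n + \<kappa> * tot s\<close> factor \<open>i\<close> is independent of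
  \<open>s i\<close> and bounded by 1. Gowers--Cauchy--Schwarz with constant majorants leaves the
  product of \<open>\<nu> - 1\<close> over the vertices of the cube, and its expansion consists of
  instances of the second condition.\<close>

lemma \<nu>_dual_orth:
  assumes "\<phi> \<in> dual_functions"
  shows "\<bar>E (\<lambda>x. (\<nu> x - 1) * \<phi> x)\<bar> \<le> 4 * root (2 ^ CARD('k)) \<eta>"
proof -
  obtain v where v: "dual_factors v" "\<phi> = (\<lambda>x. avg cube (\<lambda>s. \<Prod>i\<in>UNIV. v i x s))"
    using assms by (auto simp: dual_functions_def)
  define g where "g n s = \<nu> (n + \<kappa> * tot s) - 1" for n s
  define u where "u i n s = v i (n + \<kappa> * tot s) s" for i n s
  have vper: "periodic N (\<lambda>x. v i x s)" for i s
    using v(1) by (auto simp: dual_factors_def periodic_def)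
  have "E (\<lambda>x. (\<nu> x - 1) * \<phi> x) = avg cube (\<lambda>s. E (\<lambda>x. (\<nu> x - 1) * (\<Prod>i\<in>UNIV. v i x s)))"
    unfolding v(2) avg_cmult[symmetric] by (rule avg_swap)
  also have "\<dots> = avg cube (\<lambda>s. E (\<lambda>n. g n s * (\<Prod>i\<in>UNIV. u i n s)))"
  proof (rule avg_cong)
    fix s
    have "periodic N (\<lambda>x. (\<nu> x - 1) * (\<Prod>i\<in>UNIV. v i x s))"
      using vper \<nu>_periodic by (simp add: periodic_def)
    from E_shift[OF this, of "\<kappa> * tot s"]
    show "E (\<lambda>x. (\<nu> x - 1) * (\<Prod>i\<in>UNIV. v i x s)) = E (\<lambda>n. g n s * (\<Prod>i\<in>UNIV. u i n s))"
      by (simp add: g_def u_def)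
  qed
  also have "\<dots> = E (\<lambda>n. avg cube (\<lambda>s. g n s * (\<Prod>i\<in>UNIV. u i n s)))" by (rule avg_swap)
  finally have eq: "E (\<lambda>x. (\<nu> x - 1) * \<phi> x) = E (\<lambda>n. avg cube (\<lambda>s. g n s * (\<Prod>i\<in>UNIV. u i n s)))" .
  have "\<bar>E (\<lambda>n. avg cube (\<lambda>s. g n s * (\<Prod>i\<in>UNIV. u i n s)))\<bar> ^ (2 ^ CARD('k)) \<le>
    2 ^ (2 ^ CARD('k)) * \<bar>E (\<lambda>n. avg cube (\<lambda>s. avg cube (\<lambda>t.
      (\<Prod>A\<in>Pow UNIV. g n (mix A s t)) * (\<Prod>l\<in>(UNIV :: 'k set). \<Prod>A\<in>Pow (UNIV - {l}). 1))))\<bar>"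
    unfolding cube_def
  proof (rule gowers_Cauchy_Schwarz[where w = "\<lambda>_ _ _. 1 :: real"])
    show "u l n (s(l := x)) = u l n s" for l n s x
    proof -
      have "n + \<kappa> * tot (s(l := x)) = (n + \<kappa> * tot s) + \<kappa> * (x - s l)"
        by (simp add: tot_upd algebra_simps)
      moreover have "s(l := x) = s(l := s l + (x - s l))" by simp
      ultimately show ?thesis using v(1) unfolding u_def dual_factors_def by metis
    qed
    show "\<bar>u l n s\<bar> \<le> 1" for l n s using v(1) by (auto simp: u_def dual_factors_def)
    show "E (\<lambda>p. avg (UNIV \<rightarrow>\<^sub>E {1..M}) (\<lambda>s :: 'k \<Rightarrow> int. avg (UNIV \<rightarrow>\<^sub>E {1..M}) (\<lambda>t :: 'k \<Rightarrow> int. \<Prod>A\<in>Pow J. 1))) \<le> 2" for J :: "'k set"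
      using cube_ne unfolding cube_def by (simp add: avg_const[OF G_ne] avg_const)
  qed (use M in auto)
  also have "\<bar>E (\<lambda>n. avg cube (\<lambda>s. avg cube (\<lambda>t.
      (\<Prod>A\<in>Pow UNIV. g n (mix A s t)) * (\<Prod>l\<in>(UNIV :: 'k set). \<Prod>A\<in>Pow (UNIV - {l}). 1))))\<bar> \<le> 2 ^ (2 ^ CARD('k)) * \<eta>"
  proof -
    have "\<bar>avg ({0..<int N} \<times> cube \<times> cube) (\<lambda>q. (\<Prod>A\<in>Pow UNIV.
       (\<lambda>(n, s, t). \<nu> (n + \<kappa> * tot (mix A s t))) q - 1) * 1)\<bar> \<le> 2 ^ card (Pow (UNIV :: 'k set)) * \<eta>"
    proof (rule avg_prod_minus_one)
      fix B :: "'k set set"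
      show "\<bar>avg ({0..<int N} \<times> cube \<times> cube)
          (\<lambda>q. (\<Prod>A\<in>B. (\<lambda>(n, s, t). \<nu> (n + \<kappa> * tot (mix A s t))) q) * 1) - 1\<bar> \<le> \<eta>"
        using linear_forms_cube[of B] by (simp add: avg_Times)
    qed auto
    then show ?thesis by (simp add: avg_Times g_def card_Pow)
  qed
  finally show ?thesis unfolding eq by (intro root_bound) auto
qed

end

section \<open>Correlations of the functions \<open>dual\<close> with each other and with
  \<open>\<nu> - 1\<close>\<close>

lemma scaled_avg_mult_avg: "c * (avg A g * avg B h) = avg A (\<lambda>x. avg B (\<lambda>y. c * (g x * h y)))"
  by (simp add: avg_cmult avg_multc)

context ap_system
begin

text \<open>\<open>Z\<close> is the set of positions at which only the bound by \<open>\<nu>\<close>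
  is known; \<open>counting\<close> is an induction on its size.\<close>

definition majorant :: "'k set \<Rightarrow> 'k \<Rightarrow> int \<Rightarrow> real" where
  "majorant Z i x = (if i \<in> Z then \<nu> x else 1)"

definition majorant_avg :: "'k set \<Rightarrow> 'k \<Rightarrow> int set \<Rightarrow> int \<Rightarrow> real" where
  "majorant_avg Z j I n = avg I (\<lambda>d. \<Prod>i\<in>UNIV - {j}. majorant Z i (n + (c i - c j) * d))"

lemma majorant_nonneg: "0 \<le> majorant Z i x"
  using \<nu>_nonneg by (simp add: majorant_def)

lemma majorant_avg_nonneg: "0 \<le> majorant_avg Z j I n"
  unfolding majorant_avg_def by (intro avg_nonneg prod_nonneg) (auto simp: majorant_nonneg)

lemma dual_majorant: "dual (majorant Z) j = majorant_avg Z j {1..D}"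
  by (simp add: dual_def majorant_avg_def fun_eq_iff)

lemma prod_majorant: "(\<Prod>i\<in>UNIV - {j}. majorant Z i (h i)) = (\<Prod>i\<in>Z - {j}. \<nu> (h i))"
proof -
  have "(\<Prod>i\<in>UNIV - {j}. majorant Z i (h i)) = (\<Prod>i\<in>Z - {j}. majorant Z i (h i))"
    by (rule prod.mono_neutral_right) (auto simp: majorant_def)
  then show ?thesis by (simp add: majorant_def)
qed

lemma body_ne: "finite (body j)" "body j \<noteq> {}"
  using M D by (auto simp: body_def PiE_eq_empty_iff intro!: finite_box)

lemma body_resample: "avg (body j) h = avg (body j) (\<lambda>s. avg {1..D} (\<lambda>x. h (s(j := x))))"
proof -
  have "avg (body j) h = avg (body j) (\<lambda>s. avg (if j = j then {1..D} else {1..M}) (\<lambda>x. h (s(j := x))))"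
    unfolding body_def by (rule box_resample) (use M D in auto)
  then show ?thesis by simp
qed

text \<open>Coordinate \<open>j\<close> of both copies is pulled out as explicit parameters
  \<open>x\<close> and \<open>y\<close>, because Cauchy--Schwarz is to double every variable except
  this one.\<close>

lemma body_resample_pair:
  "E (\<lambda>n. avg (body j) (\<lambda>s. avg (body j) (h n s))) =
    avg ({0..<int N} \<times> {1..D} \<times> {1..D}) (\<lambda>(n, x, y).
      avg (body j) (\<lambda>s. avg (body j) (\<lambda>t. h n (s(j := x)) (t(j := y)))))"
proof -
  have "avg (body j) (\<lambda>s. avg (body j) (h n s)) =
    avg {1..D} (\<lambda>x. avg {1..D} (\<lambda>y. avg (body j) (\<lambda>s. avg (body j) (\<lambda>t. h n (s(j := x)) (t(j := y))))))" for n
  proof -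
    have "avg (body j) (\<lambda>s. avg (body j) (h n s)) =
      avg (body j) (\<lambda>s. avg {1..D} (\<lambda>x. avg (body j) (\<lambda>t. avg {1..D} (\<lambda>y. h n (s(j := x)) (t(j := y))))))"
      by (subst body_resample) (subst (2) body_resample, rule refl)
    also have "\<dots> = avg {1..D} (\<lambda>x. avg (body j) (\<lambda>s. avg {1..D} (\<lambda>y. avg (body j) (\<lambda>t. h n (s(j := x)) (t(j := y))))))"
      by (subst avg_swap) (subst (3) avg_swap, rule refl)
    also have "\<dots> = avg {1..D} (\<lambda>x. avg {1..D} (\<lambda>y. avg (body j) (\<lambda>s. avg (body j) (\<lambda>t. h n (s(j := x)) (t(j := y))))))"
      by (subst (2) avg_swap) (rule refl)
    finally show ?thesis .
  qed
  then show ?thesis by (simp add: avg_Times)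
qed

end

context ap_pseudorandom
begin

lemma majorant_avg_corr:
  assumes I: "I \<in> {{1..D}, {1..width}, {D+1..D+width}}" and I': "I' \<in> {{1..D}, {1..width}, {D+1..D+width}}"
  shows "\<bar>E (\<lambda>n. (if b then \<nu> n else 1) * (majorant_avg Z j I n * majorant_avg Z' j I' n)) - 1\<bar> \<le> \<eta>"
  using linear_forms_plane[OF I I', of "Z - {j}" j "Z' - {j}" b,
      OF Diff_mono[OF subset_UNIV order_refl] Diff_mono[OF subset_UNIV order_refl]]
  by (simp add: majorant_avg_def prod_majorant avg_mult_avg)

lemma majorant_avg_mean:
  "\<bar>E (\<lambda>n. (if b then \<nu> n else 1) * majorant_avg Z j {1..D} n) - 1\<bar> \<le> \<eta>"
  using majorant_avg_corr[of "{1..D}" "{1..D}" b Z j "{}"]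
  by (simp add: majorant_avg_def[of "{}"] prod_majorant avg_const[OF D_ne])

text \<open>The first and second moments are both 1 up to \<open>\<eta>\<close>, which gives even
  \<open>3 * \<eta>\<close>. The second moment is what the two independent variables of the third
  condition provide.\<close>

lemma majorant_avg_variance:
  "E (\<lambda>n. (majorant_avg Z j {1..D} n - 1)\<^sup>2) \<le> 4 * \<eta>"
proof -
  let ?W = "majorant_avg Z j {1..D}"
  have "E (\<lambda>n. (?W n - 1)\<^sup>2) = E (\<lambda>n. ?W n * ?W n) - 2 * E ?W + 1"
  proof -
    have "E (\<lambda>n. (?W n - 1)\<^sup>2) = E (\<lambda>n. ?W n * ?W n - 2 * ?W n + 1)"
      by (intro avg_cong) (simp add: power2_eq_square algebra_simps)
    then show ?thesis by (simp only: avg_add avg_diff avg_const[OF G_ne] avg_cmult)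
  qed
  then show ?thesis
    using majorant_avg_corr[of "{1..D}" "{1..D}" False Z j Z] majorant_avg_mean[of False Z j] \<eta> by simp
qed

text \<open>Both copies of the common difference are shifted by the same \<open>h\<close>. The end
  intervals are dominated by averages of \<open>\<nu>\<close>, and the third condition bounds the
  correlations of these, with or without a further weight \<open>\<nu>\<close>.\<close>

lemma dual_pair_shift:
  fixes F F' :: "'k \<Rightarrow> int \<Rightarrow> real" and j :: 'k
  defines "A \<equiv> \<lambda>F h n. avg {1..D} (\<lambda>d. \<Prod>i\<in>UNIV - {j}. F i (n + (c i - c j) * (d + h)))"
  assumes F: "\<And>i x. 0 \<le> F i x" "\<And>i x. F i x \<le> majorant Z i x"
    and F': "\<And>i x. 0 \<le> F' i x" "\<And>i x. F' i x \<le> majorant Z' i x"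
    and h: "0 \<le> h" "h \<le> width" and wD: "width \<le> D"
  shows "\<bar>E (\<lambda>n. (\<nu> n - 1) * (dual F j n * dual F' j n)) - E (\<lambda>n. (\<nu> n - 1) * (A F h n * A F' h n))\<bar>
    \<le> 32 * (real_of_int width / real_of_int D)"
proof -
  define r where "r = real_of_int width / real_of_int D"
  have r: "0 \<le> r" "r \<le> 1" using h wD D by (auto simp: r_def)
  define W where "W Z = majorant_avg Z j {1..D}" for Z
  define V where "V Z n = majorant_avg Z j {1..width} n + majorant_avg Z j {D+1..D+width} n" for Z n
  have bd: "\<bar>dual F j n - A F h n\<bar> \<le> r * V Z n \<and> \<bar>dual F j n\<bar> \<le> W Z n"
    if F: "\<And>i x. 0 \<le> F i x" "\<And>i x. F i x \<le> majorant Z i x" for F Z n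
  proof
    show "\<bar>dual F j n - A F h n\<bar> \<le> r * V Z n"
      unfolding dual_def A_def r_def V_def majorant_avg_def using F
      by (intro avg_shift_dominated h D) (auto simp: abs_prod intro!: prod_mono)
    show "\<bar>dual F j n\<bar> \<le> W Z n"
      using dual_nonneg[of F j n] dual_mono[of F "majorant Z" j n] F by (simp add: W_def dual_majorant)
  qed
  have ptw: "\<bar>(\<nu> n - 1) * (dual F j n * dual F' j n) - (\<nu> n - 1) * (A F h n * A F' h n)\<bar> \<le>
    (\<nu> n + 1) * (r * (V Z n * W Z' n) + r * (W Z n * V Z' n) + r * (V Z n * V Z' n))" for n
  proof -
    let ?a = "dual F j n" and ?b = "dual F' j n" and ?a' = "A F h n" and ?b' = "A F' h n"
    have 1: "\<bar>?a - ?a'\<bar> \<le> r * V Z n" "\<bar>?a\<bar> \<le> W Z n" "\<bar>?b - ?b'\<bar> \<le> r * V Z' n" "\<bar>?b\<bar> \<le> W Z' n"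
      using bd[OF F] bd[OF F'] by auto
    have V0: "0 \<le> V Z n" "0 \<le> V Z' n" "0 \<le> W Z n" "0 \<le> W Z' n"
      by (auto simp: V_def W_def intro!: add_nonneg_nonneg majorant_avg_nonneg)
    have "?a * ?b - ?a' * ?b' = (?a - ?a') * ?b + ?a * (?b - ?b') - (?a - ?a') * (?b - ?b')"
      by (simp add: algebra_simps)
    then have "\<bar>?a * ?b - ?a' * ?b'\<bar> \<le> \<bar>?a - ?a'\<bar> * \<bar>?b\<bar> + \<bar>?a\<bar> * \<bar>?b - ?b'\<bar> + \<bar>?a - ?a'\<bar> * \<bar>?b - ?b'\<bar>"
      unfolding abs_mult[symmetric] by linarith
    also have "\<dots> \<le> (r * V Z n) * W Z' n + W Z n * (r * V Z' n) + (r * V Z n) * (r * V Z' n)"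
      by (intro add_mono mult_mono 1) (use V0 r in auto)
    also have "(r * V Z n) * (r * V Z' n) \<le> r * (V Z n * V Z' n)"
      using mult_right_mono[OF r(2), of "r * (V Z n * V Z' n)"] r V0 by (simp add: mult_ac)
    finally have "\<bar>?a * ?b - ?a' * ?b'\<bar> \<le> r * (V Z n * W Z' n) + r * (W Z n * V Z' n) + r * (V Z n * V Z' n)"
      by (simp add: mult_ac)
    moreover have "\<bar>\<nu> n - 1\<bar> \<le> \<nu> n + 1" using \<nu>_nonneg[of n] by linarith
    ultimately show ?thesis
      unfolding right_diff_distrib[symmetric] abs_mult using \<nu>_nonneg[of n] by (intro mult_mono) auto
  qed
  \<comment> \<open>Each correlation is at most 2, once with weight \<open>\<nu>\<close> and once
    with weight 1. As \<open>V\<close> consists of two end intervals, this leads to 8 and 16, and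
    \<open>8 + 8 + 16 = 32\<close>.\<close>
  have 4: "E (\<lambda>n. (\<nu> n + 1) * (majorant_avg Z j I n * majorant_avg Z' j I' n)) \<le> 4"
    if "I \<in> {{1..D}, {1..width}, {D+1..D+width}}" "I' \<in> {{1..D}, {1..width}, {D+1..D+width}}" for I I' Z Z'
    using majorant_avg_corr[OF that, of True Z j Z'] majorant_avg_corr[OF that, of False Z j Z'] \<eta>
    by (simp add: distrib_right avg_add)
  have 8: "E (\<lambda>n. (\<nu> n + 1) * (V Z n * W Z' n)) \<le> 8" for Z Z'
    using 4[of "{1..width}" "{1..D}" Z Z'] 4[of "{D+1..D+width}" "{1..D}" Z Z']
    by (simp add: V_def W_def distrib_right distrib_left avg_add)
  have 16: "E (\<lambda>n. (\<nu> n + 1) * (V Z n * V Z' n)) \<le> 16" for Z Z'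
    using 4[of "{1..width}" "{1..width}" Z Z'] 4[of "{D+1..D+width}" "{1..width}" Z Z']
      4[of "{1..width}" "{D+1..D+width}" Z Z'] 4[of "{D+1..D+width}" "{D+1..D+width}" Z Z']
    by (simp add: V_def distrib_right distrib_left avg_add)
  have "\<bar>E (\<lambda>n. (\<nu> n - 1) * (dual F j n * dual F' j n)) - E (\<lambda>n. (\<nu> n - 1) * (A F h n * A F' h n))\<bar> \<le>
    E (\<lambda>n. (\<nu> n + 1) * (r * (V Z n * W Z' n) + r * (W Z n * V Z' n) + r * (V Z n * V Z' n)))"
    unfolding avg_diff[symmetric] by (rule avg_abs_mono) (rule ptw)
  also have "\<dots> = r * (E (\<lambda>n. (\<nu> n + 1) * (V Z n * W Z' n)) + E (\<lambda>n. (\<nu> n + 1) * (V Z' n * W Z n)) +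
      E (\<lambda>n. (\<nu> n + 1) * (V Z n * V Z' n)))"
    unfolding avg_add[symmetric] avg_cmult[symmetric] by (intro avg_cong) (simp add: algebra_simps)
  also have "\<dots> \<le> r * (8 + 8 + 16)"
    by (intro mult_left_mono add_mono 8 16 r)
  finally show ?thesis by (simp add: r_def mult.commute)
qed

text \<open>Factor \<open>l\<close> ignores \<open>s l\<close>, so Gowers--Cauchy--Schwarz applies
  to the variables other than \<open>s j\<close>, with \<open>(n, x, y)\<close> as parameter.
  Coordinate \<open>j\<close> of \<open>body j\<close> is a dummy at this stage, being overwritten
  by \<open>x\<close> or \<open>y\<close> or ignored by \<open>form j\<close>. Afterwards
  \<open>x\<close> and \<open>y\<close> are read as \<open>s j\<close> and \<open>t j\<close>, and
  the first condition applies.\<close>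

lemma dual_pair_gowers:
  assumes F: "\<And>i x. 0 \<le> F i x" "\<And>i x. F i x \<le> majorant Z i x"
    and F': "\<And>i x. 0 \<le> F' i x" "\<And>i x. F' i x \<le> majorant Z' i x"
  shows "\<bar>avg ({0..<int N} \<times> {1..D} \<times> {1..D}) (\<lambda>(n, x, y). avg (body j) (\<lambda>s.
      (\<nu> (n + form j s) - 1) *
      (\<Prod>l\<in>UNIV - {j}. F l (n + form l (s(j := x))) * F' l (n + form l (s(j := y))))))\<bar> \<le>
    4 * root (2 ^ (CARD('k) - 1)) \<eta>"
proof -
  let ?I = "UNIV - {j} :: 'k set"
  let ?P = "{0..<int N} \<times> {1..D} \<times> {1..D}"
  define g where "g = (\<lambda>(n, x :: int, y :: int). \<lambda>s. \<nu> (n + form j s) - 1)"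
  define a where "a l = (\<lambda>(n, x, y). \<lambda>s. F l (n + form l (s(j := x))) * F' l (n + form l (s(j := y))))" for l
  define w where "w l = (\<lambda>(n, x, y). \<lambda>s.
    majorant Z l (n + form l (s(j := x))) * majorant Z' l (n + form l (s(j := y))))" for l
  \<comment> \<open>Vertices containing \<open>j\<close> take the value \<open>y\<close> and belong
    to \<open>F'\<close>, the others take \<open>x\<close> and belong to \<open>F\<close>;
    \<open>sel l\<close> consists of those at which the majorant in position \<open>l\<close> is
    \<open>\<nu>\<close>.\<close>
  define sel where "sel l = {A. (j \<notin> A \<and> l \<in> Z) \<or> (j \<in> A \<and> l \<in> Z')}" for l
  have wprod: "(\<Prod>A\<in>Pow J. w l (n, x, y) (mix A s t)) =
      (\<Prod>A\<in>Pow (insert j J) \<inter> sel l. \<nu> (n + form l (mix A (s(j := x)) (t(j := y)))))"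
    if J: "j \<notin> J" for J l n x y s t
  proof -
    define G where "G A u = (if A \<in> sel l then \<nu> (n + form l u) else 1)" for A u
    have "(\<Prod>A\<in>Pow J. w l (n, x, y) (mix A s t)) =
      (\<Prod>A\<in>Pow J. G A ((mix A s t)(j := x)) * G (insert j A) ((mix A s t)(j := y)))"
      using J by (intro prod.cong refl) (auto simp: w_def G_def sel_def majorant_def)
    also have "\<dots> = (\<Prod>A\<in>Pow (insert j J). G A (mix A (s(j := x)) (t(j := y))))"
      by (rule mix_prod_Pow_insert[OF J, symmetric])
    also have "\<dots> = (\<Prod>A\<in>Pow (insert j J) \<inter> sel l. \<nu> (n + form l (mix A (s(j := x)) (t(j := y)))))"
      by (simp add: G_def prod.inter_restrict)
    finally show ?thesis .
  qed
  have upd: "form l ((s(l := z))(j := x)) = form l (s(j := x))" if "l \<noteq> j" for l s z x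
    using that form_upd_self[of l "s(j := x)" z] by (simp add: fun_upd_twist)
  define Q where "Q = avg ?P (\<lambda>p. avg (body j) (\<lambda>s. avg (body j) (\<lambda>t.
      (\<Prod>A\<in>Pow ?I. g p (mix A s t)) * (\<Prod>l\<in>?I. \<Prod>A\<in>Pow (?I - {l}). w l p (mix A s t)))))"
  have "\<bar>avg ?P (\<lambda>p. avg (body j) (\<lambda>s. g p s * (\<Prod>l\<in>?I. a l p s)))\<bar> ^ (2 ^ card ?I) \<le>
    2 ^ (2 ^ card ?I) * \<bar>Q\<bar>"
    unfolding Q_def body_def
  proof (rule gowers_Cauchy_Schwarz)
    show "finite (if i = j then {1..D} else {1..M})" "(if i = j then {1..D} else {1..M}) \<noteq> {}" for i
      using M D by auto
    show "a l p (s(l := z)) = a l p s" if "l \<in> ?I" for l p s z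
      using that by (cases p) (simp add: a_def upd)
    show "w l p (s(l := z)) = w l p s" if "l \<in> ?I" for l p s z
      using that by (cases p) (simp add: w_def upd)
    show "\<bar>a l p s\<bar> \<le> w l p s" for l p s
      using F F' by (cases p) (auto simp: a_def w_def abs_mult intro!: mult_mono majorant_nonneg)
    fix i J assume i: "i \<in> ?I" and J: "J \<subseteq> ?I - {i}"
    \<comment> \<open>The mean of majorants involves the single form with index
      \<open>i\<close>.\<close>
    define Y where "Y l = (if l = i then Pow (insert j J) \<inter> sel i else {})" for l
    have prodY: "(\<Prod>l\<in>UNIV. \<Prod>A\<in>Y l. h l A) = (\<Prod>A\<in>Pow (insert j J) \<inter> sel i. h i A)"
      for h :: "'k \<Rightarrow> 'k set \<Rightarrow> real"
      by (subst prod.remove[of UNIV i]) (auto simp: Y_def)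
    have jJ: "j \<notin> J" using J by auto
    have "avg ?P (\<lambda>p. avg (body j) (\<lambda>s. avg (body j) (\<lambda>t. \<Prod>A\<in>Pow J. w i p (mix A s t)))) =
      E (\<lambda>n. avg (body j) (\<lambda>s. avg (body j) (\<lambda>t. \<Prod>l\<in>UNIV. \<Prod>A\<in>Y l. \<nu> (n + form l (mix A s t)))))"
      unfolding body_resample_pair prodY
      by (intro avg_cong) (auto simp: wprod[OF jJ] split: prod.splits)
    also have "\<dots> \<le> 2"
    proof -
      have "Y l \<subseteq> Pow (UNIV - {l})" for l using i J by (auto simp: Y_def)
      from linear_forms_AP[OF this, of j] show ?thesis using \<eta> by linarith
    qed
    finally show "avg ?P (\<lambda>p. avg (PiE UNIV (\<lambda>i. if i = j then {1..D} else {1..M}))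
      (\<lambda>s. avg (PiE UNIV (\<lambda>i. if i = j then {1..D} else {1..M})) (\<lambda>t. \<Prod>A\<in>Pow J. w i p (mix A s t)))) \<le> 2"
      unfolding body_def .
  qed
  also have "\<bar>Q\<bar> \<le> 2 ^ card (Pow ?I) * \<eta>"
  proof -
    let ?T = "{0..<int N} \<times> body j \<times> body j"
    define G where "G = (\<lambda>(n, s, t). \<lambda>A. \<nu> (n + form j (mix A s t)))"
    define R where "R = (\<lambda>(n, s, t). \<Prod>l\<in>?I. \<Prod>A\<in>Pow (UNIV - {l}) \<inter> sel l. \<nu> (n + form l (mix A s t)))"
    have "Q = E (\<lambda>n. avg (body j) (\<lambda>s. avg (body j) (\<lambda>t. (\<Prod>A\<in>Pow ?I. G (n, s, t) A - 1) * R (n, s, t))))"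
    proof -
      have "(\<Prod>l\<in>?I. \<Prod>A\<in>Pow (?I - {l}). w l (n, x, y) (mix A s t)) = R (n, s(j := x), t(j := y))" for n x y s t
        unfolding R_def prod.case
      proof (rule prod.cong[OF refl])
        fix l assume l: "l \<in> ?I"
        then have "insert j (?I - {l}) = UNIV - {l}" by auto
        with wprod[of "?I - {l}" l n x y s t]
        show "(\<Prod>A\<in>Pow (?I - {l}). w l (n, x, y) (mix A s t)) =
          (\<Prod>A\<in>Pow (UNIV - {l}) \<inter> sel l. \<nu> (n + form l (mix A (s(j := x)) (t(j := y)))))" by simp
      qed
      moreover have "(\<Prod>A\<in>Pow ?I. g (n, x, y) (mix A s t)) =
        (\<Prod>A\<in>Pow ?I. G (n, s(j := x), t(j := y)) A - 1)" for n x y s t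
      proof (rule prod.cong[OF refl])
        fix A assume "A \<in> Pow ?I"
        then have "mix A (s(j := x)) (t(j := y)) = (mix A s t)(j := x)"
          by (auto simp: mix_def fun_eq_iff)
        then show "g (n, x, y) (mix A s t) = G (n, s(j := x), t(j := y)) A - 1"
          by (simp add: g_def G_def form_upd_self)
      qed
      ultimately show ?thesis
        unfolding Q_def body_resample_pair by (intro avg_cong) (auto split: prod.splits)
    qed
    also have "\<dots> = avg ?T (\<lambda>q. (\<Prod>A\<in>Pow ?I. G q A - 1) * R q)"
      by (simp add: avg_Times)
    also have "\<bar>\<dots>\<bar> \<le> 2 ^ card (Pow ?I) * \<eta>"
    proof (rule avg_prod_minus_one)
      fix B assume B: "B \<subseteq> Pow ?I"
      \<comment> \<open>The subset \<open>B\<close> of the vertices of \<open>form j\<close> comes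
        from expanding \<open>\<nu> - 1\<close>; the factors of the other forms are all kept, as
        prescribed by \<open>sel\<close>.\<close>
      define Y where "Y l = (if l = j then B else Pow (UNIV - {l}) \<inter> sel l)" for l
      have "(\<Prod>l\<in>UNIV. \<Prod>A\<in>Y l. \<nu> (n + form l (mix A s t))) = (\<Prod>A\<in>B. G (n, s, t) A) * R (n, s, t)" for n s t
        by (subst prod.remove[of UNIV j]) (auto simp: Y_def G_def R_def)
      then show "\<bar>avg ?T (\<lambda>q. (\<Prod>A\<in>B. G q A) * R q) - 1\<bar> \<le> \<eta>"
        using linear_forms_AP[of Y j] B by (force simp: avg_Times Y_def)
    qed auto
    finally show ?thesis .
  qed
  finally have "\<bar>avg ?P (\<lambda>p. avg (body j) (\<lambda>s. g p s * (\<Prod>l\<in>?I. a l p s)))\<bar> ^ (2 ^ card ?I) \<le>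
    2 ^ (2 ^ card ?I) * (2 ^ (2 ^ card ?I) * \<eta>)" by (simp add: card_Pow)
  then have "\<bar>avg ?P (\<lambda>p. avg (body j) (\<lambda>s. g p s * (\<Prod>l\<in>?I. a l p s)))\<bar> \<le> 4 * root (2 ^ card ?I) \<eta>"
    by (rule root_bound) simp
  moreover have "avg ?P (\<lambda>p. avg (body j) (\<lambda>s. g p s * (\<Prod>l\<in>?I. a l p s))) =
    avg ?P (\<lambda>(n, x, y). avg (body j) (\<lambda>s. (\<nu> (n + form j s) - 1) *
      (\<Prod>l\<in>?I. F l (n + form l (s(j := x))) * F' l (n + form l (s(j := y))))))"
    by (intro avg_cong) (auto simp: g_def a_def split: prod.splits)
  ultimately show ?thesis by (simp add: card_Diff_singleton)
qed

text \<open>\<open>dual_pair_shift\<close> moves both common differences by the sum of the auxiliary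
  variables, then \<open>n\<close> is moved by \<open>form j s\<close>. By \<open>form_shift\<close>
  the correlation takes the shape treated in \<open>dual_pair_gowers\<close>.\<close>

lemma \<nu>_dual_dual:
  assumes per: "\<And>i. periodic N (F i)" "\<And>i. periodic N (F' i)"
    and F: "\<And>i x. 0 \<le> F i x" "\<And>i x. F i x \<le> majorant Z i x"
    and F': "\<And>i x. 0 \<le> F' i x" "\<And>i x. F' i x \<le> majorant Z' i x"
    and wD: "width \<le> D"
  shows "\<bar>E (\<lambda>n. (\<nu> n - 1) * (dual F j n * dual F' j n))\<bar> \<le>
    4 * root (2 ^ (CARD('k) - 1)) \<eta> + 32 * (real_of_int width / real_of_int D)"
proof -
  define A where "A = (\<lambda>F h n. avg {1..D} (\<lambda>d. \<Prod>i\<in>UNIV - {j}. F i (n + (c i - c j) * (d + h))) :: real)"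
  define h where "h s = (\<Sum>l\<in>UNIV - {j}. s l)" for s :: "'k \<Rightarrow> int"
  let ?e = "E (\<lambda>n. (\<nu> n - 1) * (dual F j n * dual F' j n))"
  let ?q = "\<lambda>s. E (\<lambda>n. (\<nu> n - 1) * (A F (h s) n * A F' (h s) n))"
  have h: "0 \<le> h s \<and> h s \<le> width" if s: "s \<in> body j" for s
  proof
    have s: "1 \<le> s l \<and> s l \<le> M" if "l \<noteq> j" for l
      using PiE_mem[OF s[unfolded body_def], of l] that by auto
    show "0 \<le> h s" unfolding h_def by (rule sum_nonneg) (use s in force)
    have "h s \<le> (\<Sum>l\<in>UNIV - {j}. M)" unfolding h_def by (rule sum_mono) (use s in auto)
    also have "\<dots> \<le> (\<Sum>l\<in>(UNIV :: 'k set). M)" using M by (intro sum_mono2) auto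
    finally show "h s \<le> width" by (simp add: width_def)
  qed
  have "\<bar>avg (body j) (\<lambda>s. ?e - ?q s)\<bar> \<le> 32 * (real_of_int width / real_of_int D)"
    unfolding A_def by (intro avg_abs_le body_ne dual_pair_shift[OF F F']) (use h wD in auto)
  moreover have "avg (body j) (\<lambda>s. ?e - ?q s) = ?e - avg (body j) ?q"
    by (simp add: avg_diff avg_const[OF body_ne])
  moreover have "\<bar>avg (body j) ?q\<bar> \<le> 4 * root (2 ^ (CARD('k) - 1)) \<eta>"
  proof -
    have A': "A F (h s) (n + form j s) = avg {1..D} (\<lambda>x. \<Prod>l\<in>UNIV - {j}. F l (n + form l (s(j := x))))" for F s n
    proof -
      have "n + form j s + (c i - c j) * (d + h s) = n + form i (s(j := d))" for i d
        using form_shift[of j s i d] by (simp add: h_def)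
      then show ?thesis unfolding A_def by (simp only:)
    qed
    have "?q s = E (\<lambda>n. avg {1..D} (\<lambda>x. avg {1..D} (\<lambda>y. (\<nu> (n + form j s) - 1) *
      (\<Prod>l\<in>UNIV - {j}. F l (n + form l (s(j := x))) * F' l (n + form l (s(j := y)))))))" for s
    proof -
      have "periodic N (\<lambda>n. A F (h s) n)" if "\<And>i. periodic N (F i)" for F
        unfolding A_def using that by (intro periodicI) (simp add: periodic_shift[THEN periodicD])
      then have "periodic N (\<lambda>n. (\<nu> n - 1) * (A F (h s) n * A F' (h s) n))"
        using per \<nu>_periodic by (simp add: periodic_def)
      from E_shift[OF this, of "form j s"] show ?thesis
        by (simp only: A' prod.distrib scaled_avg_mult_avg)
    qed
    then have "avg (body j) ?q = avg ({0..<int N} \<times> {1..D} \<times> {1..D}) (\<lambda>(n, x, y). avg (body j) (\<lambda>s.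
      (\<nu> (n + form j s) - 1) *
      (\<Prod>l\<in>UNIV - {j}. F l (n + form l (s(j := x))) * F' l (n + form l (s(j := y))))))"
      by (simp add: avg_Times) (subst avg_swap, rule avg_cong, subst avg_swap, rule avg_cong, subst avg_swap, rule refl)
    then show ?thesis using dual_pair_gowers[OF F F', of j] by simp
  qed
  ultimately show ?thesis by linarith
qed

end

subsection \<open>Densification\<close>

context ap_system
begin

lemma count_upd:
  assumes "\<And>i. periodic N (F i)" "periodic N h"
  shows "count (F(j := h)) = E (\<lambda>n. h n * dual F j n)"
  using count_eq_dual[of "F(j := h)" j] assms by (simp add: dual_upd_self)

lemma count_diff:
  assumes "\<And>i. periodic N (F i)" "periodic N f" "periodic N g"
  shows "count (F(j := f)) - count (F(j := g)) = count (F(j := (\<lambda>x. f x - g x)))"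
proof -
  have "periodic N (\<lambda>x. f x - g x)" using assms by (simp add: periodic_def)
  then show ?thesis
    using assms by (simp add: count_upd avg_diff[symmetric] left_diff_distrib)
qed

end

text \<open>
  The error bound after \<open>m\<close> densification steps, where \<open>\<tau>\<close> bounds all the errors of a single step.
\<close>

primrec counting_error :: "nat \<Rightarrow> real \<Rightarrow> nat \<Rightarrow> real" where
  "counting_error k \<tau> 0 = real k * \<tau>"
| "counting_error k \<tau> (Suc m) =
     sqrt (2 * (4 * \<tau> + 2 * counting_error k \<tau> m + (\<tau> + 2 * sqrt \<tau>))) + \<tau>"

lemma counting_error_tendsto: "(\<lambda>\<tau>. counting_error k \<tau> m) \<midarrow>0\<rightarrow> 0"
  by (induction m) (auto intro!: tendsto_eq_intros)

text \<open>The excess of \<open>a\<close> over 1 is at most \<open>\<bar>W - 1\<bar>\<close>, and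
  \<open>a - b\<close> is at most \<open>W + 1\<close>; hence it suffices that \<open>W - 1\<close>
  is small in mean square.\<close>

lemma truncation_error_bound:
  fixes a b W :: real
  assumes "0 \<le> a" "a \<le> W" "0 \<le> b" "b \<le> 1"
  shows "(a - b) * (a - min a 1) \<le> (W - 1)\<^sup>2 + 2 * \<bar>W - 1\<bar>"
proof -
  have 1: "a - min a 1 \<le> \<bar>W - 1\<bar>" "0 \<le> a - min a 1" using assms by auto
  have "(a - b) * (a - min a 1) \<le> (W + 1) * \<bar>W - 1\<bar>"
    by (rule order_trans[OF mult_right_mono mult_left_mono[OF 1(1)]]) (use assms in auto)
  also have "\<dots> \<le> (\<bar>W - 1\<bar> + 2) * \<bar>W - 1\<bar>" by (intro mult_right_mono) auto
  finally show ?thesis by (simp add: power2_eq_square distrib_right abs_mult_self_eq)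
qed

context ap_pseudorandom
begin

text \<open>The difference of the counts is the mean of \<open>F j * (a - b)\<close> plus the term
  in \<open>last\<close>. Cauchy--Schwarz with weight \<open>\<nu>\<close> leads to the mean of
  \<open>\<nu> * (a - b)\<^sup>2\<close>, and \<open>\<nu> = (\<nu> - 1) + 1\<close> splits it: the
  first part expands into four terms for \<open>\<nu>_dual_dual\<close>. In the second, one factor
  \<open>a - b\<close> becomes \<open>g - b\<close>, and as \<open>g\<close> and \<open>b\<close>
  have values in the unit interval, \<open>IH\<close> applies with them at position
  \<open>j\<close>.\<close>

lemma counting_step:
  fixes F F' :: "'k \<Rightarrow> int \<Rightarrow> real"
  assumes per: "\<And>i. periodic N (F i)" "\<And>i. periodic N (F' i)"
    and F: "\<And>i x. 0 \<le> F i x" "\<And>i x. F i x \<le> majorant Z i x"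
    and F': "\<And>i x. 0 \<le> F' i x" "\<And>i x. F' i x \<le> 1"
    and wD: "width \<le> D"
    and \<tau>: "4 * root (2 ^ (CARD('k) - 1)) \<eta> + 32 * (real_of_int width / real_of_int D) \<le> \<tau>" "4 * \<eta> \<le> \<tau>"
    and j: "j \<in> Z"
    and IH: "\<And>g. periodic N g \<Longrightarrow> (\<And>x. 0 \<le> g x) \<Longrightarrow> (\<And>x. g x \<le> 1) \<Longrightarrow>
      \<bar>count (F(j := g)) - count (F'(j := g))\<bar> \<le> \<beta>"
    and last: "\<bar>count (F'(j := (\<lambda>x. F j x - F' j x)))\<bar> \<le> \<tau>"
  shows "\<bar>count F - count F'\<bar> \<le> sqrt (2 * (4 * \<tau> + 2 * \<beta> + (\<tau> + 2 * sqrt \<tau>))) + \<tau>"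
proof -
  define a where "a = dual F j"
  define b where "b = dual F' j"
  define g where "g x = min (a x) 1" for x
  define W where "W = majorant_avg Z j {1..D}"
  have a: "0 \<le> a x" "a x \<le> W x" for x
    unfolding a_def W_def dual_majorant[symmetric] by (intro dual_nonneg dual_mono F)+
  have b: "0 \<le> b x" "b x \<le> 1" for x
    unfolding b_def by (intro dual_nonneg dual_le_1 F')+
  have pa: "periodic N a" and pb: "periodic N b"
    unfolding a_def b_def by (intro periodic_dual per)+
  have pg: "periodic N g" using pa by (simp add: g_def periodic_def)
  have g: "0 \<le> g x" "g x \<le> 1" for x using a by (auto simp: g_def)
  have F'1: "F' i x \<le> majorant {} i x" for i x using F' by (simp add: majorant_def)
  have \<tau>0: "0 \<le> \<tau>" using \<tau>(2) \<eta> by linarith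
  have "count F - count F' = E (\<lambda>n. F j n * (a n - b n)) + E (\<lambda>n. (F j n - F' j n) * b n)"
    unfolding count_eq_dual[where j = j, OF per(1)] count_eq_dual[where j = j, OF per(2)] a_def b_def
      avg_diff[symmetric] avg_add[symmetric]
    by (intro avg_cong) (simp add: algebra_simps)
  moreover have "E (\<lambda>n. (F j n - F' j n) * b n) = count (F'(j := (\<lambda>x. F j x - F' j x)))"
  proof -
    have "periodic N (\<lambda>x. F j x - F' j x)" using per by (simp add: periodic_def)
    then show ?thesis by (simp add: count_upd per b_def)
  qed
  moreover have "\<bar>E (\<lambda>n. F j n * (a n - b n))\<bar> \<le> sqrt (2 * (4 * \<tau> + 2 * \<beta> + (\<tau> + 2 * sqrt \<tau>)))"
  proof (rule real_le_rsqrt, unfold power2_abs)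
    have bil: "\<bar>E (\<lambda>n. (a n - b n) * g n)\<bar> \<le> \<beta>" if g: "periodic N g" "\<And>x. 0 \<le> g x" "\<And>x. g x \<le> 1" for g
    proof -
      have "count (F(j := g)) - count (F'(j := g)) = E (\<lambda>n. (a n - b n) * g n)"
        by (simp add: count_upd per g a_def b_def avg_diff[symmetric] algebra_simps)
      with IH[OF g] show ?thesis by linarith
    qed
    have weighted: "E (\<lambda>n. (\<nu> n - 1) * (a n - b n)\<^sup>2) \<le> 4 * \<tau>"
    proof -
      have "E (\<lambda>n. (\<nu> n - 1) * (a n - b n)\<^sup>2) = E (\<lambda>n. (\<nu> n - 1) * (a n * a n))
        - E (\<lambda>n. (\<nu> n - 1) * (a n * b n)) - E (\<lambda>n. (\<nu> n - 1) * (b n * a n)) + E (\<lambda>n. (\<nu> n - 1) * (b n * b n))"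
        unfolding avg_diff[symmetric] avg_add[symmetric]
        by (intro avg_cong) (simp add: power2_eq_square algebra_simps)
      moreover have "\<bar>E (\<lambda>n. (\<nu> n - 1) * (a n * a n))\<bar> \<le> \<tau>" "\<bar>E (\<lambda>n. (\<nu> n - 1) * (a n * b n))\<bar> \<le> \<tau>"
        "\<bar>E (\<lambda>n. (\<nu> n - 1) * (b n * a n))\<bar> \<le> \<tau>" "\<bar>E (\<lambda>n. (\<nu> n - 1) * (b n * b n))\<bar> \<le> \<tau>"
        unfolding a_def b_def by (rule order_trans[OF \<nu>_dual_dual \<tau>(1)]; fact per F F' F'1 wD)+
      ultimately show ?thesis by linarith
    qed
    have unweighted: "E (\<lambda>n. (a n - b n)\<^sup>2) \<le> 2 * \<beta> + (\<tau> + 2 * sqrt \<tau>)"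
    proof -
      have var: "E (\<lambda>n. (W n - 1)\<^sup>2) \<le> \<tau>"
        using majorant_avg_variance[of Z j] \<tau>(2) by (simp add: W_def)
      have dev: "E (\<lambda>n. \<bar>W n - 1\<bar>) \<le> sqrt \<tau>"
      proof (rule real_le_rsqrt)
        have "(E (\<lambda>n. \<bar>W n - 1\<bar>))\<^sup>2 \<le> E (\<lambda>n. (W n - 1)\<^sup>2)"
          using weighted_Cauchy_Schwarz[of "{0..<int N}" "\<lambda>_. 1" "\<lambda>_. 1" "\<lambda>n. \<bar>W n - 1\<bar>"]
          by (simp add: avg_const[OF G_ne])
        then show "(E (\<lambda>n. \<bar>W n - 1\<bar>))\<^sup>2 \<le> \<tau>" using var by linarith
      qed
      \<comment> \<open>One factor is written as \<open>a - b = (g - b) + (a - g)\<close>; the tests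
        \<open>g\<close> and \<open>b\<close> cost \<open>\<beta>\<close> each and
        \<open>a - g\<close> is the truncation error.\<close>
      have "E (\<lambda>n. (a n - b n)\<^sup>2) = E (\<lambda>n. (a n - b n) * g n) - E (\<lambda>n. (a n - b n) * b n)
          + E (\<lambda>n. (a n - b n) * (a n - min (a n) 1))"
        unfolding avg_diff[symmetric] avg_add[symmetric]
        by (intro avg_cong) (simp add: power2_eq_square algebra_simps g_def)
      also have "E (\<lambda>n. (a n - b n) * (a n - min (a n) 1)) \<le> E (\<lambda>n. (W n - 1)\<^sup>2 + 2 * \<bar>W n - 1\<bar>)"
        by (intro avg_mono truncation_error_bound a b)
      also have "\<dots> = E (\<lambda>n. (W n - 1)\<^sup>2) + 2 * E (\<lambda>n. \<bar>W n - 1\<bar>)"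
        by (simp add: avg_add avg_cmult)
      finally show ?thesis
        using bil[OF pg g] bil[OF pb b] var dev by linarith
    qed
    have "(E (\<lambda>n. F j n * (a n - b n)))\<^sup>2 \<le> E \<nu> * E (\<lambda>n. \<nu> n * (a n - b n)\<^sup>2)"
    proof (rule weighted_Cauchy_Schwarz)
      show "\<bar>F j n\<bar> \<le> \<nu> n" for n using F(1)[of j n] F(2)[of j n] j by (simp add: majorant_def)
    qed
    also have "\<dots> \<le> 2 * E (\<lambda>n. \<nu> n * (a n - b n)\<^sup>2)"
      by (intro mult_right_mono \<nu>_mean avg_nonneg mult_nonneg_nonneg \<nu>_nonneg) simp
    also have "E (\<lambda>n. \<nu> n * (a n - b n)\<^sup>2) = E (\<lambda>n. (\<nu> n - 1) * (a n - b n)\<^sup>2) + E (\<lambda>n. (a n - b n)\<^sup>2)"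
      unfolding avg_add[symmetric] by (intro avg_cong) (simp add: algebra_simps)
    also have "2 * \<dots> \<le> 2 * (4 * \<tau> + (2 * \<beta> + (\<tau> + 2 * sqrt \<tau>)))"
      by (intro mult_left_mono add_mono weighted unweighted) simp
    finally show "(E (\<lambda>n. F j n * (a n - b n)))\<^sup>2 \<le> 2 * (4 * \<tau> + 2 * \<beta> + (\<tau> + 2 * sqrt \<tau>))"
      by (simp add: add.assoc)
  qed
  ultimately show ?thesis using last by linarith
qed

text \<open>For empty \<open>Z\<close> all functions are bounded and are exchanged one position at a
  time, each exchange costing \<open>\<tau>\<close> by \<open>count_small_bounded\<close>. In the
  induction step a bounded \<open>g\<close> at position \<open>j\<close> of both families removes
  \<open>j\<close> from \<open>Z\<close>.\<close>

lemma counting: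
  fixes F F' :: "'k \<Rightarrow> int \<Rightarrow> real"
  assumes "\<And>i. periodic N (F i)" "\<And>i. periodic N (F' i)"
    and "\<And>i x. 0 \<le> F i x" "\<And>i x. F i x \<le> majorant Z i x"
    and "\<And>i x. 0 \<le> F' i x" "\<And>i x. F' i x \<le> 1"
    and wD: "width \<le> D"
    and orth: "\<And>i \<phi>. \<phi> \<in> dual_functions \<Longrightarrow> \<bar>E (\<lambda>x. (F i x - F' i x) * \<phi> x)\<bar> \<le> \<delta>"
    and \<tau>: "4 * root (2 ^ (CARD('k) - 1)) \<eta> + 32 * (real_of_int width / real_of_int D) \<le> \<tau>" "4 * \<eta> \<le> \<tau>"
      "\<delta> + 6 * \<bar>real_of_int \<kappa>\<bar> * (real_of_int width / real_of_int D) \<le> \<tau>"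
  shows "\<bar>count F - count F'\<bar> \<le> counting_error CARD('k) \<tau> (card Z)"
  using assms(1-6) orth
proof (induction "card Z" arbitrary: Z F F')
  have small: "\<bar>count (G(j := (\<lambda>x. F j x - F' j x)))\<bar> \<le> \<tau>"
    if "\<And>i. periodic N (G i)" "\<And>i x. \<bar>G i x\<bar> \<le> 1" "periodic N (F j)" "periodic N (F' j)"
      "\<And>x. \<bar>F j x - F' j x\<bar> \<le> \<nu> x + 1"
      "\<And>\<phi>. \<phi> \<in> dual_functions \<Longrightarrow> \<bar>E (\<lambda>x. (F j x - F' j x) * \<phi> x)\<bar> \<le> \<delta>"
    for G F F' :: "'k \<Rightarrow> int \<Rightarrow> real" and j
  proof -
    have "\<bar>count (G(j := (\<lambda>x. F j x - F' j x)))\<bar> \<le>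
      \<delta> + real_of_int (int CARD('k) * \<bar>\<kappa>\<bar> * M) / real_of_int D * (2 * (E \<nu> + 1))"
      by (rule count_small_bounded[where j = j]) (use that in \<open>auto simp: periodic_def\<close>)
    also have "\<dots> \<le> \<delta> + real_of_int (int CARD('k) * \<bar>\<kappa>\<bar> * M) / real_of_int D * 6"
      using \<nu>_mean(2) M D by (intro add_left_mono mult_left_mono) auto
    also have "\<dots> = \<delta> + 6 * \<bar>real_of_int \<kappa>\<bar> * (real_of_int width / real_of_int D)"
      by (simp add: width_def mult_ac)
    finally show ?thesis using \<tau>(3) by linarith
  qed
  {
    case 0
    have F1: "F i x \<le> 1" for i x using 0 by (simp add: majorant_def)
    have "\<bar>count (\<lambda>i. if i \<in> Y then F i else F' i) - count F'\<bar> \<le> real (card Y) * \<tau>" for Y :: "'k set"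
    proof (induction Y rule: finite_induct[OF finite])
      case 1
      then show ?case by simp
    next
      case (2 j Y)
      define G where "G = (\<lambda>i. if i \<in> Y then F i else F' i)"
      have per: "periodic N (G i)" for i using 0 by (simp add: G_def)
      have "(\<lambda>i. if i \<in> insert j Y then F i else F' i) = G(j := F j)" "G = G(j := F' j)"
        using 2 by (auto simp: G_def fun_eq_iff)
      then have "count (\<lambda>i. if i \<in> insert j Y then F i else F' i) - count G =
        count (G(j := (\<lambda>x. F j x - F' j x)))"
        using count_diff[where F = G and f = "F j" and g = "F' j" and j = j] per 0 by simp
      moreover have "\<bar>\<dots>\<bar> \<le> \<tau>"
      proof (rule small)
        show "\<bar>G i x\<bar> \<le> 1" for i x using 0 F1 by (simp add: G_def)
        show "\<bar>F j x - F' j x\<bar> \<le> \<nu> x + 1" for x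
          using 0(4)[of j x] 0(6,7)[of j x] F1[of j x] \<nu>_nonneg[of x] by linarith
      qed (use 0 per in auto)
      ultimately show ?case using 2 by (simp add: G_def algebra_simps)
    qed
    from this[of UNIV] 0 show ?case by simp
  next
    case (Suc m)
    then obtain j where j: "j \<in> Z" by fastforce
    have m: "m = card (Z - {j})" using Suc j by simp
    have "\<bar>count F - count F'\<bar> \<le> sqrt (2 * (4 * \<tau> + 2 * counting_error CARD('k) \<tau> m + (\<tau> + 2 * sqrt \<tau>))) + \<tau>"
    proof (rule counting_step[OF _ _ _ _ _ _ wD \<tau>(1,2) j])
      fix g :: "int \<Rightarrow> real" assume g: "periodic N g" "\<And>x. 0 \<le> g x" "\<And>x. g x \<le> 1"
      \<comment> \<open>Position \<open>j\<close> holds \<open>g\<close> in both families, so the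
        difference there is 0 and its orthogonality bound reads
        \<open>0 \<le> \<delta>\<close>.\<close>
      have "0 \<le> \<delta>" using Suc.prems(7)[OF dual_functions_one] by (meson abs_ge_zero order_trans)
      moreover have "(F(j := g)) i x \<le> majorant (Z - {j}) i x" for i x
        using Suc.prems(4)[of i x] g by (auto simp: majorant_def split: if_splits)
      ultimately show "\<bar>count (F(j := g)) - count (F'(j := g))\<bar> \<le> counting_error CARD('k) \<tau> m"
        unfolding m
        by (intro Suc.hyps(1)[OF m]) (use Suc.prems g in \<open>auto simp: avg_def\<close>)
    next
      show "\<bar>count (F'(j := (\<lambda>x. F j x - F' j x)))\<bar> \<le> \<tau>"
      proof (rule small)
        show "\<bar>F' i x\<bar> \<le> 1" for i x using Suc.prems by simp
        show "\<bar>F j x - F' j x\<bar> \<le> \<nu> x + 1" for x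
          using Suc.prems(3,4)[of j x] Suc.prems(5,6)[of j x] j by (simp add: majorant_def)
      qed (use Suc.prems in auto)
    qed (use Suc.prems in auto)
    then show ?case by (simp add: Suc.hyps(2)[symmetric])
  }
qed

end

text \<open>First \<open>\<tau>\<close> makes the error after all steps less than
  \<open>\<epsilon>\<close>, then \<open>\<delta>\<close> is the accuracy of the model, for which
  \<open>dense_model\<close> demands \<open>\<eta>'\<close>; \<open>\<eta>\<^sub>0\<close> and
  \<open>\<rho>\<close> come last. None of them depends on \<open>N\<close>, \<open>M\<close>,
  \<open>D\<close> or the functions.\<close>

theorem transference_pseudorandom:
  fixes \<epsilon> :: real and c :: "'k::finite \<Rightarrow> int" and \<kappa> :: int
  assumes \<epsilon>: "0 < \<epsilon>"
  obtains \<eta>\<^sub>0 \<rho> where "0 < \<eta>\<^sub>0" "0 < \<rho>"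
    "\<And>N M D \<nu> \<eta> f. \<lbrakk>ap_pseudorandom c \<kappa> N M D \<nu> \<eta>; \<eta> \<le> \<eta>\<^sub>0; real_of_int M / real_of_int D \<le> \<rho>;
      periodic N f; \<And>x. 0 \<le> f x; \<And>x. f x \<le> \<nu> x\<rbrakk> \<Longrightarrow>
      \<exists>h. (\<forall>x. 0 \<le> h x \<and> h x \<le> 1) \<and> \<bar>avg {0..<int N} f - avg {0..<int N} h\<bar> \<le> \<epsilon> \<and> periodic N h \<and>
        \<bar>ap_system.count c N D (\<lambda>_. f) - ap_system.count c N D (\<lambda>_. h)\<bar> \<le> \<epsilon>"
proof -
  let ?k = "CARD('k)"
  have "\<forall>\<^sub>F \<tau> in at_right 0. counting_error ?k \<tau> ?k < \<epsilon>"
    using order_tendstoD(2)[OF counting_error_tendsto \<epsilon>] by (simp add: eventually_at_split)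
  moreover have "\<forall>\<^sub>F \<tau> in at_right (0::real). 0 < \<tau>" by (rule eventually_at_right_less)
  ultimately have "\<exists>\<tau>. counting_error ?k \<tau> ?k < \<epsilon> \<and> 0 < \<tau>"
    by (intro eventually_happens'[OF trivial_limit_at_right_real] eventually_conj)
  then obtain \<tau> where \<tau>: "counting_error ?k \<tau> ?k < \<epsilon>" "0 < \<tau>" by blast
  \<comment> \<open>The bound by \<open>\<epsilon>\<close> is for the means, as 1 is a dual
    function; \<open>\<tau> / 2\<close> leaves the other half of \<open>\<tau>\<close> to the shift
    errors.\<close>
  define \<delta> where "\<delta> = min \<epsilon> (\<tau> / 2)"
  have \<delta>: "0 < \<delta>" "\<delta> \<le> \<epsilon>" "\<delta> \<le> \<tau> / 2" using \<epsilon> \<tau> by (auto simp: \<delta>_def)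
  obtain \<eta>' where \<eta>': "0 < \<eta>'" and dm:
    "\<And>(G :: int set) \<Phi> f \<nu>.
      \<lbrakk>finite G; G \<noteq> {}; \<And>\<phi> x. \<phi> \<in> \<Phi> \<Longrightarrow> \<bar>\<phi> x\<bar> \<le> 1; \<And>\<phi>. \<phi> \<in> \<Phi> \<Longrightarrow> (\<lambda>x. - \<phi> x) \<in> \<Phi>;
       \<And>x. x \<in> G \<Longrightarrow> 0 \<le> f x; \<And>x. x \<in> G \<Longrightarrow> f x \<le> \<nu> x; avg G \<nu> \<le> 2;
       \<And>L. set L \<subseteq> \<Phi> \<Longrightarrow> \<bar>avg G (\<lambda>x. (\<nu> x - 1) * prod_list (map (\<lambda>\<phi>. \<phi> x) L))\<bar> \<le> (3 ^ ?k) ^ length L * \<eta>'\<rbrakk>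
      \<Longrightarrow> \<exists>h. (\<forall>x. 0 \<le> h x \<and> h x \<le> 1) \<and> (\<forall>\<phi>\<in>\<Phi>. \<bar>avg G (\<lambda>x. (f x - h x) * \<phi> x)\<bar> \<le> \<delta>)"
    by (rule dense_model[OF \<delta>(1), of "3 ^ ?k"]) auto
  \<comment> \<open>The three bounds yield \<open>4 * \<eta> \<le> \<tau>\<close>, orthogonality to
    single dual functions up to \<open>\<eta>'\<close>, and at most \<open>\<tau> / 2\<close> for
    the root in \<open>counting\<close>. In \<open>\<rho>\<close> the first bound gives
    \<open>width \<le> D\<close>, and the second keeps each shift error at most
    \<open>\<tau> / 2\<close>.\<close>
  define \<eta>\<^sub>0 where "\<eta>\<^sub>0 = min (\<tau> / 4) (min ((\<eta>' / 4) ^ (2 ^ ?k)) ((\<tau> / 8) ^ (2 ^ (?k - 1))))"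
  define \<rho> where "\<rho> = min (1 / real ?k) (\<tau> / (64 * real ?k * (1 + \<bar>real_of_int \<kappa>\<bar>)))"
  have root: "4 * root n \<eta> \<le> y" if "\<eta> \<le> (y / 4) ^ n" "0 < n" "0 < y" for n \<eta> y
  proof -
    have "root n \<eta> \<le> root n ((y / 4) ^ n)" using that by simp
    also have "\<dots> = y / 4" using that by (simp add: real_root_power_cancel)
    finally show ?thesis by simp
  qed
  show thesis
  proof (rule that[of \<eta>\<^sub>0 \<rho>])
    show "0 < \<eta>\<^sub>0" using \<tau> \<eta>' by (simp add: \<eta>\<^sub>0_def)
    show "0 < \<rho>" using \<tau> by (simp add: \<rho>_def add_pos_nonneg)
    fix N M D \<nu> \<eta> f
    assume "ap_pseudorandom c \<kappa> N M D \<nu> \<eta>" and le: "\<eta> \<le> \<eta>\<^sub>0" and MD: "real_of_int M / real_of_int D \<le> \<rho>"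
      and f: "periodic N f" "\<And>x. 0 \<le> f x" "\<And>x. f x \<le> \<nu> x"
    then interpret ap_pseudorandom c \<kappa> N M D \<nu> \<eta> by simp
    define r where "r = real_of_int width / real_of_int D"
    have r: "r = real ?k * (real_of_int M / real_of_int D)" by (simp add: r_def width_def)
    have rk: "r \<le> real ?k * \<rho>" unfolding r by (intro mult_left_mono MD) auto
    also have "\<dots> \<le> real ?k * (1 / real ?k)" by (intro mult_left_mono) (auto simp: \<rho>_def)
    finally have r1: "r \<le> 1" by simp
    have "real ?k * \<rho> \<le> real ?k * (\<tau> / (64 * real ?k * (1 + \<bar>real_of_int \<kappa>\<bar>)))"
      by (intro mult_left_mono) (auto simp: \<rho>_def)
    also have "\<dots> = \<tau> / (64 * (1 + \<bar>real_of_int \<kappa>\<bar>))" by simp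
    finally have "r \<le> \<tau> / (64 * (1 + \<bar>real_of_int \<kappa>\<bar>))" using rk by linarith
    then have r2: "r * (64 * (1 + \<bar>real_of_int \<kappa>\<bar>)) \<le> \<tau>"
      by (subst (asm) pos_le_divide_eq) (auto intro!: add_pos_nonneg)
    have r0: "0 \<le> r" using M D by (simp add: r_def width_def)
    have r3: "64 * r \<le> \<tau>" "64 * (\<bar>real_of_int \<kappa>\<bar> * r) \<le> \<tau>"
    proof -
      have "r * (64 * (1 + \<bar>real_of_int \<kappa>\<bar>)) = 64 * r + 64 * (\<bar>real_of_int \<kappa>\<bar> * r)"
        by (simp add: algebra_simps)
      moreover have "0 \<le> \<bar>real_of_int \<kappa>\<bar> * r" using r0 by simp
      ultimately show "64 * r \<le> \<tau>" "64 * (\<bar>real_of_int \<kappa>\<bar> * r) \<le> \<tau>" using r2 r0 by linarith+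
    qed
    have orth: "\<bar>E (\<lambda>x. (\<nu> x - 1) * \<phi> x)\<bar> \<le> \<eta>'" if "\<phi> \<in> dual_functions" for \<phi>
      by (rule order_trans[OF \<nu>_dual_orth[OF that] root]) (use le \<eta>' in \<open>auto simp: \<eta>\<^sub>0_def\<close>)
    obtain h where h: "\<And>x. 0 \<le> h x \<and> h x \<le> 1"
      and hd: "\<And>\<phi>. \<phi> \<in> dual_functions \<Longrightarrow> \<bar>E (\<lambda>x. (f x - h x) * \<phi> x)\<bar> \<le> \<delta>"
    proof -
      have "\<exists>h. (\<forall>x. 0 \<le> h x \<and> h x \<le> 1) \<and> (\<forall>\<phi>\<in>dual_functions. \<bar>E (\<lambda>x. (f x - h x) * \<phi> x)\<bar> \<le> \<delta>)"
        by (rule dm[where \<nu> = \<nu>])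
           (assumption | rule G_ne dual_functions_bounded dual_functions_minus f \<nu>_mean
             dual_functions_products_orth orth)+
      then show ?thesis using that by blast
    qed
    \<comment> \<open>The model is determined on \<open>{0..<int N}\<close> only, whereas
      \<open>count\<close> evaluates outside; \<open>h'\<close> is the periodic extension.\<close>
    define h' where "h' x = h (x mod int N)" for x
    have h': "0 \<le> h' x" "h' x \<le> 1" for x using h by (auto simp: h'_def)
    have eq: "h' x = h x" if "x \<in> {0..<int N}" for x using that by (simp add: h'_def)
    have per: "periodic N h'" by (simp add: periodic_def h'_def)
    have hd': "\<bar>E (\<lambda>x. (f x - h' x) * \<phi> x)\<bar> \<le> \<delta>" if "\<phi> \<in> dual_functions" for \<phi>
    proof -
      have "E (\<lambda>x. (f x - h' x) * \<phi> x) = E (\<lambda>x. (f x - h x) * \<phi> x)"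
        by (rule avg_cong) (simp add: eq)
      then show ?thesis using hd[OF that] by simp
    qed
    have "\<bar>E f - E h'\<bar> \<le> \<epsilon>"
      using hd'[OF dual_functions_one] \<delta> by (simp add: avg_diff)
    moreover have "\<bar>count (\<lambda>_. f) - count (\<lambda>_. h')\<bar> \<le> counting_error ?k \<tau> (card (UNIV :: 'k set))"
    proof (rule counting[where \<delta> = \<delta>])
      show "width \<le> D" using r1 D by (simp add: r_def)
      have "4 * root (2 ^ (?k - 1)) \<eta> \<le> \<tau> / 2"
        by (rule root) (use le \<tau> in \<open>auto simp: \<eta>\<^sub>0_def\<close>)
      then show "4 * root (2 ^ (?k - 1)) \<eta> + 32 * (real_of_int width / real_of_int D) \<le> \<tau>"
        using r3 by (simp add: r_def[symmetric])
      show "4 * \<eta> \<le> \<tau>" using le by (auto simp: \<eta>\<^sub>0_def)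
      show "\<delta> + 6 * \<bar>real_of_int \<kappa>\<bar> * (real_of_int width / real_of_int D) \<le> \<tau>"
        using r3(2) \<delta> \<tau>(2) unfolding r_def[symmetric] by linarith
    qed (use f per h' hd' in \<open>auto simp: majorant_def\<close>)
    ultimately show "\<exists>h. (\<forall>x. 0 \<le> h x \<and> h x \<le> 1) \<and> \<bar>E f - E h\<bar> \<le> \<epsilon> \<and> periodic N h \<and>
        \<bar>count (\<lambda>_. f) - count (\<lambda>_. h)\<bar> \<le> \<epsilon>"
      using \<tau>(1) h' per by (intro exI[of _ h']) auto
  qed
qed

subsection \<open>Boxes as convex bodies\<close>

text \<open>The ball of radius \<open>r\<close> about the centre shows
  \<open>r \<le> inradius\<close>, and a larger inradius only relaxes the containment, so this lower
  bound suffices. The diameter bounds the set of radii, without which \<open>Sup\<close> would be a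
  junk value.\<close>

lemma admissible_cbox:
  fixes a b :: "'a::euclidean_space"
  assumes r: "1 \<le> r" "S \<le> r" and C: "0 < C"
    and side: "\<And>i. i \<in> Basis \<Longrightarrow> 2 * r \<le> (b - a) \<bullet> i"
    and a: "\<And>i. i \<in> Basis \<Longrightarrow> \<bar>a \<bullet> i\<bar> \<le> r powr C" and b: "\<And>i. i \<in> Basis \<Longrightarrow> \<bar>b \<bullet> i\<bar> \<le> r powr C"
  shows "admissible_body S C (cbox a b)"
proof -
  let ?R = "{r. 0 \<le> r \<and> (\<exists>x. cball x r \<subseteq> cbox a b)}"
  have "cball ((1/2) *\<^sub>R (a + b)) r \<subseteq> cbox a b"
  proof
    fix x assume x: "x \<in> cball ((1/2) *\<^sub>R (a + b)) r"
    have "a \<bullet> i \<le> x \<bullet> i \<and> x \<bullet> i \<le> b \<bullet> i" if i: "i \<in> Basis" for i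
    proof -
      have "\<bar>(x - (1/2) *\<^sub>R (a + b)) \<bullet> i\<bar> \<le> r"
        using Basis_le_norm[OF i, of "x - (1/2) *\<^sub>R (a + b)"] x by (simp add: dist_norm norm_minus_commute)
      then show ?thesis using side[OF i]
        by (simp add: inner_diff_left inner_add_left abs_le_iff field_simps)
    qed
    then show "x \<in> cbox a b" by (simp add: mem_box)
  qed
  then have rR: "r \<in> ?R" using r by auto
  have "bdd_above ?R"
  proof (rule bdd_aboveI)
    fix s assume "s \<in> ?R"
    then obtain x where "0 \<le> s" "cball x s \<subseteq> cbox a b" by auto
    then show "s \<le> diameter (cbox a b) / 2"
      using diameter_subset[of "cball x s" "cbox a b"] by (simp add: bounded_cbox)
  qed
  then have ir: "r \<le> inradius (cbox a b)" unfolding inradius_def by (intro cSup_upper rR)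
  have pw: "r powr C \<le> inradius (cbox a b) powr C" using ir r C by (intro powr_mono2) auto
  have "convex_body (cbox a b)"
  proof -
    have "a \<bullet> i < b \<bullet> i" if "i \<in> Basis" for i using side[OF that] r by (simp add: inner_diff_left)
    then show ?thesis by (simp add: convex_body_def convex_box compact_cbox interior_cbox box_ne_empty)
  qed
  moreover have "cbox a b \<subseteq> cbox (- (inradius (cbox a b) powr C) *\<^sub>R One) ((inradius (cbox a b) powr C) *\<^sub>R One)"
  proof
    fix x assume x: "x \<in> cbox a b"
    have "- (inradius (cbox a b) powr C) \<le> x \<bullet> i \<and> x \<bullet> i \<le> inradius (cbox a b) powr C" if i: "i \<in> Basis" for i
      using x a[OF i] b[OF i] pw i unfolding mem_box by (smt (verit))
    then show "x \<in> cbox (- (inradius (cbox a b) powr C) *\<^sub>R One) ((inradius (cbox a b) powr C) *\<^sub>R One)"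
      by (simp add: mem_box)
  qed
  ultimately show ?thesis using ir r by (simp add: admissible_body_def)
qed

definition vec_of :: "('k::finite \<Rightarrow> int) \<Rightarrow> real ^ 'k" where
  "vec_of s = (\<chi> i. real_of_int (s i))"

lemma admissible_pair_box:
  fixes lo hi :: "'k::finite \<Rightarrow> int"
  assumes r: "1 \<le> r" "S \<le> r" and C: "0 < C"
    and side: "\<And>i. 2 * r \<le> real_of_int (hi i - lo i)"
    and bnd: "\<And>i. \<bar>real_of_int (lo i)\<bar> \<le> r powr C" "\<And>i. \<bar>real_of_int (hi i)\<bar> \<le> r powr C"
  shows "admissible_body S C (cbox (vec_of lo, vec_of lo) (vec_of hi, vec_of hi))"
  by (rule admissible_cbox[OF r C])
     (use side bnd in \<open>auto simp: Basis_prod_def Basis_vec_def inner_axis vec_of_def\<close>)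

lemma admissible_plane_box:
  fixes lo hi lo' hi' :: int
  assumes r: "1 \<le> r" "S \<le> r" and C: "0 < C"
    and side: "2 * r \<le> real_of_int (hi - lo)" "2 * r \<le> real_of_int (hi' - lo')"
    and bnd: "\<bar>real_of_int lo\<bar> \<le> r powr C" "\<bar>real_of_int hi\<bar> \<le> r powr C"
      "\<bar>real_of_int lo'\<bar> \<le> r powr C" "\<bar>real_of_int hi'\<bar> \<le> r powr C"
  shows "admissible_body S C (cbox (real_of_int lo, real_of_int lo') (real_of_int hi, real_of_int hi'))"
  by (rule admissible_cbox[OF r C]) (use side bnd in \<open>auto simp: Basis_prod_def\<close>)

lemma bij_int_points_pair_box:
  fixes lo hi :: "'k::finite \<Rightarrow> int"
  defines "X \<equiv> PiE UNIV (\<lambda>i. {lo i..hi i})"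
  shows "bij_betw (\<lambda>(s, t). (\<chi> i. s i, \<chi> i. t i)) (X \<times> X)
    (int_points_pair (cbox (vec_of lo, vec_of lo) (vec_of hi, vec_of hi)))"
  by (rule bij_betw_byWitness[where f' = "\<lambda>(s, t). ((\<lambda>i. s $ i), (\<lambda>i. t $ i))"])
     (auto simp: X_def PiE_iff int_points_pair_def cbox_Pair_eq mem_box_cart vec_of_def)

lemma avg_int_points_pair_box:
  fixes lo hi :: "'k::finite \<Rightarrow> int"
  defines "X \<equiv> PiE UNIV (\<lambda>i. {lo i..hi i})"
  shows "avg (int_points_pair (cbox (vec_of lo, vec_of lo) (vec_of hi, vec_of hi))) g =
    avg X (\<lambda>s. avg X (\<lambda>t. g (\<chi> i. s i, \<chi> i. t i)))"
  unfolding X_def by (subst avg_reindex_bij[OF bij_int_points_pair_box]) (simp add: avg_Times)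

lemma int_points_pair_box_nonempty:
  fixes lo hi :: "'k::finite \<Rightarrow> int"
  assumes "\<And>i. lo i \<le> hi i"
  shows "int_points_pair (cbox (vec_of lo, vec_of lo) (vec_of hi, vec_of hi)) \<noteq> {}"
proof -
  have "((\<chi> i. lo i), (\<chi> i. lo i)) \<in> int_points_pair (cbox (vec_of lo, vec_of lo) (vec_of hi, vec_of hi))"
    using assms by (simp add: int_points_pair_def cbox_Pair_eq mem_box_cart vec_of_def)
  then show ?thesis by blast
qed

lemma int_points_plane_box:
  "int_points_plane (cbox (real_of_int lo, real_of_int lo') (real_of_int hi, real_of_int hi')) = {lo..hi} \<times> {lo'..hi'}"
  by (auto simp: int_points_plane_def cbox_Pair_eq)

text \<open>A function \<open>\<omega>\<close> corresponds to the set on which it is 1;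
  \<open>restrict\<close> supplies the \<open>undefined\<close> values outside \<open>J\<close> that
  \<open>\<rightarrow>\<^sub>E\<close> demands.\<close>

lemma prod_binary_functions:
  fixes g :: "('k::finite \<Rightarrow> nat) \<Rightarrow> real"
  shows "(\<Prod>\<omega> \<in> J \<rightarrow>\<^sub>E {0, 1}. g \<omega>) = (\<Prod>A\<in>Pow J. g (restrict (\<lambda>i. of_bool (i \<in> A)) J))"
proof -
  have "restrict (\<lambda>i. of_bool (i \<in> {i \<in> J. \<omega> i = 1})) J = \<omega>" if "\<omega> \<in> J \<rightarrow>\<^sub>E {0, 1}" for \<omega> :: "'k \<Rightarrow> nat"
    by (rule ext) (use that in \<open>auto simp: PiE_iff extensional_def\<close>)
  then show ?thesis
    by (intro prod.reindex_bij_witness[of _ "\<lambda>A. restrict (\<lambda>i. of_bool (i \<in> A)) J" "\<lambda>\<omega>. {i \<in> J. \<omega> i = 1}"])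
       auto
qed

lemma prod_indicator_power:
  fixes g :: "'a \<Rightarrow> real"
  assumes "finite X" "Y \<subseteq> X"
  shows "(\<Prod>A\<in>X. g A ^ (if A \<in> Y then 1 else 0)) = (\<Prod>A\<in>Y. g A)"
proof -
  have "(\<Prod>A\<in>X. g A ^ (if A \<in> Y then 1 else 0)) = (\<Prod>A\<in>X. if A \<in> Y then g A else 1)"
    by (rule prod.cong) auto
  also have "\<dots> = (\<Prod>A\<in>X \<inter> Y. g A)" using assms by (simp add: prod.inter_restrict)
  finally show ?thesis using assms by (simp add: Int_absorb1)
qed

subsection \<open>Transfer of the linear forms conditions\<close>

lemma ZMod_eq: "0 < N \<Longrightarrow> ZMod N = {0..<int N}"
  by (auto simp: residue_ring_def)

lemma psi_at_select:
  assumes "A \<subseteq> UNIV - {j}"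
  shows "psi_at lab j (select (\<chi> i. s i, \<chi> i. t i) (restrict (\<lambda>i. of_bool (i \<in> A)) (UNIV - {j}))) =
    (\<Sum>i\<in>UNIV. (int (lab j) - int (lab i)) * mix A s t i)"
  unfolding psi_at_def by (rule sum.cong) (auto simp: select_def pick_def mix_def)

lemma psi_select:
  "psi k (select (\<chi> i. s i, \<chi> i. t i) (restrict (\<lambda>i. of_bool (i \<in> A)) UNIV)) =
    fact k * (\<Sum>i\<in>UNIV. mix A s t i)"
  unfolding psi_def by (intro arg_cong2[where f = "(*)"] sum.cong) (auto simp: select_def pick_def mix_def)

text \<open>All bodies are boxes with sides among \<open>{1..M}\<close>, \<open>{1..D}\<close>,
  \<open>{1..width}\<close> and \<open>{D+1..D+width}\<close>. As real intervals these have length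
  at least \<open>M - 1\<close>, hence \<open>2 * r \<le> real M - 1\<close>; the largest endpoint
  is \<open>D + k * M\<close>, hence the bound by \<open>r powr C\<close>.\<close>

lemma ap_pseudorandom_of_linear_forms:
  fixes lab :: "'k::finite \<Rightarrow> nat" and \<nu> :: "int \<Rightarrow> real" and M D :: nat
  assumes N: "0 < N" and k: "2 \<le> k" and lab: "bij_betw lab UNIV {1..k}"
    and \<nu>: "\<And>x. x \<in> ZMod N \<Longrightarrow> 0 \<le> \<nu> x"
    and \<eta>: "0 < \<eta>" "\<eta> \<le> 1" and C: "0 < C"
    and r: "1 \<le> r" "S \<le> r" "2 * r \<le> real M - 1" "real D + real k * real M \<le> r powr C" "M \<le> D"
    and lf1: "\<And>(\<Omega> :: ((real ^ 'k) \<times> (real ^ 'k)) set) (e :: 'k \<Rightarrow> ('k \<Rightarrow> nat) \<Rightarrow> nat).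
         \<lbrakk>admissible_body S C \<Omega>; int_points_pair \<Omega> \<noteq> {};
         \<forall>j. \<forall>\<omega> \<in> (UNIV - {j}) \<rightarrow>\<^sub>E {0, 1}. e j \<omega> \<in> {0, 1}\<rbrakk> \<Longrightarrow>
         \<bar>avg (ZMod N) (\<lambda>n. avg (int_points_pair \<Omega>) (\<lambda>p.
            \<Prod>j\<in>UNIV. \<Prod>\<omega> \<in> (UNIV - {j}) \<rightarrow>\<^sub>E {0, 1}.
              at_residue N \<nu> (n + psi_at lab j (select p \<omega>)) ^ e j \<omega>)) - 1\<bar> < \<eta>"
    and lf2: "\<And>(\<Omega> :: ((real ^ 'k) \<times> (real ^ 'k)) set) (e :: ('k \<Rightarrow> nat) \<Rightarrow> nat).
         \<lbrakk>admissible_body S C \<Omega>; int_points_pair \<Omega> \<noteq> {};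
         \<forall>\<omega> \<in> UNIV \<rightarrow>\<^sub>E {0, 1}. e \<omega> \<in> {0, 1}\<rbrakk> \<Longrightarrow>
         \<bar>avg (ZMod N) (\<lambda>n. avg (int_points_pair \<Omega>) (\<lambda>p.
            \<Prod>\<omega> \<in> UNIV \<rightarrow>\<^sub>E {0, 1}.
              at_residue N \<nu> (n + psi k (select p \<omega>)) ^ e \<omega>)) - 1\<bar> < \<eta>"
    and lf3: "\<And>(\<Omega> :: (real \<times> real) set) (e :: nat) (e' :: nat \<Rightarrow> nat \<Rightarrow> nat) j.
         \<lbrakk>j \<in> {1..k}; admissible_body S C \<Omega>; int_points_plane \<Omega> \<noteq> {};
         e \<in> {0, 1}; \<forall>i\<in>{1..k} - {j}. \<forall>t\<in>{0, 1}. e' i t \<in> {0, 1}\<rbrakk> \<Longrightarrow>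
         \<bar>avg (ZMod N) (\<lambda>n. at_residue N \<nu> n ^ e * avg (int_points_plane \<Omega>) (\<lambda>p.
            \<Prod>i\<in>{1..k} - {j}. \<Prod>t\<in>{0, 1}.
              at_residue N \<nu> (n + (int i - int j) * pick p t) ^ e' i t)) - 1\<bar> < \<eta>"
  shows "ap_pseudorandom (\<lambda>i. int (lab i)) (fact k) N (int M) (int D) (at_residue N \<nu>) \<eta>"
proof -
  have inj: "inj lab" using lab by (simp add: bij_betw_def)
  have labk: "lab i \<in> {1..k}" for i using lab by (auto simp: bij_betw_def)
  have card: "CARD('k) = k" using bij_betw_same_card[OF lab] by simp
  have MD: "0 < M" "0 < D" using r by linarith+
  let ?\<nu> = "at_residue N \<nu>"
  interpret ap_system "\<lambda>i. int (lab i)" "fact k" N "int M" "int D" ?\<nu>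
  proof
    show "inj (\<lambda>i. int (lab i))" using inj by (auto simp: inj_def)
    \<comment> \<open>Distinct labels differ by at least 1 and at most \<open>k - 1\<close>, so the
      difference divides \<open>k!\<close>.\<close>
    show "int (lab j) - int (lab i) dvd fact k" if "i \<noteq> j" for i j
    proof -
      have "lab i \<noteq> lab j" using that inj by (auto dest: injD)
      then have "nat \<bar>int (lab j) - int (lab i)\<bar> dvd fact k"
        using labk[of i] labk[of j] by (intro dvd_fact) auto
      then have "int (nat \<bar>int (lab j) - int (lab i)\<bar>) dvd int (fact k)" by (simp only: of_nat_dvd_iff)
      then show ?thesis by simp
    qed
    show "periodic N ?\<nu>" by (simp add: periodic_def at_residue_def)
    show "0 \<le> ?\<nu> x" for x using \<nu> N by (simp add: at_residue_def ZMod_eq)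
  qed (use N MD k card in auto)
  have form: "psi_at lab j (select (\<chi> i. s i, \<chi> i. t i) (restrict (\<lambda>i. of_bool (i \<in> A)) (UNIV - {j}))) = form j (mix A s t)"
    if "A \<subseteq> UNIV - {j}" for A j s t
    using psi_at_select[OF that, of lab s t] by (simp add: form_def)
  have bounds: "1 \<le> r powr C" "real D \<le> r powr C" "real M \<le> r powr C" "real_of_int width \<le> r powr C"
    "real D + real_of_int width \<le> r powr C" "real D + 1 \<le> r powr C" "real M \<le> real_of_int width"
  proof -
    have w: "real_of_int width = real k * real M" by (simp add: width_def card)
    have "1 * real M \<le> real k * real M" using k by (intro mult_right_mono) auto
    then have 1: "real M \<le> real k * real M" by simp
    show "1 \<le> r powr C" "real D \<le> r powr C" "real M \<le> r powr C" "real_of_int width \<le> r powr C"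
      "real D + real_of_int width \<le> r powr C" "real D + 1 \<le> r powr C" "real M \<le> real_of_int width"
      using 1 r MD unfolding w by linarith+
  qed
  show ?thesis
  proof
    show "0 \<le> \<eta>" "\<eta> \<le> 1" using \<eta> by auto
  next
    fix Y :: "'k \<Rightarrow> 'k set set" and j :: 'k
    assume Y: "\<And>l. Y l \<subseteq> Pow (UNIV - {l})"
    define hi where "hi i = (if i = j then int D else int M)" for i
    let ?\<Omega> = "cbox (vec_of (\<lambda>_. 1), vec_of (\<lambda>_. 1)) (vec_of hi, vec_of hi)"
    define e where "e l \<omega> = (if {i \<in> UNIV - {l}. \<omega> i = 1} \<in> Y l then 1 else 0 :: nat)" for l and \<omega> :: "'k \<Rightarrow> nat"
    have e01: "\<forall>j. \<forall>\<omega> \<in> (UNIV - {j}) \<rightarrow>\<^sub>E {0, 1}. e j \<omega> \<in> {0, 1}" by (simp add: e_def)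
    have body: "body j = PiE UNIV (\<lambda>i. {1..hi i})"
      unfolding body_def hi_def by (rule PiE_cong) auto
    have "admissible_body S C ?\<Omega>"
      by (rule admissible_pair_box[OF r(1,2) C]) (use r bounds in \<open>auto simp: hi_def\<close>)
    moreover have "int_points_pair ?\<Omega> \<noteq> {}"
      by (rule int_points_pair_box_nonempty) (use MD in \<open>auto simp: hi_def\<close>)
    moreover have "(\<Prod>l\<in>UNIV. \<Prod>\<omega> \<in> (UNIV - {l}) \<rightarrow>\<^sub>E {0, 1}.
        ?\<nu> (n + psi_at lab l (select (\<chi> i. s i, \<chi> i. t i) \<omega>)) ^ e l \<omega>) =
      (\<Prod>l\<in>UNIV. \<Prod>A\<in>Y l. ?\<nu> (n + form l (mix A s t)))" for n s t
    proof (rule prod.cong[OF refl])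
      fix l :: 'k
      have "(\<Prod>\<omega> \<in> (UNIV - {l}) \<rightarrow>\<^sub>E {0, 1}. ?\<nu> (n + psi_at lab l (select (\<chi> i. s i, \<chi> i. t i) \<omega>)) ^ e l \<omega>) =
        (\<Prod>A\<in>Pow (UNIV - {l}). ?\<nu> (n + form l (mix A s t)) ^ (if A \<in> Y l then 1 else 0))"
        unfolding prod_binary_functions
      proof (rule prod.cong[OF refl])
        fix A assume A: "A \<in> Pow (UNIV - {l})"
        have "{i \<in> UNIV - {l}. restrict (\<lambda>i. of_bool (i \<in> A) :: nat) (UNIV - {l}) i = 1} = A" using A by auto
        then show "?\<nu> (n + psi_at lab l (select (\<chi> i. s i, \<chi> i. t i) (restrict (\<lambda>i. of_bool (i \<in> A)) (UNIV - {l})))) ^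
            e l (restrict (\<lambda>i. of_bool (i \<in> A)) (UNIV - {l})) =
          ?\<nu> (n + form l (mix A s t)) ^ (if A \<in> Y l then 1 else 0)"
          using A by (simp add: e_def form)
      qed
      also have "\<dots> = (\<Prod>A\<in>Y l. ?\<nu> (n + form l (mix A s t)))"
        by (rule prod_indicator_power) (use Y in auto)
      finally show "(\<Prod>\<omega> \<in> (UNIV - {l}) \<rightarrow>\<^sub>E {0, 1}. ?\<nu> (n + psi_at lab l (select (\<chi> i. s i, \<chi> i. t i) \<omega>)) ^ e l \<omega>) =
        (\<Prod>A\<in>Y l. ?\<nu> (n + form l (mix A s t)))" .
    qed
    ultimately show "\<bar>E (\<lambda>n. avg (body j) (\<lambda>s. avg (body j) (\<lambda>t.
         \<Prod>l\<in>UNIV. \<Prod>A\<in>Y l. ?\<nu> (n + form l (mix A s t))))) - 1\<bar> \<le> \<eta>"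
      using lf1[of ?\<Omega> e, OF _ _ e01] by (simp add: ZMod_eq[OF N] avg_int_points_pair_box body)
  next
    fix Y' :: "'k set set"
    define hi where "hi i = int M" for i :: 'k
    let ?\<Omega> = "cbox (vec_of (\<lambda>_. 1), vec_of (\<lambda>_. 1)) (vec_of hi, vec_of hi)"
    define e where "e \<omega> = (if {i \<in> UNIV. \<omega> i = 1} \<in> Y' then 1 else 0 :: nat)" for \<omega> :: "'k \<Rightarrow> nat"
    have e01: "\<forall>\<omega> \<in> UNIV \<rightarrow>\<^sub>E {0, 1}. e \<omega> \<in> {0, 1}" by (simp add: e_def)
    have "admissible_body S C ?\<Omega>"
      by (rule admissible_pair_box[OF r(1,2) C]) (use r bounds in \<open>auto simp: hi_def\<close>)
    moreover have "int_points_pair ?\<Omega> \<noteq> {}"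
      by (rule int_points_pair_box_nonempty) (use MD in \<open>auto simp: hi_def\<close>)
    moreover have "(\<Prod>\<omega> \<in> UNIV \<rightarrow>\<^sub>E {0, 1}. ?\<nu> (n + psi k (select (\<chi> i. s i, \<chi> i. t i) \<omega>)) ^ e \<omega>) =
      (\<Prod>A\<in>Y'. ?\<nu> (n + fact k * tot (mix A s t)))" for n s t
    proof -
      have "(\<Prod>\<omega> \<in> UNIV \<rightarrow>\<^sub>E {0, 1}. ?\<nu> (n + psi k (select (\<chi> i. s i, \<chi> i. t i) \<omega>)) ^ e \<omega>) =
        (\<Prod>A\<in>Pow UNIV. ?\<nu> (n + fact k * tot (mix A s t)) ^ (if A \<in> Y' then 1 else 0))"
        unfolding prod_binary_functions by (rule prod.cong) (auto simp: psi_select tot_def e_def)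
      also have "\<dots> = (\<Prod>A\<in>Y'. ?\<nu> (n + fact k * tot (mix A s t)))"
        by (rule prod_indicator_power) auto
      finally show ?thesis .
    qed
    ultimately show "\<bar>E (\<lambda>n. avg cube (\<lambda>s. avg cube (\<lambda>t. \<Prod>A\<in>Y'. ?\<nu> (n + fact k * tot (mix A s t))))) - 1\<bar> \<le> \<eta>"
      using lf2[of ?\<Omega> e, OF _ _ e01] by (simp add: ZMod_eq[OF N] avg_int_points_pair_box cube_def hi_def)
  next
    fix I I' :: "int set" and Z Z' :: "'k set" and j :: 'k and b :: bool
    assume I: "I \<in> {{1..int D}, {1..width}, {int D + 1..int D + width}}"
      and I': "I' \<in> {{1..int D}, {1..width}, {int D + 1..int D + width}}"
      and Z: "Z \<subseteq> UNIV - {j}" "Z' \<subseteq> UNIV - {j}"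
    have ex: "\<exists>lo hi. I = {lo..hi} \<and> lo \<le> hi \<and> 2 * r \<le> real_of_int (hi - lo) \<and>
        \<bar>real_of_int lo\<bar> \<le> r powr C \<and> \<bar>real_of_int hi\<bar> \<le> r powr C"
      if iv: "I \<in> {{1..int D}, {1..width}, {int D + 1..int D + width}}" for I
    proof -
      consider "I = {1..int D}" | "I = {1..width}" | "I = {int D + 1..int D + width}" using iv by auto
      then show ?thesis
      proof cases
        case 1
        show ?thesis by (rule exI[of _ 1], rule exI[of _ "int D"]) (use 1 r bounds MD in auto)
      next
        case 2
        show ?thesis by (rule exI[of _ 1], rule exI[of _ width]) (use 2 r bounds MD in auto)
      next
        case 3
        show ?thesis
          by (rule exI[of _ "int D + 1"], rule exI[of _ "int D + width"]) (use 3 r bounds MD in auto)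
      qed
    qed
    obtain lo hi where 1: "I = {lo..hi}" "lo \<le> hi" "2 * r \<le> real_of_int (hi - lo)"
        "\<bar>real_of_int lo\<bar> \<le> r powr C" "\<bar>real_of_int hi\<bar> \<le> r powr C"
      using ex[OF I] by blast
    obtain lo' hi' where 2: "I' = {lo'..hi'}" "lo' \<le> hi'" "2 * r \<le> real_of_int (hi' - lo')"
        "\<bar>real_of_int lo'\<bar> \<le> r powr C" "\<bar>real_of_int hi'\<bar> \<le> r powr C"
      using ex[OF I'] by blast
    let ?\<Omega> = "cbox (real_of_int lo, real_of_int lo') (real_of_int hi, real_of_int hi')"
    define e' where "e' l t = (if l \<in> lab ` (if t = 0 then Z else Z') then 1 else 0 :: nat)" for l t :: nat
    have adm: "admissible_body S C ?\<Omega>"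
      by (rule admissible_plane_box[OF r(1,2) C]) (use 1 2 in auto)
    have pts: "int_points_plane ?\<Omega> = I \<times> I'" by (simp add: int_points_plane_box 1 2)
    have "(\<Prod>i\<in>{1..k} - {lab j}. \<Prod>t\<in>{0, 1}. ?\<nu> (n + (int i - int (lab j)) * pick (d, d') t) ^ e' i t) =
      (\<Prod>i\<in>Z. ?\<nu> (n + (int (lab i) - int (lab j)) * d)) * (\<Prod>i\<in>Z'. ?\<nu> (n + (int (lab i) - int (lab j)) * d'))"
      for n d d'
    proof -
      have bij: "bij_betw lab (UNIV - {j}) ({1..k} - {lab j})"
        using lab inj by (auto simp: bij_betw_def inj_on_def)
      have mem: "lab i \<in> lab ` X \<longleftrightarrow> i \<in> X" for i X using inj by (auto dest: injD)
      have "(\<Prod>i\<in>{1..k} - {lab j}. \<Prod>t\<in>{0, 1}. ?\<nu> (n + (int i - int (lab j)) * pick (d, d') t) ^ e' i t) =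
        (\<Prod>i\<in>UNIV - {j}. ?\<nu> (n + (int (lab i) - int (lab j)) * d) ^ (if i \<in> Z then 1 else 0) *
          ?\<nu> (n + (int (lab i) - int (lab j)) * d') ^ (if i \<in> Z' then 1 else 0))"
        unfolding prod.reindex_bij_betw[OF bij, symmetric]
        by (rule prod.cong) (simp_all add: pick_def e'_def mem)
      then show ?thesis by (simp add: prod.distrib prod_indicator_power[OF _ Z(1)] prod_indicator_power[OF _ Z(2)])
    qed
    then have "\<bar>E (\<lambda>n. ?\<nu> n ^ (if b then 1 else 0) * avg I (\<lambda>d. avg I' (\<lambda>d'.
        (\<Prod>i\<in>Z. ?\<nu> (n + (int (lab i) - int (lab j)) * d)) *
        (\<Prod>i\<in>Z'. ?\<nu> (n + (int (lab i) - int (lab j)) * d'))))) - 1\<bar> < \<eta>"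
      using lf3[of "lab j" ?\<Omega> "if b then 1 else 0" e'] adm labk[of j] 1(1,2) 2(1,2)
      by (simp add: pts ZMod_eq[OF N] avg_Times e'_def)
    moreover have "?\<nu> n ^ (if b then 1 else 0) = (if b then ?\<nu> n else 1)" for n by simp
    ultimately show "\<bar>E (\<lambda>n. (if b then ?\<nu> n else 1) * avg I (\<lambda>d. avg I' (\<lambda>d'.
        (\<Prod>i\<in>Z. ?\<nu> (n + (int (lab i) - int (lab j)) * d)) *
        (\<Prod>i\<in>Z'. ?\<nu> (n + (int (lab i) - int (lab j)) * d'))))) - 1\<bar> \<le> \<eta>"
      by simp
  qed
qed

subsection \<open>The transference theorem\<close>

text \<open>\<open>Lambda\<close> has the coefficients \<open>j - 1\<close> and \<open>count\<close>
  the coefficients \<open>j\<close>; for every \<open>d\<close>, shifting \<open>n\<close> by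
  \<open>d\<close> removes the discrepancy.\<close>

lemma Lambda_eq_count:
  fixes lab :: "'k::finite \<Rightarrow> nat"
  assumes sys: "ap_system (\<lambda>i. int (lab i)) \<kappa> N M (int D) \<nu>" and lab: "bij_betw lab UNIV {1..k}"
  shows "Lambda N k D (\<lambda>_. g) = ap_system.count (\<lambda>i. int (lab i)) N (int D) (\<lambda>_. at_residue N g)"
proof -
  interpret ap_system "\<lambda>i. int (lab i)" \<kappa> N M "int D" \<nu> by (rule sys)
  let ?g = "at_residue N g"
  have per: "periodic N ?g" by (simp add: periodic_def at_residue_def)
  have "Lambda N k D (\<lambda>_. g) = avg {1..int D} (\<lambda>d. E (\<lambda>n. \<Prod>j = 1..k. ?g (n + (int j - 1) * d)))"
    unfolding Lambda_def ZMod_eq[OF N] by (rule avg_swap)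
  also have "\<dots> = avg {1..int D} (\<lambda>d. E (\<lambda>n. \<Prod>j = 1..k. ?g (n + int j * d)))"
  proof (rule avg_cong)
    fix d
    let ?h = "\<lambda>n. \<Prod>j = 1..k. ?g (n + (int j - 1) * d)"
    have "periodic N ?h" using per by (intro periodicI) (simp add: periodic_shift[THEN periodicD])
    then have "E ?h = E (\<lambda>n. ?h (n + d))" by (rule E_shift[symmetric])
    then show "E ?h = E (\<lambda>n. \<Prod>j = 1..k. ?g (n + int j * d))" by (simp add: algebra_simps)
  qed
  also have "\<dots> = avg {1..int D} (\<lambda>d. E (\<lambda>n. \<Prod>i\<in>UNIV. ?g (n + int (lab i) * d)))"
    unfolding prod.reindex_bij_betw[OF lab, symmetric] ..
  also have "\<dots> = count (\<lambda>_. ?g)"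
    unfolding count_def by (rule avg_swap)
  finally show ?thesis .
qed

text \<open>For every \<open>N\<close> a choice within \<open>1 / (N + 1)\<close> of the infimum is
  made, the infimum itself possibly not being attained. This choice does not refer to
  \<open>\<epsilon>\<close>, so it competes with the good choices for all accuracies at
  once.\<close>

lemma eventually_small_choice:
  fixes e :: "nat \<Rightarrow> 'b \<Rightarrow> real"
  assumes le: "F \<le> at_top" and nonneg: "\<And>N h. 0 \<le> e N h" and ne: "A \<noteq> {}"
    and ev: "\<And>\<epsilon>. 0 < \<epsilon> \<Longrightarrow> \<forall>\<^sub>F N in F. \<exists>h\<in>A. e N h \<le> \<epsilon>"
  obtains f where "\<And>N. f N \<in> A" "((\<lambda>N. e N (f N)) \<longlongrightarrow> 0) F"
proof -
  define I where "I N = Inf (e N ` A)" for N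
  have "\<exists>h\<in>A. e N h < I N + 1 / real (Suc N)" for N
    using cInf_lessD[of "e N ` A" "I N + 1 / real (Suc N)"] ne by (auto simp: I_def)
  then obtain f where f: "\<And>N. f N \<in> A" "\<And>N. e N (f N) < I N + 1 / real (Suc N)" by metis
  have "((\<lambda>N. e N (f N)) \<longlongrightarrow> 0) F"
  proof (rule tendstoI)
    fix \<epsilon> :: real assume \<epsilon>: "0 < \<epsilon>"
    have "((\<lambda>N. 1 / real (Suc N)) \<longlongrightarrow> 0) F"
      using LIMSEQ_inverse_real_of_nat le unfolding inverse_eq_divide by (rule tendsto_mono[rotated])
    then have "\<forall>\<^sub>F N in F. 1 / real (Suc N) < \<epsilon> / 2" using \<epsilon> by (intro order_tendstoD(2)) auto
    moreover have "\<forall>\<^sub>F N in F. \<exists>h\<in>A. e N h \<le> \<epsilon> / 2" by (rule ev) (use \<epsilon> in simp)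
    ultimately show "\<forall>\<^sub>F N in F. dist (e N (f N)) 0 < \<epsilon>"
    proof eventually_elim
      case (elim N)
      then obtain h where h: "h \<in> A" "e N h \<le> \<epsilon> / 2" by blast
      have "I N \<le> e N h"
        unfolding I_def by (rule cInf_lower) (use h nonneg in \<open>auto intro: bdd_belowI[of _ 0]\<close>)
      then show ?case using f(2)[of N] elim(1) h(2) nonneg[of N "f N"] by (simp add: dist_real_def)
    qed
  qed
  with f(1) that show thesis by blast
qed

theorem theorem7p1:
  fixes k :: nat
    and lab :: "'k::finite \<Rightarrow> nat"
    and f \<nu> :: "nat \<Rightarrow> int \<Rightarrow> real"
    and D S :: "nat \<Rightarrow> nat"
  assumes "k \<ge> 2"
    and "bij_betw lab UNIV {1..k}"
    and "\<forall>\<^sub>F N in primes_at_top. \<forall>x\<in>ZMod N. 0 \<le> f N x \<and> f N x \<le> \<nu> N x"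
    and "\<forall>\<^sub>F N in primes_at_top. D N \<ge> 2 \<and> S N \<ge> 2"
    and "((\<lambda>N. real (S N) / real (D N)) \<longlongrightarrow> 0) primes_at_top"
    and "linear_forms_conditions lab k S \<nu>"
  shows "\<exists>f' :: nat \<Rightarrow> int \<Rightarrow> real.
    (\<forall>N. prime N \<longrightarrow> (\<forall>x\<in>ZMod N. f' N x \<in> {0..1})) \<and>
    ((\<lambda>N. avg (ZMod N) (f N) - avg (ZMod N) (f' N)) \<longlongrightarrow> 0) primes_at_top \<and>
    ((\<lambda>N. \<bar>Lambda N k (D N) (\<lambda>_. f N) - Lambda N k (D N) (\<lambda>_. f' N)\<bar>) \<longlongrightarrow> 0) primes_at_top"
proof -
  \<comment> \<open>Both errors are added up so that the same \<open>f'\<close> serves both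
    claims.\<close>
  define e where "e N h = \<bar>avg (ZMod N) (f N) - avg (ZMod N) h\<bar> +
    \<bar>Lambda N k (D N) (\<lambda>_. f N) - Lambda N k (D N) (\<lambda>_. h)\<bar>" for N h
  let ?A = "{h :: int \<Rightarrow> real. \<forall>x. 0 \<le> h x \<and> h x \<le> 1}"
  have small: "\<forall>\<^sub>F N in primes_at_top. \<exists>h\<in>?A. e N h \<le> \<epsilon>" if \<epsilon>: "0 < \<epsilon>" for \<epsilon>
  proof -
    obtain \<eta>\<^sub>0 \<rho> where \<eta>\<^sub>0: "0 < \<eta>\<^sub>0" and \<rho>: "0 < \<rho>" and tr:
      "\<And>N M D \<nu> \<eta> f. \<lbrakk>ap_pseudorandom (\<lambda>i. int (lab i)) (fact k) N M D \<nu> \<eta>; \<eta> \<le> \<eta>\<^sub>0;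
        real_of_int M / real_of_int D \<le> \<rho>; periodic N f; \<And>x. 0 \<le> f x; \<And>x. f x \<le> \<nu> x\<rbrakk> \<Longrightarrow>
      \<exists>h. (\<forall>x. 0 \<le> h x \<and> h x \<le> 1) \<and> \<bar>avg {0..<int N} f - avg {0..<int N} h\<bar> \<le> \<epsilon> / 2 \<and> periodic N h \<and>
        \<bar>ap_system.count (\<lambda>i. int (lab i)) N D (\<lambda>_. f) - ap_system.count (\<lambda>i. int (lab i)) N D (\<lambda>_. h)\<bar> \<le> \<epsilon> / 2"
      by (rule transference_pseudorandom[of "\<epsilon> / 2" "\<lambda>i. int (lab i)" "fact k"]) (use \<epsilon> in auto)
    define \<eta> where "\<eta> = min \<eta>\<^sub>0 1"
    have \<eta>01: "0 < \<eta>" "\<eta> \<le> 1" "\<eta> \<le> \<eta>\<^sub>0" using \<eta>\<^sub>0 by (auto simp: \<eta>_def)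
    define q where "q = min \<rho> 1"
    have q: "0 < q" "q \<le> 1" "q \<le> \<rho>" using \<rho> by (auto simp: q_def)
    \<comment> \<open>As \<open>S \<ge> 2\<close>, the bound \<open>S / D < \<sigma>\<close> also
      forces \<open>q\<^sup>2 * D > 16 * (k + 1)\<close>, which is the largeness of \<open>D\<close>
      used below.\<close>
    define \<sigma> where "\<sigma> = q\<^sup>2 / (8 * (real k + 1))"
    have \<sigma>: "0 < \<sigma>" using q by (simp add: \<sigma>_def)
    \<comment> \<open>The exponent \<open>C = 2\<close> suffices: \<open>r\<close> will be at least
      \<open>q * D / 4\<close>, so \<open>r\<^sup>2\<close> exceeds the size
      \<open>(k + 1) * D\<close> of the boxes.\<close>
    have two: "(0::real) < 2" by simp
    have lf: "linear_forms_1 lab S \<nu>" "linear_forms_2 lab k S \<nu>" "linear_forms_3 k S \<nu>"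
      using assms(6) by (auto simp: linear_forms_conditions_def)
    have "\<forall>\<^sub>F N in primes_at_top. prime N"
      unfolding primes_at_top_def by (simp add: eventually_inf_principal)
    moreover have "\<forall>\<^sub>F N in primes_at_top. real (S N) / real (D N) < \<sigma>"
      by (rule order_tendstoD(2)[OF assms(5) \<sigma>])
    moreover note assms(3,4)
    moreover note lf(1)[unfolded linear_forms_1_def, rule_format, OF two \<eta>01(1)]
      lf(2)[unfolded linear_forms_2_def, rule_format, OF two \<eta>01(1)]
      lf(3)[unfolded linear_forms_3_def, rule_format, OF two \<eta>01(1)]
    ultimately show ?thesis
    proof eventually_elim
      case (elim N)
      let ?D = "real (D N)"
      \<comment> \<open>The side \<open>M\<close> is about \<open>q * D\<close>: small enough for
        \<open>M / D \<le> \<rho>\<close>, and large enough that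
        \<open>r \<ge> y / 4 \<ge> S\<close>.\<close>
      define y where "y = q * ?D"
      define M where "M = nat \<lfloor>y\<rfloor>"
      define r where "r = (real M - 1) / 2"
      have N: "0 < N" using elim(1) by (simp add: prime_gt_0_nat)
      have D0: "0 < ?D" and S2: "2 \<le> real (S N)" using elim(4) by auto
      have SD: "real (S N) < \<sigma> * ?D" using elim(2) D0 by (simp add: divide_less_eq)
      have k3: "3 \<le> real k + 1" using assms(1) by simp
      have "2 < \<sigma> * ?D" using SD S2 by linarith
      then have big: "16 * (real k + 1) < q\<^sup>2 * ?D" unfolding \<sigma>_def by (simp add: field_simps)
      have q2: "q\<^sup>2 * ?D \<le> y" using q D0 by (simp add: y_def power2_eq_square mult_right_mono mult_left_le_one_le)
      have "48 \<le> 16 * (real k + 1)" using k3 by simp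
      also note big
      also note q2
      finally have qD: "48 \<le> y" by simp
      have "\<sigma> * ?D \<le> y / 4"
      proof -
        have "\<sigma> * ?D = q\<^sup>2 * ?D / (8 * (real k + 1))" by (simp add: \<sigma>_def)
        also have "\<dots> \<le> y / 4"
          by (rule frac_le) (use q2 qD k3 in auto)
        finally show ?thesis .
      qed
      then have S: "real (S N) \<le> y / 4" using SD by linarith
      have My: "real M \<le> y" "y - 1 < real M" unfolding M_def using qD by linarith+
      have r: "y / 4 \<le> r" unfolding r_def using My(2) qD by (simp add: field_simps)
      have qD1: "y \<le> ?D" using q D0 by (simp add: y_def mult_left_le_one_le)
      have "ap_pseudorandom (\<lambda>i. int (lab i)) (fact k) N (int M) (int (D N)) (at_residue N (\<nu> N)) \<eta>"
      proof (rule ap_pseudorandom_of_linear_forms[where C = 2 and r = r and S = "real (S N)"])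
        show "1 \<le> r" "real (S N) \<le> r" "2 * r \<le> real M - 1" "M \<le> D N"
          using r qD S My(1) qD1 by (auto simp: r_def)
        have "real (D N) + real k * real M \<le> (real k + 1) * ?D"
          using mult_left_mono[of "real M" ?D "real k"] My(1) qD1 by (simp add: algebra_simps)
        also have "\<dots> \<le> (q\<^sup>2 * ?D / 16) * ?D" using big by (intro mult_right_mono) auto
        also have "\<dots> = (y / 4)\<^sup>2" by (simp add: y_def power2_eq_square)
        also have "\<dots> \<le> r\<^sup>2" using r qD by (intro power_mono) auto
        finally show "real (D N) + real k * real M \<le> r powr 2" using r qD by simp
      next
        show "0 \<le> \<nu> N x" if "x \<in> ZMod N" for x using elim(3) that by force
      next
        fix \<Omega> :: "((real ^ 'k) \<times> (real ^ 'k)) set" and e :: "'k \<Rightarrow> ('k \<Rightarrow> nat) \<Rightarrow> nat"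
        assume "admissible_body (real (S N)) 2 \<Omega>" "int_points_pair \<Omega> \<noteq> {}"
          "\<forall>j. \<forall>\<omega> \<in> (UNIV - {j}) \<rightarrow>\<^sub>E {0, 1}. e j \<omega> \<in> {0, 1}"
        then show "\<bar>avg (ZMod N) (\<lambda>n. avg (int_points_pair \<Omega>) (\<lambda>p.
            \<Prod>j\<in>UNIV. \<Prod>\<omega> \<in> (UNIV - {j}) \<rightarrow>\<^sub>E {0, 1}.
              at_residue N (\<nu> N) (n + psi_at lab j (select p \<omega>)) ^ e j \<omega>)) - 1\<bar> < \<eta>"
          using elim(5) by blast
      next
        fix \<Omega> :: "((real ^ 'k) \<times> (real ^ 'k)) set" and e :: "('k \<Rightarrow> nat) \<Rightarrow> nat"
        assume "admissible_body (real (S N)) 2 \<Omega>" "int_points_pair \<Omega> \<noteq> {}"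
          "\<forall>\<omega> \<in> UNIV \<rightarrow>\<^sub>E {0, 1}. e \<omega> \<in> {0, 1}"
        then show "\<bar>avg (ZMod N) (\<lambda>n. avg (int_points_pair \<Omega>) (\<lambda>p.
            \<Prod>\<omega> \<in> UNIV \<rightarrow>\<^sub>E {0, 1}.
              at_residue N (\<nu> N) (n + psi k (select p \<omega>)) ^ e \<omega>)) - 1\<bar> < \<eta>"
          using elim(6) by blast
      next
        fix \<Omega> :: "(real \<times> real) set" and e :: nat and e' :: "nat \<Rightarrow> nat \<Rightarrow> nat" and j
        assume "j \<in> {1..k}" "admissible_body (real (S N)) 2 \<Omega>" "int_points_plane \<Omega> \<noteq> {}"
          "e \<in> {0, 1}" "\<forall>i\<in>{1..k} - {j}. \<forall>t\<in>{0, 1}. e' i t \<in> {0, 1}"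
        then show "\<bar>avg (ZMod N) (\<lambda>n. at_residue N (\<nu> N) n ^ e * avg (int_points_plane \<Omega>) (\<lambda>p.
            \<Prod>i\<in>{1..k} - {j}. \<Prod>t\<in>{0, 1}.
              at_residue N (\<nu> N) (n + (int i - int j) * pick p t) ^ e' i t)) - 1\<bar> < \<eta>"
          using elim(7) by blast
      qed (use N assms \<eta>01 in auto)
      then interpret ap_pseudorandom "\<lambda>i. int (lab i)" "fact k" N "int M" "int (D N)" "at_residue N (\<nu> N)" \<eta> .
      let ?f = "at_residue N (f N)"
      have f: "0 \<le> ?f x" "?f x \<le> at_residue N (\<nu> N) x" for x
        using elim(3) N by (auto simp: at_residue_def ZMod_eq)
      obtain h where h: "\<And>x. 0 \<le> h x \<and> h x \<le> 1" "periodic N h" "\<bar>E ?f - E h\<bar> \<le> \<epsilon> / 2"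
        "\<bar>count (\<lambda>_. ?f) - count (\<lambda>_. h)\<bar> \<le> \<epsilon> / 2"
      proof -
        have "real_of_int (int M) / real_of_int (int (D N)) \<le> \<rho>"
        proof -
          have "y \<le> \<rho> * ?D" unfolding y_def using q D0 by (intro mult_right_mono) auto
          then have "real M \<le> \<rho> * ?D" using My(1) by linarith
          then show ?thesis using D0 by (simp add: divide_le_eq)
        qed
        moreover have "periodic N ?f" by (simp add: periodic_def at_residue_def)
        ultimately show ?thesis
          using tr[OF ap_pseudorandom_axioms \<eta>01(3), of ?f] f that by blast
      qed
      have res: "at_residue N h = h" using periodic_mod[OF h(2)] by (simp add: at_residue_def fun_eq_iff)
      have "avg (ZMod N) (f N) = E ?f" unfolding ZMod_eq[OF N] by (rule avg_cong) (simp add: at_residue_def)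
      then have "e N h \<le> \<epsilon>"
        using h(3,4) unfolding e_def Lambda_eq_count[OF ap_system_axioms assms(2)] res ZMod_eq[OF N] by simp
      then show ?case using h(1) by blast
    qed
  qed
  obtain f' where f': "\<And>N. f' N \<in> ?A" "((\<lambda>N. e N (f' N)) \<longlongrightarrow> 0) primes_at_top"
    by (rule eventually_small_choice[of primes_at_top e ?A])
       (use small in \<open>auto simp: primes_at_top_def e_def intro!: exI[of _ "\<lambda>_. 0"]\<close>)
  show ?thesis
  proof (intro exI[of _ f'] conjI)
    show "\<forall>N. prime N \<longrightarrow> (\<forall>x\<in>ZMod N. f' N x \<in> {0..1})" using f'(1) by auto
    show "((\<lambda>N. avg (ZMod N) (f N) - avg (ZMod N) (f' N)) \<longlongrightarrow> 0) primes_at_top"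
      by (rule Lim_null_comparison[OF _ f'(2)]) (auto simp: e_def)
    show "((\<lambda>N. \<bar>Lambda N k (D N) (\<lambda>_. f N) - Lambda N k (D N) (\<lambda>_. f' N)\<bar>) \<longlongrightarrow> 0) primes_at_top"
      by (rule Lim_null_comparison[OF _ f'(2)]) (auto simp: e_def)
  qed
qed

end
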